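(* Let $T>0$ and let $\alpha_1,\alpha_2\in(0,2]$ satisfy $\max\{\alpha_1,\alpha_2\}>1$. Let $X^{\alpha_1}=\{X^{\alpha_1}_t,t\ge 0\}$ and $\widetilde X^{\alpha_2}=\{\widetilde X^{\alpha_2}_t,t\ge 0\}$ be two independent real-valued symmetric stable processes with indices $\alpha_1$ and $\alpha_2$ respectively, and let $\widetilde L(T)$ be their collision local time on $[0,T]$. For $z\in\mathbb{C}\setminus(-\infty,0]$ put $$\Phi(z)=\int_{\mathbb{R}}\frac{1}{z+T|v|^{\alpha_1}+T|v|^{\alpha_2}}\,dv .$$ Then, if $\min\{\alpha_1,\alpha_2\}<1$, $$\lim_{\varepsilon\downarrow 0}\varepsilon^{-1}P(\widetilde L(T)\le\varepsilon)=\frac{2}{T}\int_0^{+\infty}\frac{\mathrm{Im}\big\{e^{i\frac{r}{\sqrt2}}\Phi(re^{-i\frac{3\pi}{4}})\big\}}{|\Phi(re^{i\frac{3\pi}{4}})|^2}\cdot\frac{e^{-\frac{1}{\sqrt2}r}}{r}\,dr+\frac{3\pi}{2\int_{\mathbb{R}}\frac{1}{|v|^{\alpha_1}+|v|^{\alpha_2}}\,dv},$$ and, if $\min\{\alpha_1,\alpha_2\}\ge 1$, $$\lim_{\varepsilon\downarrow 0}\varepsilon^{-1}P(\widetilde L(T)\le\varepsilon)=\frac{2}{T}\int_0^{+\infty}\frac{\mathrm{Im}\big\{e^{i\frac{r}{\sqrt2}}\Phi(re^{-i\frac{3\pi}{4}})\big\}}{|\Phi(re^{i\frac{3\pi}{4}})|^2}\cdot\frac{e^{-\frac{1}{\sqrt2}r}}{r}\,dr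 .$$
   Context: All processes live on a complete probability space $(\Omega,\mathcal F,P)$ with a filtration $(\mathcal F_t)$. A symmetric $\alpha$-stable process with $\alpha\in(0,2]$ is an $(\mathcal F_t)$-adapted real-valued process $X=\{X_t,t\ge0\}$ with sample paths in the Skorokhod space $D[0,\infty)$ (right-continuous with left limits), $X_0=0$, and $E[e^{iu(X_t-X_s)}\mid\mathcal F_s]=e^{-(t-s)|u|^{\alpha}}$ for all $t>s\ge0$ and $u\in\mathbb{R}$. Collision local time: for $\varepsilon>0$ let $p_\varepsilon(x)=(2\pi\varepsilon)^{-1/2}e^{-x^2/(2\varepsilon)}$, $x\in\mathbb{R}$, and $\widetilde L_\varepsilon(T)=\int_0^T p_\varepsilon(X^{\alpha_1}_t-\widetilde X^{\alpha_2}_t)\,dt$. The collision local time $\widetilde L(T)$ (formally $\int_0^T\delta(X^{\alpha_1}_t-\widetilde X^{\alpha_2}_t)\,dt$ with $\delta$ the Dirac function) is the limit of $\widetilde L_\varepsilon(T)$ in $L^2(P)$ as $\varepsilon\downarrow0$; this limit exists when $\max\{\alpha_1,\alpha_2\}>1$, and is a non-negative random variable. $\mathrm{Im}$ denotes the imaginary part. *)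

theory Defs
  imports "HOL-Probability.Probability"
begin

text \<open>Time is \<open>[0, \<infinity>)\<close>, represented by type \<^typ>\<open>real\<close>: values of processes and
  filtrations at negative times are never referred to.  Of the measures \<open>F t\<close> only the
  underlying sigma-algebra matters.\<close>

definition filtration_on :: "'a measure \<Rightarrow> (real \<Rightarrow> 'a measure) \<Rightarrow> bool" where
  "filtration_on M F \<longleftrightarrow>
     (\<forall>t\<ge>0. subalgebra M (F t)) \<and>
     (\<forall>s t. 0 \<le> s \<and> s \<le> t \<longrightarrow> subalgebra (F t) (F s))"

definition adapted_to :: "(real \<Rightarrow> 'a measure) \<Rightarrow> (real \<Rightarrow> 'a \<Rightarrow> real) \<Rightarrow> bool" where
  "adapted_to F X \<longleftrightarrow> (\<forall>t\<ge>0. X t \<in> borel_measurable (F t))"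

definition cadlag :: "(real \<Rightarrow> real) \<Rightarrow> bool" where
  "cadlag x \<longleftrightarrow>
     (\<forall>t\<ge>0. (x \<longlongrightarrow> x t) (at_right t)) \<and>
     (\<forall>t>0. \<exists>l. (x \<longlongrightarrow> l) (at_left t))"

definition complex_cond_exp ::
  "'a measure \<Rightarrow> 'a measure \<Rightarrow> ('a \<Rightarrow> complex) \<Rightarrow> 'a \<Rightarrow> complex" where
  "complex_cond_exp M G f = (\<lambda>\<omega>.
     Complex (real_cond_exp M G (\<lambda>x. Re (f x)) \<omega>) (real_cond_exp M G (\<lambda>x. Im (f x)) \<omega>))"

definition symmetric_stable_process ::
  "'a measure \<Rightarrow> (real \<Rightarrow> 'a measure) \<Rightarrow> real \<Rightarrow> (real \<Rightarrow> 'a \<Rightarrow> real) \<Rightarrow> bool" where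
  "symmetric_stable_process M F \<alpha> X \<longleftrightarrow>
     0 < \<alpha> \<and> \<alpha> \<le> 2 \<and>
     adapted_to F X \<and>
     (\<forall>\<omega>\<in>space M. cadlag (\<lambda>t. X t \<omega>)) \<and>
     (\<forall>\<omega>\<in>space M. X 0 \<omega> = 0) \<and>
     (\<forall>s t u. 0 \<le> s \<and> s < t \<longrightarrow>
        (AE \<omega> in M.
           complex_cond_exp M (F s) (\<lambda>\<omega>. exp (\<i> * of_real (u * (X t \<omega> - X s \<omega>)))) \<omega>
             = of_real (exp (- (t - s) * \<bar>u\<bar> powr \<alpha>))))"

text \<open>Independence as random elements of path space with the cylinder sigma-algebra (which on
  cadlag paths is the Borel sigma-algebra of the Skorokhod topology).\<close>

definition independent_processes ::
  "'a measure \<Rightarrow> (real \<Rightarrow> 'a \<Rightarrow> real) \<Rightarrow> (real \<Rightarrow> 'a \<Rightarrow> real) \<Rightarrow> bool" where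
  "independent_processes M X Y \<longleftrightarrow>
     prob_space.indep_var M
       (Pi\<^sub>M {0..} (\<lambda>_. borel)) (\<lambda>\<omega>. \<lambda>t\<in>{0..}. X t \<omega>)
       (Pi\<^sub>M {0..} (\<lambda>_. borel)) (\<lambda>\<omega>. \<lambda>t\<in>{0..}. Y t \<omega>)"

text \<open>The Gaussian kernel \<open>p\<^sub>\<epsilon>\<close> has variance \<open>\<epsilon>\<close>, i.e. standard deviation \<open>sqrt \<epsilon>\<close>.\<close>

definition approx_collision_local_time ::
  "(real \<Rightarrow> 'a \<Rightarrow> real) \<Rightarrow> (real \<Rightarrow> 'a \<Rightarrow> real) \<Rightarrow> real \<Rightarrow> real \<Rightarrow> 'a \<Rightarrow> real" where
  "approx_collision_local_time X Y T \<epsilon> \<omega> =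
     (LINT t:{0..T}|lborel. normal_density 0 (sqrt \<epsilon>) (X t \<omega> - Y t \<omega>))"

text \<open>An \<open>L\<^sup>2\<close> limit is unique only up to null sets, so \<open>L\<close> ranges over its versions.  The
  extended integral makes an infinite \<open>L\<^sup>2\<close> distance count as infinite rather than 0.\<close>

definition is_collision_local_time ::
  "'a measure \<Rightarrow> (real \<Rightarrow> 'a \<Rightarrow> real) \<Rightarrow> (real \<Rightarrow> 'a \<Rightarrow> real) \<Rightarrow> real \<Rightarrow> ('a \<Rightarrow> real) \<Rightarrow> bool" where
  "is_collision_local_time M X Y T L \<longleftrightarrow>
     L \<in> borel_measurable M \<and>
     ((\<lambda>\<epsilon>. \<integral>\<^sup>+ \<omega>. ennreal ((approx_collision_local_time X Y T \<epsilon> \<omega> - L \<omega>)\<^sup>2) \<partial>M)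
        \<longlongrightarrow> 0) (at_right 0)"

definition Phi :: "real \<Rightarrow> real \<Rightarrow> real \<Rightarrow> complex \<Rightarrow> complex" where
  "Phi \<alpha>\<^sub>1 \<alpha>\<^sub>2 T z =
     (LINT v|lborel. 1 / (z + of_real (T * \<bar>v\<bar> powr \<alpha>\<^sub>1) + of_real (T * \<bar>v\<bar> powr \<alpha>\<^sub>2)))"

definition main_term :: "real \<Rightarrow> real \<Rightarrow> real \<Rightarrow> real" where
  "main_term \<alpha>\<^sub>1 \<alpha>\<^sub>2 T =
     2 / T * (LINT r:{0<..}|lborel.
       Im (exp (\<i> * of_real (r / sqrt 2)) * Phi \<alpha>\<^sub>1 \<alpha>\<^sub>2 T (of_real r * exp (- \<i> * of_real (3 * pi / 4))))
         / (cmod (Phi \<alpha>\<^sub>1 \<alpha>\<^sub>2 T (of_real r * exp (\<i> * of_real (3 * pi / 4)))))\<^sup>2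
         * (exp (- (1 / sqrt 2) * r) / r))"

end

theory Submission
  imports Defs "HOL-Complex_Analysis.Complex_Analysis"
begin

text \<open>The difference \<open>Z = X - Y\<close> is a Levy process with exponent \<open>\<psi>(v) = |v|^\<alpha>\<^sub>1 + |v|^\<alpha>\<^sub>2\<close>.  For
  \<open>V\<close> the Gaussian kernel and \<open>A\<close> its occupation integral along \<open>Z\<close>, the identity
  \<open>exp (- \<mu> A\<^sub>t) = 1 - \<mu> \<integral>\<^sub>0\<^sup>t V(Z\<^sub>s) exp (- \<mu> A\<^sub>s) ds\<close> and the Markov property give a closed equation for
  the Laplace transform in \<open>t\<close> of \<open>E[exp (i u Z\<^sub>t) exp (- \<mu> A\<^sub>t)]\<close>.  When \<open>V\<close> concentrates at 0 it yields
  \<open>\<integral>\<^sub>0\<^sup>\<infinity> e\<^sup>-\<^sup>q\<^sup>t E[exp (- \<mu> L(t))] dt = 1 / (q (1 + \<mu> m(q) / 2\<pi>))\<close> with \<open>m(q) = \<integral> dv / (q + \<psi>(v))\<close>.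
  Multiplying by \<open>\<mu> \<rightarrow> \<infinity>\<close> leaves \<open>2\<pi> / (q m(q))\<close>, and Cauchy's theorem on a sector with half-angle
  \<open>3\<pi>/4\<close> shows that this is the Laplace transform in \<open>T\<close> of the claimed limit; the arc around 0 contributes
  the extra term when \<open>m(0) < \<infinity>\<close>.  Monotonicity in \<open>t\<close> makes the Laplace transform invertible
  in the limit, and Karamata's Tauberian argument passes from \<open>\<mu> E[exp (- \<mu> L)]\<close> to \<open>P(L \<le> \<epsilon>) / \<epsilon>\<close>.\<close>

section \<open>Convergence of Laplace transforms of monotone functions\<close>

text \<open>The collision local time is given at the single time \<open>T\<close>, so its Laplace
  transform in time is not at hand. The resolvent computation is carried out for occupation
  integrals of Gaussian width \<sigma>, which exist at all times, and \<sigma> is coupled to \<mu>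
  by a diagonal choice so that both limits are taken at once. At fixed \<sigma> the equations do not
  close at frequency 0: \<open>Sq\<close> at 0 involves \<open>Sq\<close> at every frequency. They
  close in the limit, because a concentrating kernel makes \<open>Sq\<close> lose its dependence on
  the frequency.

  The angle 3\<pi>/4 lies beyond \<pi>/2, where \<open>exp (t * z)\<close> decays, and short of
  \<pi>, where \<open>z + \<psi> v\<close> stays comparable with \<open>cmod z + \<psi> v\<close>.
  At the origin the ray integrand carries a factor \<open>1 / s\<close>; its integrability there
  comes from taking the imaginary part, which is controlled by the derivative of
  \<open>1 / res\<close>. A divergent integral of \<open>1 / \<psi>\<close> is 0 by convention, so
  one formula covers both cases of the theorem.\<close>

lemma set_integrable_exp_mult_continuous:
  fixes f \<phi> :: "real \<Rightarrow> real"
  assumes f: "set_integrable lborel {0<..} (\<lambda>t. exp (-t) * f t)"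
    and \<phi>: "continuous_on {0..1} \<phi>"
  shows "set_integrable lborel {0<..} (\<lambda>t. exp (-t) * \<phi> (exp (-t)) * f t)"
proof -
  obtain B where B: "\<And>x. x \<in> {0..1} \<Longrightarrow> \<bar>\<phi> x\<bar> \<le> \<bar>B\<bar>"
  proof -
    have "bounded (\<phi> ` {0..1})"
      by (rule compact_imp_bounded[OF compact_continuous_image[OF \<phi> compact_Icc]])
    then obtain b where "\<forall>y\<in>\<phi> ` {0..1}. norm y \<le> b"
      unfolding bounded_iff by blast
    then have "\<bar>\<phi> x\<bar> \<le> \<bar>b\<bar>" if "x \<in> {0..1}" for x
      using that by force
    then show thesis by (rule that)
  qed
  have m1: "set_borel_measurable lborel {0<..} (\<lambda>t. \<phi> (exp (-t)))"
    unfolding set_borel_measurable_def using borel_measurable_continuous_on_indicator[of "{0<..}" "\<lambda>t. \<phi> (exp (-t))"]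
      continuous_on_compose2[OF \<phi>, of "{0<..}" "\<lambda>t. exp (-t)"]
    by (force intro!: continuous_intros)
  have fi: "integrable lborel (\<lambda>t. indicat_real {0<..} t *\<^sub>R (exp (-t) * f t))"
    using f unfolding set_integrable_def .
  have "integrable lborel (\<lambda>t. (indicat_real {0<..} t *\<^sub>R \<phi> (exp (-t))) * (indicat_real {0<..} t *\<^sub>R (exp (-t) * f t)))"
  proof (rule Bochner_Integration.integrable_bound[OF integrable_mult_right[OF fi, of B]])
    show "(\<lambda>t. (indicat_real {0<..} t *\<^sub>R \<phi> (exp (-t))) * (indicat_real {0<..} t *\<^sub>R (exp (-t) * f t))) \<in> borel_measurable lborel"
      using m1 fi unfolding set_borel_measurable_def by (intro borel_measurable_times) auto
    show "AE x in lborel. norm ((indicat_real {0<..} x *\<^sub>R \<phi> (exp (-x))) * (indicat_real {0<..} x *\<^sub>R (exp (-x) * f x)))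
        \<le> norm (B * (indicat_real {0<..} x *\<^sub>R (exp (-x) * f x)))"
      using B by (intro always_eventually allI)
        (auto simp: indicator_def abs_mult intro!: mult_right_mono)
  qed
  then show ?thesis unfolding set_integrable_def
    by (rule Bochner_Integration.integrable_cong[THEN iffD1, rotated 2]) (auto simp: indicator_def)
qed

text \<open>With \<open>y = exp (-t)\<close>, a monomial \<open>y ^ k\<close> under the weight
  \<open>exp (-t)\<close> is the transform at \<open>k + 1\<close>, so the hypothesis covers all
  polynomial test functions and Weierstrass approximation on [0, 1] does the rest. Nonnegativity of
  \<open>g i\<close> bounds the approximation error uniformly in \<open>i\<close>: the weighted mass
  of \<open>g i\<close> is its transform at 1, which converges.\<close>

lemma laplace_convergence_continuous:
  fixes g :: "'i \<Rightarrow> real \<Rightarrow> real" and f \<phi> :: "real \<Rightarrow> real"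
  assumes g: "\<forall>\<^sub>F i in F. set_integrable lborel {0<..} (\<lambda>t. exp (-t) * g i t) \<and> (\<forall>t>0. 0 \<le> g i t)"
    and f: "set_integrable lborel {0<..} (\<lambda>t. exp (-t) * f t)"
    and lim: "\<And>k. ((\<lambda>i. LINT t:{0<..}|lborel. exp (-(real (Suc k) * t)) * g i t) \<longlongrightarrow>
                (LINT t:{0<..}|lborel. exp (-(real (Suc k) * t)) * f t)) F"
    and \<phi>: "continuous_on {0..1} \<phi>"
  shows "((\<lambda>i. LINT t:{0<..}|lborel. exp (-t) * \<phi> (exp (-t)) * g i t) \<longlongrightarrow>
           (LINT t:{0<..}|lborel. exp (-t) * \<phi> (exp (-t)) * f t)) F"
proof -
  define I where "I \<psi> h = (LINT t:{0<..}|lborel. exp (-t) * \<psi> (exp (-t)) * h t)" for \<psi> h :: "real \<Rightarrow> real"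
  have diff: "\<bar>I \<phi> h - I p h\<bar> \<le> e * (LINT t:{0<..}|lborel. exp (-t) * \<bar>h t\<bar>)"
    if h: "set_integrable lborel {0<..} (\<lambda>t. exp (-t) * h t)" and p: "continuous_on {0..1} p"
      and e: "\<And>x. x \<in> {0..1} \<Longrightarrow> \<bar>\<phi> x - p x\<bar> \<le> e" for h p e
  proof -
    note i1 = set_integrable_exp_mult_continuous[OF h \<phi>]
    note i2 = set_integrable_exp_mult_continuous[OF h p]
    have i3: "set_integrable lborel {0<..} (\<lambda>t. exp (-t) * \<bar>h t\<bar>)"
      using set_integrable_abs[OF h] by (simp add: abs_mult)
    have "I \<phi> h - I p h = (LINT t:{0<..}|lborel. exp (-t) * \<phi> (exp (-t)) * h t - exp (-t) * p (exp (-t)) * h t)"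
      unfolding I_def using i1 i2 by (rule set_integral_diff(2)[symmetric])
    also have "\<bar>\<dots>\<bar> \<le> (LINT t:{0<..}|lborel. e * (exp (-t) * \<bar>h t\<bar>))"
      unfolding real_norm_def[symmetric]
    proof (rule order_trans[OF set_integral_norm_bound set_integral_mono])
      show "set_integrable lborel {0<..} (\<lambda>t. exp (-t) * \<phi> (exp (-t)) * h t - exp (-t) * p (exp (-t)) * h t)"
        by (intro set_integral_diff i1 i2)
      then show "set_integrable lborel {0<..} (\<lambda>t. norm (exp (-t) * \<phi> (exp (-t)) * h t - exp (-t) * p (exp (-t)) * h t))"
        by (rule set_integrable_norm)
      show "set_integrable lborel {0<..} (\<lambda>t. e * (exp (-t) * norm (h t)))"
        using i3 by simp
      fix t :: real assume "t \<in> {0<..}"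
      have "norm (exp (-t) * \<phi> (exp (-t)) * h t - exp (-t) * p (exp (-t)) * h t)
        = \<bar>\<phi> (exp (-t)) - p (exp (-t))\<bar> * (exp (-t) * \<bar>h t\<bar>)"
        unfolding left_diff_distrib[symmetric] right_diff_distrib[symmetric] by (simp add: abs_mult mult_ac)
      also have "\<dots> \<le> e * (exp (-t) * \<bar>h t\<bar>)" using e \<open>t \<in> _\<close> by (intro mult_right_mono) auto
      finally show "norm (exp (-t) * \<phi> (exp (-t)) * h t - exp (-t) * p (exp (-t)) * h t) \<le> e * (exp (-t) * norm (h t))"
        by simp
    qed
    finally show ?thesis by simp
  qed
  have poly: "((\<lambda>i. I p (g i)) \<longlongrightarrow> I p f) F" if p0: "real_polynomial_function p" for p
  proof -
    obtain a n where p: "p = (\<lambda>x. \<Sum>k\<le>n. a k * x ^ k)"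
      using p0 unfolding real_polynomial_function_iff_sum by blast
    have eq: "I p h = (\<Sum>k\<le>n. a k * (LINT t:{0<..}|lborel. exp (-(real (Suc k) * t)) * h t))"
      if h: "set_integrable lborel {0<..} (\<lambda>t. exp (-t) * h t)" for h
    proof -
      have ee: "exp (-(real (Suc k) * t)) * h t = exp (-t) * (exp (-t))^k * h t" for k t
      proof -
        have "exp (-(real (Suc k) * t)) = exp (real (Suc k) * (-t))" by simp
        also have "\<dots> = exp (-t) ^ Suc k" by (rule exp_of_nat_mult)
        finally show ?thesis by simp
      qed
      have i: "set_integrable lborel {0<..} (\<lambda>t. exp (-(real (Suc k) * t)) * h t)" for k
        unfolding ee by (rule set_integrable_exp_mult_continuous[OF h]) (intro continuous_intros)
      have "I p h = (LINT t:{0<..}|lborel. (\<Sum>k\<le>n. a k * (exp (-(real (Suc k) * t)) * h t)))"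
        unfolding I_def p ee by (simp add: sum_distrib_left sum_distrib_right mult_ac)
      also have "\<dots> = (\<Sum>k\<le>n. LINT t:{0<..}|lborel. a k * (exp (-(real (Suc k) * t)) * h t))"
        using i unfolding set_lebesgue_integral_def set_integrable_def scaleR_sum_right
        by (intro Bochner_Integration.integral_sum) (simp add: mult.left_commute[of _ "a _"])
      finally show ?thesis by simp
    qed
    have "((\<lambda>i. \<Sum>k\<le>n. a k * (LINT t:{0<..}|lborel. exp (-(real (Suc k) * t)) * g i t)) \<longlongrightarrow> I p f) F"
      unfolding eq[OF f] by (intro tendsto_intros lim)
    then show ?thesis
      by (rule Lim_transform_eventually) (use g eq in \<open>auto elim!: eventually_mono\<close>)
  qed
  define C where "C = (LINT t:{0<..}|lborel. exp (-t) * \<bar>f t\<bar>)"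
  define D where "D = (LINT t:{0<..}|lborel. exp (-t) * f t)"
  have C0: "C \<ge> 0" unfolding C_def set_lebesgue_integral_def by (rule integral_nonneg_AE) auto
  have D: "((\<lambda>i. LINT t:{0<..}|lborel. exp (-t) * g i t) \<longlongrightarrow> D) F"
    using lim[of 0] unfolding D_def by simp
  have "((\<lambda>i. I \<phi> (g i)) \<longlongrightarrow> I \<phi> f) F"
  proof (rule tendstoI)
    fix r :: real assume r: "r > 0"
    \<comment> \<open>The bracket is at least as large as both masses involved, eventually
      \<open>\<bar>D\<bar> + 1\<close> for \<open>g i\<close> and \<open>C\<close> for
      \<open>f\<close>, so each replacement of \<phi> by \<open>p\<close> costs at most
      \<open>r / 3\<close>.\<close>
    define e where "e = r / (3 * (\<bar>D\<bar> + C + 1))"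
    have e: "e > 0" unfolding e_def using r C0 by simp
    obtain p where p: "real_polynomial_function p" "\<And>x. x \<in> {0..1} \<Longrightarrow> \<bar>\<phi> x - p x\<bar> < e"
      using Stone_Weierstrass_real_polynomial_function[OF compact_Icc \<phi> e] by blast
    have pc: "continuous_on {0..1} p"
      by (rule continuous_on_polymonial_function) (use p(1) in \<open>simp add: real_polynomial_function_eq\<close>)
    have 1: "\<forall>\<^sub>F i in F. \<bar>I p (g i) - I p f\<bar> < r / 3"
      using tendstoD[OF poly[OF p(1)], of "r/3"] r by (simp add: dist_real_def)
    have 2: "\<forall>\<^sub>F i in F. (LINT t:{0<..}|lborel. exp (-t) * g i t) < \<bar>D\<bar> + 1"
      by (rule order_tendstoD[OF D]) auto
    have e3: "e * (\<bar>D\<bar> + 1) \<le> r / 3" "e * C \<le> r / 3"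
    proof -
      have *: "r / (3 * d) * c \<le> r / 3" if "0 \<le> c" "c \<le> d" "0 < d" for c d
        using that r by (simp add: field_simps)
      show "e * (\<bar>D\<bar> + 1) \<le> r / 3" unfolding e_def by (rule *) (use C0 in auto)
      show "e * C \<le> r / 3" unfolding e_def by (rule *) (use C0 in auto)
    qed
    show "\<forall>\<^sub>F i in F. dist (I \<phi> (g i)) (I \<phi> f) < r"
      using 1 2 g
    proof eventually_elim
      case (elim i)
      have "(LINT t:{0<..}|lborel. exp (-t) * \<bar>g i t\<bar>) = (LINT t:{0<..}|lborel. exp (-t) * g i t)"
        by (rule set_lebesgue_integral_cong) (use elim in auto)
      then have "\<bar>I \<phi> (g i) - I p (g i)\<bar> \<le> e * (LINT t:{0<..}|lborel. exp (-t) * g i t)"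
        using diff[of "g i" p e] elim pc p(2) by (simp add: less_imp_le)
      also have "\<dots> \<le> e * (\<bar>D\<bar> + 1)" using elim e by (intro mult_left_mono) auto
      also note e3(1)
      finally have 3: "\<bar>I \<phi> (g i) - I p (g i)\<bar> \<le> r / 3" .
      have 4: "\<bar>I \<phi> f - I p f\<bar> \<le> r / 3"
        using diff[OF f pc, of e] p(2) e3(2) unfolding C_def by (force simp: less_imp_le)
      show ?case using elim(1) 3 4 unfolding dist_real_def by linarith
    qed
  qed
  then show ?thesis unfolding I_def .
qed


text \<open>Monotonicity traps the value at \<open>T\<close> between weighted averages of
  \<open>g i\<close> over short windows just left and just right of \<open>T\<close>; the averages
  converge by the previous lemma, to limits within the oscillation of \<open>f\<close> near
  \<open>T\<close>. The sign \<sigma> treats increasing and decreasing families together: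
  distribution functions increase in their argument, while \<open>gk\<close> decreases in
  time.\<close>

lemma laplace_convergence_monotone:
  fixes g :: "'i \<Rightarrow> real \<Rightarrow> real" and f :: "real \<Rightarrow> real" and \<sigma> T :: real
  assumes g: "\<forall>\<^sub>F i in F. set_integrable lborel {0<..} (\<lambda>t. exp (-t) * g i t) \<and> (\<forall>t>0. 0 \<le> g i t)"
    and f: "set_integrable lborel {0<..} (\<lambda>t. exp (-t) * f t)"
    and lim: "\<And>k. ((\<lambda>i. LINT t:{0<..}|lborel. exp (-(real (Suc k) * t)) * g i t) \<longlongrightarrow>
                (LINT t:{0<..}|lborel. exp (-(real (Suc k) * t)) * f t)) F"
    and \<sigma>: "\<bar>\<sigma>\<bar> = 1"
    and mono: "\<forall>\<^sub>F i in F. \<forall>s t. 0 < s \<and> s \<le> t \<longrightarrow> \<sigma> * g i s \<le> \<sigma> * g i t"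
    and T: "T > 0" and cont: "isCont f T"
  shows "((\<lambda>i. g i T) \<longlongrightarrow> f T) F"
proof (rule tendstoI)
  fix r :: real assume r: "r > 0"
  obtain d where d: "d > 0" "\<And>t. \<bar>t - T\<bar> < d \<Longrightarrow> \<bar>f t - f T\<bar> < r / 2"
    using cont r unfolding continuous_at_eps_delta dist_real_def by (meson half_gt_zero)
  define e where "e = min d (T / 2)"
  have e: "e > 0" "e < T" "e \<le> d" unfolding e_def using d T by auto
  have main: "\<exists>w B. B > 0 \<and> (\<forall>t. 0 \<le> w t) \<and> (\<forall>t. t \<le> a \<or> b \<le> t \<longrightarrow> w t = 0) \<and>
       set_integrable lborel {0<..} w \<and> (LINT t:{0<..}|lborel. w t) = B \<and>
       (\<forall>\<^sub>F i in F. set_integrable lborel {0<..} (\<lambda>t. w t * g i t)) \<and>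
       (\<forall>\<^sub>F i in F. \<bar>(LINT t:{0<..}|lborel. w t * g i t) - f T * B\<bar> < r * B)"
    if ab: "0 < a" "a < b" "\<And>t. a < t \<Longrightarrow> t < b \<Longrightarrow> \<bar>f t - f T\<bar> < r / 2" for a b
  proof -
    \<comment> \<open>A continuous bump in the variable \<open>y = exp (-t)\<close>, positive
      exactly for \<open>t\<close> strictly between \<open>a\<close> and \<open>b\<close>.\<close>
    define \<phi> where "\<phi> y = max 0 ((y - exp (-b)) * (exp (-a) - y))" for y :: real
    define w where "w t = exp (-t) * \<phi> (exp (-t))" for t :: real
    define B where "B = (LINT t:{0<..}|lborel. w t)"
    have \<phi>c: "continuous_on {0..1} \<phi>" unfolding \<phi>_def by (intro continuous_intros)
    have w0: "0 \<le> w t" for t unfolding w_def \<phi>_def by simp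
    have wz: "w t = 0" if "t \<le> a \<or> b \<le> t" for t
    proof -
      have "(exp (-t) - exp (-b)) * (exp (-a) - exp (-t)) \<le> 0"
        using that
      proof
        assume "t \<le> a" then show ?thesis using ab(2) by (intro mult_nonneg_nonpos) auto
      next
        assume "b \<le> t" then show ?thesis using ab(2) by (intro mult_nonpos_nonneg) auto
      qed
      then show ?thesis unfolding w_def \<phi>_def by simp
    qed
    have wp: "0 < w t" if "a < t" "t < b" for t
      using that unfolding w_def \<phi>_def by (auto intro!: mult_pos_pos simp: less_max_iff_disj)
    have one: "set_integrable lborel {0<..} (\<lambda>t::real. exp (-t) * 1)"
      using integrable_I0i_exp_mscale[of 1] by (simp add: set_integrable_def)
    have wi: "set_integrable lborel {0<..} w"
      using set_integrable_exp_mult_continuous[OF one \<phi>c] unfolding w_def by simp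
    have "B \<ge> 0" unfolding B_def set_lebesgue_integral_def using w0 by (intro integral_nonneg_AE) auto
    moreover have "B \<noteq> 0"
    proof
      assume "B = 0"
      then have "AE t in lborel. indicator {0<..} t *\<^sub>R w t = 0"
        using wi w0 unfolding B_def set_lebesgue_integral_def set_integrable_def
        by (subst (asm) integral_nonneg_eq_0_iff_AE) (auto simp: indicator_def)
      then have "AE t in lborel. t \<notin> {a<..<b}"
        by eventually_elim (use wp ab(1) in \<open>force simp: indicator_def split: if_splits\<close>)
      then have "emeasure lborel {a<..<b} = 0"
        by (subst (asm) AE_iff_measurable[where N="{a<..<b}"]) auto
      then show False using ab by simp
    qed
    ultimately have B: "B > 0" by simp
    have fi: "set_integrable lborel {0<..} (\<lambda>t. w t * f t)"
      using set_integrable_exp_mult_continuous[OF f \<phi>c] unfolding w_def .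
    have "(LINT t:{0<..}|lborel. w t * f t) - f T * B = (LINT t:{0<..}|lborel. w t * f t - f T * w t)"
      unfolding B_def by (subst set_integral_diff(2)) (use fi wi in auto)
    also have "\<bar>\<dots>\<bar> \<le> (LINT t:{0<..}|lborel. r / 2 * w t)"
      unfolding real_norm_def[symmetric]
    proof (rule order_trans[OF set_integral_norm_bound set_integral_mono])
      show i: "set_integrable lborel {0<..} (\<lambda>t. w t * f t - f T * w t)"
        using fi wi by (intro set_integral_diff) auto
      show "set_integrable lborel {0<..} (\<lambda>t. norm (w t * f t - f T * w t))"
        by (rule set_integrable_norm[OF i])
      show "set_integrable lborel {0<..} (\<lambda>t. r / 2 * w t)" using wi by auto
      fix t :: real
      have "norm (w t * f t - f T * w t) = w t * \<bar>f t - f T\<bar>"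
        using w0[of t] by (simp add: abs_mult[symmetric] algebra_simps abs_mult_pos')
      also have "\<dots> \<le> w t * (r / 2)"
      proof (cases "a < t \<and> t < b")
        case True
        then show ?thesis using ab(3)[of t] w0[of t] by (intro mult_left_mono) linarith+
      next
        case False
        then have "w t = 0" using wz[of t] by linarith
        then show ?thesis by simp
      qed
      finally show "norm (w t * f t - f T * w t) \<le> r / 2 * w t" by (simp add: mult.commute)
    qed
    finally have c1: "\<bar>(LINT t:{0<..}|lborel. w t * f t) - f T * B\<bar> \<le> r / 2 * B"
      unfolding B_def by simp
    have "((\<lambda>i. LINT t:{0<..}|lborel. w t * g i t) \<longlongrightarrow> (LINT t:{0<..}|lborel. w t * f t)) F"
      unfolding w_def by (rule laplace_convergence_continuous[OF g f lim \<phi>c])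
    then have "\<forall>\<^sub>F i in F. \<bar>(LINT t:{0<..}|lborel. w t * g i t) - (LINT t:{0<..}|lborel. w t * f t)\<bar> < r / 2 * B"
      unfolding dist_real_def[symmetric] by (rule tendstoD) (use r B in simp)
    then have c2: "\<forall>\<^sub>F i in F. \<bar>(LINT t:{0<..}|lborel. w t * g i t) - f T * B\<bar> < r * B"
      by eventually_elim (use c1 in linarith)
    have c3: "\<forall>\<^sub>F i in F. set_integrable lborel {0<..} (\<lambda>t. w t * g i t)"
      using g by eventually_elim (unfold w_def, auto intro!: set_integrable_exp_mult_continuous \<phi>c)
    show ?thesis
      by (rule exI[of _ w], rule exI[of _ B]) (use B w0 wz wi B_def c2 c3 in auto)
  qed
  obtain w1 B1 where 1: "B1 > 0" "\<And>t. 0 \<le> w1 t" "\<And>t. t \<le> T \<or> T + e \<le> t \<Longrightarrow> w1 t = 0"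
       "set_integrable lborel {0<..} w1" "(LINT t:{0<..}|lborel. w1 t) = B1"
       "\<forall>\<^sub>F i in F. set_integrable lborel {0<..} (\<lambda>t. w1 t * g i t)"
       "\<forall>\<^sub>F i in F. \<bar>(LINT t:{0<..}|lborel. w1 t * g i t) - f T * B1\<bar> < r * B1"
    using main[of T "T + e"] d e T by (force simp: abs_if)
  obtain w2 B2 where 2: "B2 > 0" "\<And>t. 0 \<le> w2 t" "\<And>t. t \<le> T - e \<or> T \<le> t \<Longrightarrow> w2 t = 0"
       "set_integrable lborel {0<..} w2" "(LINT t:{0<..}|lborel. w2 t) = B2"
       "\<forall>\<^sub>F i in F. set_integrable lborel {0<..} (\<lambda>t. w2 t * g i t)"
       "\<forall>\<^sub>F i in F. \<bar>(LINT t:{0<..}|lborel. w2 t * g i t) - f T * B2\<bar> < r * B2"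
    using main[of "T - e" T] d e T by (force simp: abs_if)
  show "\<forall>\<^sub>F i in F. dist (g i T) (f T) < r"
    using 1(6,7) 2(6,7) mono
  proof eventually_elim
    case (elim i)
    have "\<sigma> * g i T * B1 = (LINT t:{0<..}|lborel. \<sigma> * g i T * w1 t)" using 1(5) by simp
    also have "\<dots> \<le> (LINT t:{0<..}|lborel. \<sigma> * (w1 t * g i t))"
    proof (rule set_integral_mono)
      fix t :: real assume "t \<in> {0<..}"
      then have "w1 t * (\<sigma> * g i T) \<le> w1 t * (\<sigma> * g i t)"
        using elim(5) 1(2,3)[of t] T by (cases "T \<le> t") (auto intro: mult_left_mono)
      then show "\<sigma> * g i T * w1 t \<le> \<sigma> * (w1 t * g i t)" by (simp add: mult_ac)
    qed (use 1(4) elim in auto)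
    finally have u: "\<sigma> * g i T * B1 \<le> \<sigma> * (LINT t:{0<..}|lborel. w1 t * g i t)" by simp
    have "\<sigma> * (LINT t:{0<..}|lborel. w2 t * g i t) = (LINT t:{0<..}|lborel. \<sigma> * (w2 t * g i t))" by simp
    also have "\<dots> \<le> (LINT t:{0<..}|lborel. \<sigma> * g i T * w2 t)"
    proof (rule set_integral_mono)
      fix t :: real assume "t \<in> {0<..}"
      then have "w2 t * (\<sigma> * g i t) \<le> w2 t * (\<sigma> * g i T)"
        using elim(5) 2(2,3)[of t] T by (cases "t \<le> T") (auto intro: mult_left_mono)
      then show "\<sigma> * (w2 t * g i t) \<le> \<sigma> * g i T * w2 t" by (simp add: mult_ac)
    qed (use 2(4) elim in auto)
    finally have l: "\<sigma> * (LINT t:{0<..}|lborel. w2 t * g i t) \<le> \<sigma> * g i T * B2" using 2(5) by simp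
    \<comment> \<open>For \<sigma> = 1 the right window bounds \<open>g i T\<close> from above and
      the left one from below; for \<sigma> = -1 the roles are exchanged.\<close>
    consider "\<sigma> = 1" | "\<sigma> = -1" using \<sigma> by (auto simp: abs_if split: if_splits)
    then have "\<bar>g i T - f T\<bar> < r"
    proof cases
      case 1
      have "g i T * B1 < (f T + r) * B1" "(f T - r) * B2 < g i T * B2"
        using u l elim(2,4) 1 by (simp_all add: algebra_simps abs_less_iff)
      then show ?thesis using \<open>B1 > 0\<close> \<open>B2 > 0\<close> by (simp add: abs_less_iff)
    next
      case 2
      have "g i T * B2 < (f T + r) * B2" "(f T - r) * B1 < g i T * B1"
        using u l elim(2,4) 2 by (simp_all add: algebra_simps abs_less_iff)
      then show ?thesis using \<open>B1 > 0\<close> \<open>B2 > 0\<close> by (simp add: abs_less_iff)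
    qed
    then show ?case by (simp add: dist_real_def)
  qed
qed

section \<open>The potential of a Levy exponent in a sector\<close>

text \<open>Rotation by -\<theta>/2 places the two summands symmetrically about the real axis, at
  angles \<theta>/2 and -\<theta>/2, so both have real part \<open>cos (\<theta> / 2)\<close> times
  their length, and the modulus is at least the real part.\<close>

lemma cmod_sector_ge:
  assumes "r \<ge> 0" "s \<ge> 0"
  shows "cos (\<theta> / 2) * (r + s) \<le> cmod (of_real r * cis \<theta> + of_real s)"
proof -
  have "cis (- (\<theta> / 2)) * cis \<theta> = cis (\<theta> / 2)"
    by (simp add: cis_mult)
  then have eq: "cis (- (\<theta> / 2)) * (of_real r * cis \<theta> + of_real s)
      = of_real r * cis (\<theta> / 2) + of_real s * cis (- (\<theta> / 2))"
    by (simp add: algebra_simps)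
  have "Re (cis (- (\<theta> / 2)) * (of_real r * cis \<theta> + of_real s)) = cos (\<theta> / 2) * (r + s)"
    unfolding eq by (simp add: algebra_simps)
  moreover have "cmod (cis (- (\<theta> / 2)) * (of_real r * cis \<theta> + of_real s)) = cmod (of_real r * cis \<theta> + of_real s)"
    by (simp add: norm_mult)
  ultimately show ?thesis using complex_Re_le_cmod by metis
qed

text \<open>The same rotation applied to the reciprocal: \<open>cis (\<theta> / 2) * cnj w\<close>
  has real part \<open>cos (\<theta> / 2) * (r + s)\<close>, and \<open>cmod w \<le> r + s\<close>.
  A lower bound on a real part, unlike one on a modulus, survives integration over \<open>v\<close>
  with \<open>s = \<psi> v\<close>; this is how \<open>resC\<close> is kept away from 0.\<close>

lemma Re_cis_half_divide_sector:
  assumes "r > 0" "s \<ge> 0" "\<bar>\<theta>\<bar> < pi"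
  shows "cos (\<theta> / 2) * (1 / (r + s)) \<le> Re (cis (\<theta> / 2) * (1 / (of_real r * cis \<theta> + of_real s)))"
proof -
  define w where "w = of_real r * cis \<theta> + (of_real s :: complex)"
  have c: "cos (\<theta> / 2) > 0" using assms(3) by (intro cos_gt_zero_pi) auto
  have "0 < cmod w"
    unfolding w_def by (rule less_le_trans[OF _ cmod_sector_ge]) (use assms c in auto)
  moreover have "cmod w \<le> r + s"
    unfolding w_def by (rule order_trans[OF norm_triangle_ineq]) (use assms in \<open>simp add: norm_mult\<close>)
  ultimately have w2: "0 < (cmod w)\<^sup>2" "(cmod w)\<^sup>2 \<le> (r + s)\<^sup>2" by (auto intro: power_mono)
  have "cis (\<theta> / 2) * cis (- \<theta>) = cis (- (\<theta> / 2))" by (simp add: cis_mult)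
  then have eq: "cis (\<theta> / 2) * cnj w = of_real r * cis (- (\<theta> / 2)) + of_real s * cis (\<theta> / 2)"
    unfolding w_def by (simp add: algebra_simps cis_cnj)
  have "Re (cis (\<theta> / 2) * cnj w) = cos (\<theta> / 2) * (r + s)"
    unfolding eq by (simp add: algebra_simps)
  moreover have "cis (\<theta> / 2) * (1 / w) = cis (\<theta> / 2) * cnj w / of_real ((cmod w)\<^sup>2)"
    using w2(1) by (simp add: complex_norm_square[symmetric] field_simps)
  ultimately have "Re (cis (\<theta> / 2) * (1 / w)) = cos (\<theta> / 2) * (r + s) / (cmod w)\<^sup>2"
    by (simp del: times_complex.simps)
  also have "\<dots> \<ge> cos (\<theta> / 2) * (r + s) / (r + s)\<^sup>2"
    using w2 c assms by (intro divide_left_mono mult_nonneg_nonneg mult_pos_pos) auto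
  finally show ?thesis using assms unfolding w_def by (simp add: power2_eq_square)
qed

text \<open>The sector bound at angle \<open>Arg z\<close> is perturbed to a disc around
  \<open>z\<close> whose radius is proportional to \<open>cmod z\<close>. One constant serves all
  \<open>s \<ge> 0\<close>, and this uniformity controls difference quotients under the
  integral.\<close>

lemma nonpos_Reals_bounded_below:
  assumes "z \<notin> \<real>\<^sub>\<le>\<^sub>0"
  obtains c where "c > 0" "\<And>z' s. cmod (z' - z) \<le> c * cmod z \<Longrightarrow> s \<ge> 0 \<Longrightarrow> c * (cmod z + s) \<le> cmod (z' + of_real s)"
proof -
  have z0: "z \<noteq> 0" using assms by auto
  define d where "d = cos (Arg z / 2)"
  have "Arg z \<noteq> pi" using assms by (auto simp: Arg_eq_pi complex_nonpos_Reals_iff)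
  then have d: "d > 0" unfolding d_def using Arg_bounded[of z] by (intro cos_gt_zero_pi) auto
  have z: "z = of_real (cmod z) * cis (Arg z)" using Arg_eq[OF z0] by (simp add: cis_conv_exp)
  have "d / 2 * (cmod z + s) \<le> cmod (z' + of_real s)" if "cmod (z' - z) \<le> d / 2 * cmod z" "s \<ge> 0" for z' s
  proof -
    have "d * (cmod z + s) \<le> cmod (z + of_real s)"
      unfolding d_def by (subst (2) z) (rule cmod_sector_ge, use that in auto)
    also have "\<dots> \<le> cmod (z' + of_real s) + cmod (z' - z)"
      using norm_triangle_ineq4[of "z' + of_real s" "z' - z"] by (simp add: algebra_simps)
    finally have "d * (cmod z + s) \<le> cmod (z' + of_real s) + d / 2 * cmod z" using that by simp
    moreover have "0 \<le> d / 2 * s" using d that by simp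
    ultimately show ?thesis by (simp add: algebra_simps)
  qed
  then show ?thesis using that[of "d / 2"] d by simp
qed

text \<open>\<open>integrable_psi\<close> is the classical condition for local times at points, here
  finiteness of the potential density at 0. \<open>psi_le\<close> works in the opposite direction:
  it prevents \<open>res\<close> from decaying faster than \<open>1 / sqrt r\<close>, which makes
  the arc at infinity negligible.\<close>

locale levy_exponent =
  fixes \<psi> :: "real \<Rightarrow> real"
  assumes psi_measurable [measurable]: "\<psi> \<in> borel_measurable borel"
    and psi_nonneg: "0 \<le> \<psi> v"
    and psi_pos: "v \<noteq> 0 \<Longrightarrow> 0 < \<psi> v"
    and psi_le: "\<psi> v \<le> 2 * (1 + v\<^sup>2)"
    and integrable_psi: "integrable lborel (\<lambda>v. 1 / (1 + \<psi> v))"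
begin

text \<open>\<open>res r / (2 \<pi>)\<close> is the \<open>r\<close>-potential density at 0 of the Levy process with exponent \<open>\<psi>\<close>.\<close>

definition res :: "real \<Rightarrow> real" where
  "res r = (LINT v|lborel. 1 / (r + \<psi> v))"

text \<open>Minus the derivative of \<open>res\<close>. It also measures the imaginary part of
  \<open>resC\<close> off the real axis.\<close>

definition res2 :: "real \<Rightarrow> real" where
  "res2 r = (LINT v|lborel. 1 / (r + \<psi> v)\<^sup>2)"

definition resC :: "complex \<Rightarrow> complex" where
  "resC z = (LINT v|lborel. 1 / (z + of_real (\<psi> v)))"

lemma res_measurable [measurable]: "res \<in> borel_measurable borel"
  unfolding res_def by measurable

lemma res2_measurable [measurable]: "res2 \<in> borel_measurable borel"
  unfolding res2_def by measurable

lemma resC_measurable [measurable]: "resC \<in> borel_measurable borel"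
  unfolding resC_def by measurable

lemma integrable_res:
  assumes r: "r > 0"
  shows "integrable lborel (\<lambda>v. 1 / (r + \<psi> v))"
proof (rule Bochner_Integration.integrable_bound[OF integrable_mult_right[OF integrable_psi, of "1 / min 1 r"]])
  show "AE v in lborel. norm (1 / (r + \<psi> v)) \<le> norm (1 / min 1 r * (1 / (1 + \<psi> v)))"
  proof (intro always_eventually allI)
    fix v
    have m: "0 < min 1 r" "min 1 r \<le> 1" "min 1 r \<le> r" using r by auto
    have "min 1 r * (1 + \<psi> v) \<le> r + \<psi> v"
      using m psi_nonneg[of v] mult_right_mono[of "min 1 r" 1 "\<psi> v"] by (simp add: distrib_left)
    moreover have "0 < min 1 r * (1 + \<psi> v)" using m psi_nonneg[of v] by (intro mult_pos_pos) auto
    ultimately have "1 / (r + \<psi> v) \<le> 1 / (min 1 r * (1 + \<psi> v))" by (intro divide_left_mono) auto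
    then show "norm (1 / (r + \<psi> v)) \<le> norm (1 / min 1 r * (1 / (1 + \<psi> v)))"
      using m psi_nonneg[of v] r by simp
  qed
qed measurable

lemma integrable_res2:
  assumes r: "r > 0"
  shows "integrable lborel (\<lambda>v. 1 / (r + \<psi> v)\<^sup>2)"
proof (rule Bochner_Integration.integrable_bound[OF integrable_mult_right[OF integrable_res[OF r], of "1 / r"]])
  show "AE v in lborel. norm (1 / (r + \<psi> v)\<^sup>2) \<le> norm (1 / r * (1 / (r + \<psi> v)))"
  proof (intro always_eventually allI)
    fix v
    have "r * (r + \<psi> v) \<le> (r + \<psi> v) * (r + \<psi> v)"
      using r psi_nonneg[of v] by (intro mult_right_mono) auto
    moreover have "0 < r * (r + \<psi> v)" using r psi_nonneg[of v] by (intro mult_pos_pos) auto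
    ultimately have "1 / ((r + \<psi> v) * (r + \<psi> v)) \<le> 1 / (r * (r + \<psi> v))" by (intro divide_left_mono) auto
    then show "norm (1 / (r + \<psi> v)\<^sup>2) \<le> norm (1 / r * (1 / (r + \<psi> v)))"
      using psi_nonneg[of v] r by (simp add: power2_eq_square)
  qed
qed measurable

lemma res_pos:
  assumes r: "r > 0"
  shows "res r > 0"
proof -
  \<comment> \<open>On [0, 1] the quadratic bound gives \<open>\<psi> v \<le> 4\<close>.\<close>
  have "1 / (r + 4) = (LINT v|lborel. indicator {0..1::real} v * (1 / (r + 4)))"
    using r by (simp add: content_real)
  also have "\<dots> \<le> res r" unfolding res_def
  proof (rule integral_mono[OF _ integrable_res[OF r]])
    fix v :: real
    show "indicator {0..1} v * (1 / (r + 4)) \<le> 1 / (r + \<psi> v)"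
    proof (cases "v \<in> {0..1}")
      case True
      then have "v\<^sup>2 \<le> 1" by (simp add: power_le_one)
      then have "\<psi> v \<le> 4" using psi_le[of v] by simp
      then show ?thesis using True r psi_nonneg[of v] by (auto intro!: divide_left_mono mult_pos_pos)
    qed (use r psi_nonneg[of v] in auto)
  qed simp
  finally show ?thesis using r by (smt (verit) divide_pos_pos)
qed

lemma res_antimono:
  assumes "0 < r" "r \<le> s"
  shows "res s \<le> res r"
  unfolding res_def
proof (rule integral_mono[OF integrable_res integrable_res])
  show "1 / (s + \<psi> v) \<le> 1 / (r + \<psi> v)" for v
    using assms psi_nonneg[of v] by (intro divide_left_mono mult_pos_pos) auto
qed (use assms in auto)

text \<open>Only the window \<open>\<bar>v\<bar> \<le> sqrt r\<close> is kept: there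
  \<open>\<psi> v \<le> 2 * (1 + r) \<le> 4 * r\<close>, so the integrand is at least
  \<open>1 / (5 * r)\<close> on a set of length \<open>2 * sqrt r\<close>.\<close>

lemma res_lower_bound:
  assumes "r \<ge> 1"
  shows "2 / (5 * sqrt r) \<le> res r"
proof -
  have sq: "sqrt r > 0" "sqrt r * sqrt r = r" using assms by auto
  have "2 / (5 * sqrt r) = 2 * sqrt r * (1 / (5 * r))"
    using sq by (simp add: field_simps)
  also have "\<dots> = (LINT v|lborel. indicator {- sqrt r..sqrt r} v * (1 / (5 * r)))"
    using sq by simp
  also have "\<dots> \<le> res r" unfolding res_def
  proof (rule integral_mono[OF _ integrable_res])
    fix v :: real
    show "indicator {- sqrt r..sqrt r} v * (1 / (5 * r)) \<le> 1 / (r + \<psi> v)"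
    proof (cases "v \<in> {- sqrt r..sqrt r}")
      case True
      then have "\<bar>v\<bar> \<le> sqrt r" by auto
      then have "v\<^sup>2 \<le> r" using sqrt_ge_absD by blast
      then have "\<psi> v \<le> 4 * r" using psi_le[of v] assms by simp
      then show ?thesis using True assms psi_nonneg[of v] by (auto intro!: divide_left_mono mult_pos_pos)
    qed (use assms psi_nonneg[of v] in auto)
  qed (use assms in auto)
  finally show ?thesis .
qed

lemma integrable_resC:
  fixes z :: complex
  assumes z: "z \<notin> \<real>\<^sub>\<le>\<^sub>0"
  shows "integrable lborel (\<lambda>v. 1 / (z + of_real (\<psi> v)))"
    and "integrable lborel (\<lambda>v. 1 / (z + of_real (\<psi> v))\<^sup>2)"
proof -
  obtain c where c: "c > 0" "\<And>(z'::complex) s. cmod (z' - z) \<le> c * cmod z \<Longrightarrow> s \<ge> 0 \<Longrightarrow> c * (cmod z + s) \<le> cmod (z' + of_real s)"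
    using nonpos_Reals_bounded_below[OF z] by metis
  have z0: "cmod z > 0" using z by auto
  have b: "c * (cmod z + \<psi> v) \<le> cmod (z + of_real (\<psi> v))" for v
    using c(2)[of z "\<psi> v"] c(1) psi_nonneg by simp
  have p: "0 < c * (cmod z + \<psi> v)" for v
    using c(1) z0 psi_nonneg[of v] by (intro mult_pos_pos add_pos_nonneg)
  show "integrable lborel (\<lambda>v. 1 / (z + of_real (\<psi> v)))"
  proof (rule Bochner_Integration.integrable_bound[OF integrable_mult_right[OF integrable_res[OF z0], of "1 / c"]])
    show "AE v in lborel. norm (1 / (z + of_real (\<psi> v))) \<le> norm (1 / c * (1 / (cmod z + \<psi> v)))"
    proof (intro always_eventually allI)
      fix v
      have "1 / cmod (z + of_real (\<psi> v)) \<le> 1 / (c * (cmod z + \<psi> v))"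
        using b[of v] p[of v] by (intro frac_le) auto
      then show "norm (1 / (z + of_real (\<psi> v))) \<le> norm (1 / c * (1 / (cmod z + \<psi> v)))"
        using c(1) psi_nonneg[of v] by (simp add: norm_divide)
    qed
  qed measurable
  show "integrable lborel (\<lambda>v. 1 / (z + of_real (\<psi> v))\<^sup>2)"
  proof (rule Bochner_Integration.integrable_bound[OF integrable_mult_right[OF integrable_res2[OF z0], of "1 / c\<^sup>2"]])
    show "AE v in lborel. norm (1 / (z + of_real (\<psi> v))\<^sup>2) \<le> norm (1 / c\<^sup>2 * (1 / (cmod z + \<psi> v)\<^sup>2))"
    proof (intro always_eventually allI)
      fix v
      have "1 / (cmod (z + of_real (\<psi> v)))\<^sup>2 \<le> 1 / (c * (cmod z + \<psi> v))\<^sup>2"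
        using b[of v] p[of v] by (intro frac_le power_mono zero_less_power) auto
      then show "norm (1 / (z + of_real (\<psi> v))\<^sup>2) \<le> norm (1 / c\<^sup>2 * (1 / (cmod z + \<psi> v)\<^sup>2))"
        using c(1) psi_nonneg[of v] by (simp add: norm_divide norm_power power_mult_distrib)
    qed
  qed measurable
qed

text \<open>With \<open>a\<close> and \<open>a'\<close> the two denominators, the difference
  quotient minus the expected derivative has integrand \<open>(a' - a) / (a' * a\<^sup>2)\<close>,
  which carries a factor \<open>z' - z\<close>. The bound of
  \<open>nonpos_Reals_bounded_below\<close> dominates the remaining factor by an integrable
  function, uniformly near \<open>z\<close>.\<close>

lemma resC_has_field_derivative:
  assumes z: "z \<notin> \<real>\<^sub>\<le>\<^sub>0"
  shows "(resC has_field_derivative - (LINT v|lborel. 1 / (z + of_real (\<psi> v))\<^sup>2)) (at z)"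
proof -
  obtain c where c: "c > 0" "\<And>(z'::complex) s. cmod (z' - z) \<le> c * cmod z \<Longrightarrow> s \<ge> 0 \<Longrightarrow> c * (cmod z + s) \<le> cmod (z' + of_real s)"
    using nonpos_Reals_bounded_below[OF z] by metis
  define r where "r = cmod z"
  have r: "r > 0" unfolding r_def using z by auto
  define D where "D = - (LINT v|lborel. 1 / (z + of_real (\<psi> v))\<^sup>2)"
  \<comment> \<open>From the lower bounds \<open>c * r\<close> for \<open>cmod a'\<close> and
    \<open>c * (r + \<psi> v)\<close> for \<open>cmod a\<close>, the latter squared.\<close>
  define K where "K = 1 / c ^ 3 * (1 / r) * res2 r"
  have bound: "cmod ((resC z' - resC z) / (z' - z) - D) \<le> K * cmod (z' - z)"
    if z': "z' \<noteq> z" "cmod (z' - z) \<le> c * r" for z'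
  proof -
    \<comment> \<open>Otherwise \<open>s = - z'\<close> would make \<open>z' + of_real s\<close>
      vanish, against the lower bound.\<close>
    have "z' \<notin> \<real>\<^sub>\<le>\<^sub>0"
    proof
      assume "z' \<in> \<real>\<^sub>\<le>\<^sub>0"
      then obtain s where s: "s \<ge> 0" "z' = - of_real s"
        by (metis nonpos_Reals_cases of_real_minus minus_minus neg_0_le_iff_le)
      then show False using c(2)[of z' s] z' r c(1) unfolding r_def
        by (smt (verit) add.left_inverse mult_pos_pos norm_zero)
    qed
    note i = integrable_resC[OF z] integrable_resC(1)[OF this]
    have b: "c * (r + \<psi> v) \<le> cmod (z + of_real (\<psi> v))" "c * (r + \<psi> v) \<le> cmod (z' + of_real (\<psi> v))" for v
      using c(2)[of z "\<psi> v"] c(2)[of z' "\<psi> v"] z' c(1) psi_nonneg unfolding r_def by auto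
    have p: "0 < c * (r + \<psi> v)" for v using c(1) r psi_nonneg[of v] by (intro mult_pos_pos) auto
    have "(resC z' - resC z) / (z' - z) - D =
       (LINT v|lborel. (1 / (z' + of_real (\<psi> v)) - 1 / (z + of_real (\<psi> v))) / (z' - z) + 1 / (z + of_real (\<psi> v))\<^sup>2)"
      unfolding D_def resC_def using i by simp
    also have "cmod \<dots> \<le> (LINT v|lborel. cmod (z' - z) * (1 / c ^ 3 * (1 / r)) * (1 / (r + \<psi> v)\<^sup>2))"
    proof (rule order_trans[OF integral_norm_bound integral_mono])
      show "integrable lborel (\<lambda>v. norm ((1 / (z' + of_real (\<psi> v)) - 1 / (z + of_real (\<psi> v))) / (z' - z) + 1 / (z + of_real (\<psi> v))\<^sup>2))"
        using i by (intro integrable_norm Bochner_Integration.integrable_add integrable_divide Bochner_Integration.integrable_diff)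
      show "integrable lborel (\<lambda>v. cmod (z' - z) * (1 / c ^ 3 * (1 / r)) * (1 / (r + \<psi> v)\<^sup>2))"
        by (intro integrable_mult_right integrable_res2 r)
      fix v
      define a where "a = z + of_real (\<psi> v)"
      define a' where "a' = z' + of_real (\<psi> v)"
      have a: "c * (r + \<psi> v) \<le> cmod a" "c * (r + \<psi> v) \<le> cmod a'" using b[of v] unfolding a_def a'_def by auto
      then have a0: "a \<noteq> 0" "a' \<noteq> 0" using p[of v] by auto
      have d: "z' - z = a' - a" unfolding a_def a'_def by simp
      then have "a' \<noteq> a" using z'(1) by auto
      then have "(1 / a' - 1 / a) / (a' - a) + 1 / a\<^sup>2 = (a' - a) / (a' * a\<^sup>2)"
        using a0 by (simp add: divide_simps power2_eq_square) (simp add: algebra_simps)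
      then have "norm ((1 / a' - 1 / a) / (z' - z) + 1 / a\<^sup>2) = cmod (z' - z) * (1 / (cmod a' * (cmod a)\<^sup>2))"
        unfolding d by (simp add: norm_divide norm_mult norm_power)
      also have "\<dots> \<le> cmod (z' - z) * (1 / (c * r * (c * (r + \<psi> v))\<^sup>2))"
      proof (intro mult_left_mono divide_left_mono mult_mono power_mono mult_pos_pos zero_less_power)
        show "c * r \<le> cmod a'" using a(2) c(1) psi_nonneg[of v] by (smt (verit) mult_left_mono)
      qed (use a a0 c(1) r p[of v] psi_nonneg[of v] in \<open>auto intro!: add_pos_nonneg\<close>)
      also have "\<dots> = cmod (z' - z) * (1 / c ^ 3 * (1 / r)) * (1 / (r + \<psi> v)\<^sup>2)"
        by (simp add: power_mult_distrib power3_eq_cube power2_eq_square)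
      finally show "norm ((1 / (z' + of_real (\<psi> v)) - 1 / (z + of_real (\<psi> v))) / (z' - z) + 1 / (z + of_real (\<psi> v))\<^sup>2)
        \<le> cmod (z' - z) * (1 / c ^ 3 * (1 / r)) * (1 / (r + \<psi> v)\<^sup>2)"
        unfolding a_def a'_def .
    qed
    also have "\<dots> = K * cmod (z' - z)" unfolding K_def res2_def
      by (subst integral_mult_right_zero) (simp add: mult_ac)
    finally show ?thesis .
  qed
  have "((\<lambda>z'. (resC z' - resC z) / (z' - z) - D) \<longlongrightarrow> 0) (at z)"
  proof (rule Lim_null_comparison)
    have "((\<lambda>z'. K * cmod (z' - z)) \<longlongrightarrow> K * cmod (z - z)) (at z)" by (intro tendsto_intros)
    then show "((\<lambda>z'. K * cmod (z' - z)) \<longlongrightarrow> 0) (at z)" by simp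
    show "\<forall>\<^sub>F z' in at z. cmod ((resC z' - resC z) / (z' - z) - D) \<le> K * cmod (z' - z)"
      unfolding eventually_at by (rule exI[of _ "c * r"]) (use bound c(1) r in \<open>auto simp: dist_norm\<close>)
  qed
  then show ?thesis
    unfolding has_field_derivative_iff D_def[symmetric] using Lim_null by blast
qed

lemma resC_of_real: "resC (of_real r) = of_real (res r)"
proof -
  have "resC (of_real r) = (LINT v|lborel. complex_of_real (1 / (r + \<psi> v)))"
    unfolding resC_def by simp
  then show ?thesis unfolding res_def by (simp only: integral_complex_of_real)
qed

lemma res_has_real_derivative:
  assumes r: "r > 0"
  shows "(res has_real_derivative - res2 r) (at r)"
proof -
  have z: "complex_of_real r \<notin> \<real>\<^sub>\<le>\<^sub>0" using r by (auto simp: complex_nonpos_Reals_iff)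
  have "(LINT v|lborel. 1 / (complex_of_real r + of_real (\<psi> v))\<^sup>2) = (LINT v|lborel. complex_of_real (1 / (r + \<psi> v)\<^sup>2))"
    by simp
  then have e: "(LINT v|lborel. 1 / (complex_of_real r + of_real (\<psi> v))\<^sup>2) = of_real (res2 r)"
    unfolding res2_def by (simp only: integral_complex_of_real)
  have "((\<lambda>r. resC (of_real r)) has_vector_derivative - of_real (res2 r)) (at r)"
    using resC_has_field_derivative[OF z] unfolding e by (rule has_vector_derivative_real_field)
  then show ?thesis
    using has_field_derivative_Re[of "\<lambda>r. resC (of_real r)" "- of_real (res2 r)" "at r"]
    by (simp add: resC_of_real)
qed

lemma resC_holomorphic: "resC holomorphic_on (- \<real>\<^sub>\<le>\<^sub>0)"
  unfolding holomorphic_on_def field_differentiable_def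
  using resC_has_field_derivative has_field_derivative_at_within by blast

lemma resC_cnj: "resC (cnj z) = cnj (resC z)"
proof -
  have "resC (cnj z) = (LINT v|lborel. cnj (1 / (z + of_real (\<psi> v))))" unfolding resC_def by simp
  also have "\<dots> = cnj (resC z)" unfolding resC_def
    by (rule Bochner_Integration.integral_cnj)
  finally show ?thesis .
qed

lemma cis_notin_nonpos_Reals:
  assumes "r > 0" "\<bar>\<theta>\<bar> < pi"
  shows "of_real r * cis \<theta> \<notin> \<real>\<^sub>\<le>\<^sub>0"
proof
  assume a: "of_real r * cis \<theta> \<in> \<real>\<^sub>\<le>\<^sub>0"
  have "cos (\<theta> / 2) > 0" using assms(2) by (intro cos_gt_zero_pi) auto
  moreover obtain s where s: "s \<ge> 0" "of_real r * cis \<theta> = - of_real s"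
    using a by (metis nonpos_Reals_cases of_real_minus minus_minus neg_0_le_iff_le)
  ultimately show False using cmod_sector_ge[of r s \<theta>] assms(1)
    by (smt (verit) add.left_inverse mult_pos_pos norm_zero)
qed

text \<open>Integrating the pointwise bound on the rotated real part excludes cancellation between
  different \<open>v\<close>, so \<open>resC\<close> has no zero in the slit plane and dominates a
  multiple of \<open>res\<close> on each ray.\<close>

lemma cmod_resC_ge:
  assumes "r > 0" "\<bar>\<theta>\<bar> < pi"
  shows "cos (\<theta> / 2) * res r \<le> cmod (resC (of_real r * cis \<theta>))"
proof -
  note i = integrable_resC(1)[OF cis_notin_nonpos_Reals[OF assms]]
  have "cos (\<theta> / 2) * res r = (LINT v|lborel. cos (\<theta> / 2) * (1 / (r + \<psi> v)))"
    unfolding res_def by (rule integral_mult_right_zero[symmetric])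
  also have "\<dots> \<le> (LINT v|lborel. Re (cis (\<theta> / 2) * (1 / (of_real r * cis \<theta> + of_real (\<psi> v)))))"
    using assms psi_nonneg
    by (intro integral_mono integrable_mult_right integrable_res integrable_Re Re_cis_half_divide_sector i) auto
  also have "\<dots> = Re (LINT v|lborel. cis (\<theta> / 2) * (1 / (of_real r * cis \<theta> + of_real (\<psi> v))))"
    by (intro integral_Re integrable_mult_right i)
  also have "\<dots> = Re (cis (\<theta> / 2) * resC (of_real r * cis \<theta>))"
    unfolding resC_def by (subst integral_mult_right_zero) (rule refl)
  also have "\<dots> \<le> cmod (cis (\<theta> / 2) * resC (of_real r * cis \<theta>))" by (rule complex_Re_le_cmod)
  finally show ?thesis by (simp add: norm_mult)
qed

text \<open>The imaginary part of the denominator is \<open>r * sin \<theta>\<close>, free of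
  \<open>\<psi> v\<close>, so the imaginary part of \<open>resC\<close> gains a factor
  \<open>r\<close> and a second power of the denominator over the trivial estimate. This gain pays
  for the \<open>1 / s\<close> of the ray integrand near 0.\<close>

lemma abs_Im_resC_le:
  assumes "r > 0" "\<bar>\<theta>\<bar> < pi"
  shows "\<bar>Im (resC (of_real r * cis \<theta>))\<bar> \<le> r * res2 r / (cos (\<theta> / 2))\<^sup>2"
proof -
  note i = integrable_resC(1)[OF cis_notin_nonpos_Reals[OF assms]]
  have c: "cos (\<theta> / 2) > 0" using assms(2) by (intro cos_gt_zero_pi) auto
  have "Im (resC (of_real r * cis \<theta>)) = (LINT v|lborel. Im (1 / (of_real r * cis \<theta> + of_real (\<psi> v))))"
    unfolding resC_def using i by (rule integral_Im[symmetric])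
  also have "\<bar>\<dots>\<bar> \<le> (LINT v|lborel. r / (cos (\<theta> / 2))\<^sup>2 * (1 / (r + \<psi> v)\<^sup>2))"
    unfolding real_norm_def[symmetric]
  proof (rule order_trans[OF integral_norm_bound integral_mono])
    show "integrable lborel (\<lambda>v. norm (Im (1 / (of_real r * cis \<theta> + of_real (\<psi> v)))))"
      by (intro integrable_norm integrable_Im i)
    show "integrable lborel (\<lambda>v. r / (cos (\<theta> / 2))\<^sup>2 * (1 / (r + \<psi> v)\<^sup>2))"
      by (intro integrable_mult_right integrable_res2 assms)
    fix v
    define w where "w = of_real r * cis \<theta> + (of_real (\<psi> v) :: complex)"
    have w: "cos (\<theta> / 2) * (r + \<psi> v) \<le> cmod w"
      unfolding w_def by (rule cmod_sector_ge) (use assms psi_nonneg in auto)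
    have p: "0 < cos (\<theta> / 2) * (r + \<psi> v)" using c assms psi_nonneg[of v] by (intro mult_pos_pos) auto
    have "\<bar>Im w\<bar> = r * \<bar>sin \<theta>\<bar>" unfolding w_def using assms by (simp add: abs_mult)
    then have im: "\<bar>Im w\<bar> \<le> r" using assms by (simp add: mult_left_le)
    have "norm (Im (1 / w)) = \<bar>Im w\<bar> / (cmod w)\<^sup>2"
      by (simp add: Im_divide cmod_power2)
    also have "\<dots> \<le> r / (cos (\<theta> / 2) * (r + \<psi> v))\<^sup>2"
      using im w p assms by (intro frac_le power_mono zero_less_power) auto
    finally show "norm (Im (1 / (of_real r * cis \<theta> + of_real (\<psi> v)))) \<le> r / (cos (\<theta> / 2))\<^sup>2 * (1 / (r + \<psi> v)\<^sup>2)"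
      unfolding w_def by (simp add: power_mult_distrib)
  qed
  also have "\<dots> = r / (cos (\<theta> / 2))\<^sup>2 * res2 r"
    unfolding res2_def by (rule integral_mult_right_zero)
  finally show ?thesis by simp
qed

end

lemma integral_exp_complex:
  fixes a :: complex
  assumes a: "Re a > 0"
  shows "set_integrable lborel {0<..} (\<lambda>t. exp (- (of_real t * a)))"
    and "(LINT t:{0<..}|lborel. exp (- (of_real t * a))) = 1 / a"
proof -
  have e: "einterval 0 \<infinity> = {0<..}" by (auto simp: einterval_def)
  have "set_integrable lborel {0<..} (\<lambda>t. exp (- (t * Re a)))"
    using integrable_I0i_exp_mscale[of "Re a"] a by (simp add: set_integrable_def)
  then show i: "set_integrable lborel {0<..} (\<lambda>t. exp (- (of_real t * a)))"
    by (rule set_integrable_bound) (auto simp: set_borel_measurable_def)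
  have a0: "a \<noteq> 0" using a by auto
  have "(LBINT t=0..\<infinity>. exp (- (of_real t * a))) = 0 - (- (1 / a))"
  proof (rule interval_integral_FTC_integrable[where F="\<lambda>t. - exp (- (of_real t * a)) / a"])
    fix x :: real
    have "((\<lambda>z. - exp (- (z * a)) / a) has_field_derivative exp (- (of_real x * a))) (at (of_real x))"
      by (rule derivative_eq_intros refl | simp add: a0)+
    then show "((\<lambda>t. - exp (- (of_real t * a)) / a) has_vector_derivative exp (- (of_real x * a))) (at x)"
      by (rule has_vector_derivative_real_field)
    show "isCont (\<lambda>t. exp (- (of_real t * a))) x" by (intro continuous_intros)
  next
    show "set_integrable lborel (einterval 0 \<infinity>) (\<lambda>t. exp (- (of_real t * a)))" using i e by simp
    have "((\<lambda>t. - exp (- (complex_of_real t * a)) / a) \<longlongrightarrow> - exp (- (complex_of_real 0 * a)) / a) (at_right 0)"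
      by (intro tendsto_intros a0)
    then show "(((\<lambda>t. - exp (- (of_real t * a)) / a) \<circ> real_of_ereal) \<longlongrightarrow> - (1 / a)) (at_right 0)"
      by (simp add: ereal_tendsto_simps zero_ereal_def)
    have "((\<lambda>t. exp (- (t * Re a)) / cmod a) \<longlongrightarrow> 0) at_top"
      using a a0 by real_asymp
    then have "((\<lambda>t. - exp (- (complex_of_real t * a)) / a) \<longlongrightarrow> 0) at_top"
      by (rule Lim_null_comparison[rotated]) (simp add: norm_divide)
    then show "(((\<lambda>t. - exp (- (of_real t * a)) / a) \<circ> real_of_ereal) \<longlongrightarrow> 0) (at_left \<infinity>)"
      by (simp add: ereal_tendsto_simps)
  qed simp
  then show "(LINT t:{0<..}|lborel. exp (- (of_real t * a))) = 1 / a"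
    by (simp add: interval_lebesgue_integral_def e)
qed

section \<open>Boundary behaviour of the reciprocal potential at the origin\<close>

context levy_exponent
begin

lemma AE_psi_pos: "AE v in lborel. 0 < \<psi> v"
  using AE_lborel_singleton[of 0] by eventually_elim (rule psi_pos)

text \<open>Along \<open>S n\<close> decreasing to 0 the reciprocals decrease, hence converge; a
  nonzero limit would keep the integrals \<open>res (S n)\<close> convergent, and monotone
  convergence would then make \<open>1 / \<psi>\<close> integrable.\<close>

lemma inverse_res_tendsto_0:
  assumes ni: "\<not> integrable lborel (\<lambda>v. 1 / \<psi> v)"
  shows "((\<lambda>r. 1 / res r) \<longlongrightarrow> 0) (at_right 0)"
proof (rule tendsto_at_right_sequentially[of 0 1])
  fix S :: "nat \<Rightarrow> real"
  assume S: "\<And>n. 0 < S n" "decseq S" "S \<longlonglongrightarrow> 0"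
  have "decseq (\<lambda>n. 1 / res (S n))"
    unfolding decseq_def using S(1,2)
    by (auto intro!: divide_left_mono res_antimono mult_pos_pos res_pos simp: decseq_def)
  then obtain l where l: "(\<lambda>n. 1 / res (S n)) \<longlonglongrightarrow> l"
    using decseq_convergent[of "\<lambda>n. 1 / res (S n)" 0] res_pos[OF S(1)] by (metis divide_nonneg_pos zero_le_one)
  have "l = 0"
  proof (rule ccontr)
    assume "l \<noteq> 0"
    then have lim: "(\<lambda>n. res (S n)) \<longlonglongrightarrow> 1 / l" using tendsto_divide[OF tendsto_const[of 1] l] by simp
    have "integrable lborel (\<lambda>v. 1 / \<psi> v)"
    proof (rule integrable_monotone_convergence[where f="\<lambda>n v. 1 / (S n + \<psi> v)"])
      show "integrable lborel (\<lambda>v. 1 / (S n + \<psi> v))" for n by (rule integrable_res[OF S(1)])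
      show "AE v in lborel. mono (\<lambda>n. 1 / (S n + \<psi> v))"
      proof (intro always_eventually allI monoI)
        fix v :: real and m n :: nat assume "m \<le> n"
        then have "S n \<le> S m" using S(2) by (simp add: decseq_def)
        then show "1 / (S m + \<psi> v) \<le> 1 / (S n + \<psi> v)"
          using S(1)[of n] S(1)[of m] psi_nonneg[of v] by (intro divide_left_mono mult_pos_pos) auto
      qed
      show "AE v in lborel. (\<lambda>n. 1 / (S n + \<psi> v)) \<longlonglongrightarrow> 1 / \<psi> v"
        using AE_psi_pos
      proof eventually_elim
        case (elim v)
        have "(\<lambda>n. 1 / (S n + \<psi> v)) \<longlonglongrightarrow> 1 / (0 + \<psi> v)" by (intro tendsto_intros S(3)) (use elim in auto)
        then show ?case by simp
      qed
      show "(\<lambda>n. LINT v|lborel. 1 / (S n + \<psi> v)) \<longlonglongrightarrow> 1 / l" using lim unfolding res_def .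
    qed measurable
    then show False using ni by simp
  qed
  then show "(\<lambda>n. 1 / res (S n)) \<longlonglongrightarrow> 0" using l by simp
qed simp

text \<open>If \<open>1 / \<psi>\<close> is not integrable, both the integral and the quotient on the right are 0 by convention.\<close>

lemma inverse_resC_tendsto:
  assumes \<theta>: "\<bar>\<theta>\<bar> < pi"
  shows "((\<lambda>r. 1 / resC (of_real r * cis \<theta>)) \<longlongrightarrow> of_real (1 / (LINT v|lborel. 1 / \<psi> v))) (at_right 0)"
proof (cases "integrable lborel (\<lambda>v. 1 / \<psi> v)")
  case False
  have c: "cos (\<theta> / 2) > 0" using \<theta> by (intro cos_gt_zero_pi) auto
  have "((\<lambda>r. 1 / resC (of_real r * cis \<theta>)) \<longlongrightarrow> 0) (at_right 0)"
  proof (rule Lim_null_comparison)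
    show "\<forall>\<^sub>F r in at_right 0. norm (1 / resC (of_real r * cis \<theta>)) \<le> 1 / cos (\<theta> / 2) * (1 / res r)"
      unfolding eventually_at_right_field
    proof (intro exI[of _ 1] conjI allI impI)
      fix r :: real assume r: "0 < r" "r < 1"
      have "0 < cos (\<theta> / 2) * res r" using c res_pos r by simp
      moreover have "cos (\<theta> / 2) * res r \<le> cmod (resC (of_real r * cis \<theta>))" by (rule cmod_resC_ge[OF r(1) \<theta>])
      ultimately have "1 / cmod (resC (of_real r * cis \<theta>)) \<le> 1 / (cos (\<theta> / 2) * res r)"
        by (intro frac_le) simp_all
      then show "norm (1 / resC (of_real r * cis \<theta>)) \<le> 1 / cos (\<theta> / 2) * (1 / res r)"
        by (simp add: norm_divide)
    qed simp
    show "((\<lambda>r. 1 / cos (\<theta> / 2) * (1 / res r)) \<longlongrightarrow> 0) (at_right 0)"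
      by (rule tendsto_mult_right_zero[OF inverse_res_tendsto_0[OF False]])
  qed
  then show ?thesis using False by (simp add: not_integrable_integral_eq)
next
  case True
  have c: "cos (\<theta> / 2) > 0" using \<theta> by (intro cos_gt_zero_pi) auto
  \<comment> \<open>\<open>res 1 > 0\<close> lies below the integral of \<open>1 / \<psi>\<close>,
    so the limit of \<open>resC\<close> is nonzero and reciprocals may be taken.\<close>
  have "res 1 \<le> (LINT v|lborel. 1 / \<psi> v)"
    unfolding res_def
  proof (rule integral_mono_AE[OF integrable_res True])
    show "AE v in lborel. 1 / (1 + \<psi> v) \<le> 1 / \<psi> v"
      using AE_psi_pos by eventually_elim (auto intro!: divide_left_mono mult_pos_pos)
  qed simp
  then have p: "(LINT v|lborel. 1 / \<psi> v) > 0" using res_pos[of 1] by simp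
  show ?thesis
  proof (rule tendsto_at_right_sequentially[of 0 1])
    fix S :: "nat \<Rightarrow> real"
    assume S: "\<And>n. 0 < S n" "S \<longlonglongrightarrow> 0"
    have "(\<lambda>n. LINT v|lborel. 1 / (of_real (S n) * cis \<theta> + of_real (\<psi> v))) \<longlonglongrightarrow> (LINT v|lborel. complex_of_real (1 / \<psi> v))"
    proof (rule integral_dominated_convergence[where w="\<lambda>v. 1 / cos (\<theta> / 2) * (1 / \<psi> v)"])
      show "integrable lborel (\<lambda>v. 1 / cos (\<theta> / 2) * (1 / \<psi> v))" using True by (rule integrable_mult_right)
      show "AE v in lborel. (\<lambda>n. 1 / (of_real (S n) * cis \<theta> + of_real (\<psi> v))) \<longlonglongrightarrow> complex_of_real (1 / \<psi> v)"
        using AE_psi_pos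
      proof eventually_elim
        case (elim v)
        have "(\<lambda>n. 1 / (of_real (S n) * cis \<theta> + of_real (\<psi> v))) \<longlonglongrightarrow> 1 / (of_real 0 * cis \<theta> + complex_of_real (\<psi> v))"
          by (intro tendsto_intros S(2)) (use elim in auto)
        then show ?case by simp
      qed
      show "AE v in lborel. norm (1 / (of_real (S n) * cis \<theta> + complex_of_real (\<psi> v))) \<le> 1 / cos (\<theta> / 2) * (1 / \<psi> v)" for n
        using AE_psi_pos
      proof eventually_elim
        case (elim v)
        have "cos (\<theta> / 2) * \<psi> v \<le> cos (\<theta> / 2) * (S n + \<psi> v)" using c S(1)[of n] by simp
        also have "\<dots> \<le> cmod (of_real (S n) * cis \<theta> + complex_of_real (\<psi> v))"
          by (rule cmod_sector_ge) (use S(1)[of n] elim in auto)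
        finally have "1 / cmod (of_real (S n) * cis \<theta> + complex_of_real (\<psi> v)) \<le> 1 / (cos (\<theta> / 2) * \<psi> v)"
          using c elim by (intro frac_le mult_pos_pos) simp_all
        then show ?case by (simp add: norm_divide)
      qed
    qed measurable
    then have "(\<lambda>n. resC (of_real (S n) * cis \<theta>)) \<longlonglongrightarrow> of_real (LINT v|lborel. 1 / \<psi> v)"
      unfolding resC_def by (simp only: integral_complex_of_real)
    then have "(\<lambda>n. 1 / resC (of_real (S n) * cis \<theta>)) \<longlonglongrightarrow> 1 / of_real (LINT v|lborel. 1 / \<psi> v)"
      using p by (intro tendsto_intros) auto
    then show "(\<lambda>n. 1 / resC (of_real (S n) * cis \<theta>)) \<longlonglongrightarrow> of_real (1 / (LINT v|lborel. 1 / \<psi> v))"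
      by simp
  qed simp
qed

lemma inverse_res_tendsto: "((\<lambda>r. 1 / res r) \<longlongrightarrow> 1 / (LINT v|lborel. 1 / \<psi> v)) (at_right 0)"
proof -
  have "((\<lambda>r. Re (1 / resC (of_real r * cis 0))) \<longlongrightarrow> Re (of_real (1 / (LINT v|lborel. 1 / \<psi> v)))) (at_right 0)"
    by (intro tendsto_Re inverse_resC_tendsto) simp
  then show ?thesis by (simp add: resC_of_real)
qed

text \<open>On the positive axis \<open>- res2\<close> is the derivative of the holomorphic function
  \<open>resC\<close>, and such a derivative is continuous.\<close>

lemma isCont_res2:
  assumes "r > 0"
  shows "isCont res2 r"
proof -
  have o: "open (- \<real>\<^sub>\<le>\<^sub>0 :: complex set)" by (intro open_Compl closed_nonpos_Reals_complex)
  have d: "deriv resC (of_real x) = - of_real (res2 x)" if "x > 0" for x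
  proof -
    have z: "complex_of_real x \<notin> \<real>\<^sub>\<le>\<^sub>0" using that by (auto simp: complex_nonpos_Reals_iff)
    have "(LINT v|lborel. 1 / (complex_of_real x + of_real (\<psi> v))\<^sup>2) = (LINT v|lborel. complex_of_real (1 / (x + \<psi> v)\<^sup>2))"
      by simp
    then have e: "(LINT v|lborel. 1 / (complex_of_real x + of_real (\<psi> v))\<^sup>2) = of_real (res2 x)"
      unfolding res2_def by (simp only: integral_complex_of_real)
    show ?thesis using DERIV_imp_deriv[OF resC_has_field_derivative[OF z]] e by simp
  qed
  have "continuous_on (- \<real>\<^sub>\<le>\<^sub>0) (deriv resC)"
    by (intro holomorphic_on_imp_continuous_on holomorphic_deriv resC_holomorphic o)
  then have "continuous_on {0<..} (\<lambda>x. deriv resC (of_real x))"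
    by (rule continuous_on_compose2) (auto intro!: continuous_intros simp: complex_nonpos_Reals_iff)
  then have "continuous_on {0<..} (\<lambda>x. - Re (deriv resC (of_real x)))"
    by (intro continuous_on_minus continuous_on_Re)
  then have "continuous_on {0<..} res2"
    by (rule continuous_on_cong[THEN iffD1, rotated 2]) (auto simp: d)
  then show ?thesis using assms by (simp add: continuous_on_eq_continuous_at)
qed

text \<open>The integrand is the derivative of \<open>1 / res\<close>, which is monotone with a finite limit at 0.\<close>

lemma integrable_res2_divide_res:
  "set_integrable lborel {0<..<1} (\<lambda>s. res2 s / (res s)\<^sup>2)"
proof -
  have e: "einterval (ereal 0) (ereal 1) = {0<..<1}" by (auto simp: einterval_def)
  have "set_integrable lborel (einterval (ereal 0) (ereal 1)) (\<lambda>s. res2 s / (res s)\<^sup>2)"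
  proof (rule interval_integral_FTC_nonneg(1)[where F="\<lambda>r. 1 / res r"])
    fix x :: real assume x: "ereal 0 < ereal x" "ereal x < ereal 1"
    then have r: "res x > 0" by (simp add: res_pos)
    have "((\<lambda>r. 1 / res r) has_real_derivative (0 * res x - 1 * (- res2 x)) / (res x * res x)) (at x)"
      by (rule DERIV_divide DERIV_const res_has_real_derivative)+ (use x r in auto)
    then show "((\<lambda>r. 1 / res r) has_real_derivative res2 x / (res x)\<^sup>2) (at x)"
      by (simp add: power2_eq_square)
    have "isCont res x" using x by (intro DERIV_isCont[OF res_has_real_derivative]) simp
    then show "isCont (\<lambda>s. res2 s / (res s)\<^sup>2) x"
      using x r by (intro continuous_intros isCont_res2) auto
  next
    show "AE x in lborel. ereal 0 < ereal x \<longrightarrow> ereal x < ereal 1 \<longrightarrow> 0 \<le> res2 x / (res x)\<^sup>2"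
      unfolding res2_def by (intro always_eventually allI impI divide_nonneg_nonneg integral_nonneg_AE) auto
    show "(((\<lambda>r. 1 / res r) \<circ> real_of_ereal) \<longlongrightarrow> 1 / (LINT v|lborel. 1 / \<psi> v)) (at_right (ereal 0))"
      using inverse_res_tendsto by (simp only: ereal_tendsto_simps)
    have "isCont (\<lambda>r. 1 / res r) 1"
      using res_pos[of 1] by (intro continuous_intros DERIV_isCont[OF res_has_real_derivative]) auto
    then have "((\<lambda>r. 1 / res r) \<longlongrightarrow> 1 / res 1) (at_left 1)"
      by (metis continuous_at_split continuous_within)
    then show "(((\<lambda>r. 1 / res r) \<circ> real_of_ereal) \<longlongrightarrow> 1 / res 1) (at_left (ereal 1))"
      by (simp only: ereal_tendsto_simps)
  qed simp
  then show ?thesis unfolding e .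
qed

end

section \<open>The contour integral\<close>

lemma contour_integral_linepath_same_Im:
  assumes "a < b"
  shows "contour_integral (linepath (Complex a c) (Complex b c)) f = integral {a..b} (\<lambda>x. f (Complex x c))"
proof -
  have "(f has_contour_integral I) (linepath (Complex a c) (Complex b c)) \<longleftrightarrow>
      ((\<lambda>x. f (Complex x c)) has_integral I) {a..b}" for I
  proof -
    have l: "linepath (Complex a c) (Complex b c) x = linepath (of_real a) (of_real b) x + \<i> * of_real c" for x
      by (simp add: linepath_def Complex_eq scaleR_conv_of_real algebra_simps)
    have d: "Complex b c - Complex a c = of_real b - of_real a" by (simp add: Complex_eq)
    have "(f has_contour_integral I) (linepath (Complex a c) (Complex b c)) \<longleftrightarrow>
        ((\<lambda>z. f (z + \<i> * of_real c)) has_contour_integral I) (linepath (of_real a) (of_real b))"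
      unfolding has_contour_integral_linepath l d ..
    also have "\<dots> \<longleftrightarrow> ((\<lambda>x. f (of_real x + \<i> * of_real c)) has_integral I) {a..b}"
      using assms by (subst has_contour_integral_linepath_Reals_iff) auto
    finally show ?thesis by (simp add: Complex_eq)
  qed
  then show ?thesis
    unfolding contour_integral_def contour_integrable_on_def integral_def integrable_on_def by simp
qed

lemma exp_conv_cis: "exp w = of_real (exp (Re w)) * cis (Im w)"
  by (rule exp_eq_polar)

text \<open>The smallest value of the sector constant \<open>cos (\<theta> / 2)\<close> for
  \<open>\<bar>\<theta>\<bar> \<le> 3 * pi / 4\<close>, hence one constant for the whole
  contour.\<close>

definition \<kappa> :: real where "\<kappa> = cos (3 * pi / 8)"

lemma kappa_pos: "\<kappa> > 0"
  unfolding \<kappa>_def using pi_gt_zero by (intro cos_gt_zero_pi) (simp_all add: field_simps)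

lemma kappa_le:
  assumes "\<bar>y\<bar> \<le> 3 * pi / 4"
  shows "\<kappa> \<le> cos (y / 2)"
proof -
  have "cos (3 * pi / 8) \<le> cos (\<bar>y / 2\<bar>)"
    using assms pi_gt_zero by (intro cos_monotone_0_pi_le) auto
  then show ?thesis unfolding \<kappa>_def by (simp only: cos_abs_real)
qed

section \<open>Residue calculus for the reciprocal potential on a strip\<close>

context levy_exponent
begin

lemma cmod_resC_ge_kappa:
  assumes "r > 0" "\<bar>\<theta>\<bar> \<le> 3 * pi / 4"
  shows "\<kappa> * res r \<le> cmod (resC (of_real r * cis \<theta>))"
proof -
  have "\<kappa> * res r \<le> cos (\<theta> / 2) * res r"
    using kappa_le[OF assms(2)] res_pos[OF assms(1)] by (intro mult_right_mono) auto
  also have "\<dots> \<le> cmod (resC (of_real r * cis \<theta>))"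
    by (rule cmod_resC_ge) (use assms pi_gt_zero in linarith)+
  finally show ?thesis .
qed

lemma resC_nonzero:
  assumes "r > 0" "\<bar>\<theta>\<bar> < pi"
  shows "resC (of_real r * cis \<theta>) \<noteq> 0"
proof -
  have "0 < cos (\<theta> / 2)" using assms(2) by (intro cos_gt_zero_pi) auto
  then have "0 < cos (\<theta> / 2) * res r" using res_pos[OF assms(1)] by simp
  also have "\<dots> \<le> cmod (resC (of_real r * cis \<theta>))" by (rule cmod_resC_ge[OF assms])
  finally show ?thesis by auto
qed

text \<open>The substitution \<open>z = exp w\<close> turns the sector into a strip and the contour into a rectangle.\<close>

definition Hq :: "real \<Rightarrow> complex \<Rightarrow> complex" where
  "Hq q w = (1 / resC (exp w)) / (of_real q - exp w)"

lemma strip_open: "open {w. \<bar>Im w\<bar> < pi}"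
  by (intro open_Collect_less continuous_intros)

lemma strip_convex: "convex {w. \<bar>Im w\<bar> < pi}"
proof -
  have "{w. \<bar>Im w\<bar> < pi} = {w. Im w < pi} \<inter> {w. Im w > - pi}" by (auto simp: abs_less_iff)
  then show ?thesis by (simp add: convex_Int convex_halfspace_Im_lt convex_halfspace_Im_gt)
qed

lemma inverse_resC_exp_holomorphic: "(\<lambda>w. 1 / resC (exp w)) holomorphic_on {w. \<bar>Im w\<bar> < pi}"
proof -
  have "(resC \<circ> exp) holomorphic_on {w. \<bar>Im w\<bar> < pi}"
    by (rule holomorphic_on_compose_gen[OF _ resC_holomorphic])
       (use cis_notin_nonpos_Reals[OF exp_gt_zero] in \<open>auto intro!: holomorphic_intros simp: exp_conv_cis\<close>)
  then show ?thesis unfolding o_def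
    by (intro holomorphic_intros) (auto simp: exp_conv_cis resC_nonzero)
qed

text \<open>Injectivity of \<open>exp\<close> on the strip leaves a single pole of
  \<open>Hq q\<close>, at \<open>ln q\<close>.\<close>

lemma exp_eq_of_real_strip:
  assumes "q > 0" "\<bar>Im w\<bar> < pi" "exp w = of_real q"
  shows "w = of_real (ln q)"
proof -
  have "w = Ln (exp w)" using assms(2) by (intro Ln_exp[symmetric]) auto
  then show ?thesis using assms Ln_of_real[OF assms(1)] by simp
qed

lemma Hq_holomorphic:
  assumes "q > 0"
  shows "Hq q holomorphic_on {w. \<bar>Im w\<bar> < pi} - {of_real (ln q)}"
  unfolding Hq_def
  by (intro holomorphic_on_divide holomorphic_on_subset[OF inverse_resC_exp_holomorphic] holomorphic_intros)
     (use exp_eq_of_real_strip[OF assms] in force)+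

lemma residue_Hq:
  assumes q: "q > 0"
  shows "residue (Hq q) (of_real (ln q)) = - of_real (1 / (q * res q))"
proof -
  have e: "exp (of_real (ln q)) = complex_of_real q" using q by (simp add: exp_of_real)
  have "residue (Hq q) (of_real (ln q)) = (1 / resC (exp (of_real (ln q)))) / (- of_real q)"
    unfolding Hq_def
  proof (rule residue_simple_pole_deriv[OF inverse_resC_exp_holomorphic])
    show "((\<lambda>w. of_real q - exp w) has_field_derivative - complex_of_real q) (at (of_real (ln q)))"
      by (auto intro!: derivative_eq_intros simp: e)
  qed (use q res_pos[OF q] in \<open>auto intro!: holomorphic_intros strip_open convex_connected strip_convex simp: e resC_of_real\<close>)
  then show ?thesis unfolding e by (simp add: resC_of_real)
qed

lemma Hq_cnj: "Hq q (cnj w) = cnj (Hq q w)"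
  unfolding Hq_def by (simp add: exp_cnj resC_cnj[symmetric])

lemma Hq_continuous:
  assumes "q > 0" "S \<subseteq> {w. \<bar>Im w\<bar> < pi}" "of_real (ln q) \<notin> S"
  shows "continuous_on S (Hq q)"
  by (rule holomorphic_on_imp_continuous_on, rule holomorphic_on_subset[OF Hq_holomorphic]) (use assms in auto)

text \<open>The residue at \<open>ln q\<close> produces the main value. The reflection symmetry
  \<open>Hq_cnj\<close> makes the integrals along the two horizontal sides conjugate, so they
  combine to the imaginary part along the upper side; the vertical sides are left over and stand for
  the arcs at infinity and around 0.\<close>

lemma Hq_rectangle:
  assumes q: "q > 0" and A: "A > \<bar>ln q\<bar>"
  defines "\<theta> \<equiv> 3 * pi / 4"
  shows "of_real (integral {- A..A} (\<lambda>x. Im (Hq q (Complex x \<theta>)))) =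
     of_real (pi / (q * res q)) + (integral {-\<theta>..\<theta>} (\<lambda>y. Hq q (Complex A y)) - integral {-\<theta>..\<theta>} (\<lambda>y. Hq q (Complex (-A) y))) / 2"
proof -
  have \<theta>: "0 < \<theta>" "\<theta> < pi" unfolding \<theta>_def using pi_gt_zero by auto
  have A0: "A > 0" using A by simp
  define a1 a2 a3 a4 where "a1 = Complex (-A) (-\<theta>)" and "a2 = Complex A (-\<theta>)"
    and "a3 = Complex A \<theta>" and "a4 = Complex (-A) \<theta>"
  note a = a1_def a2_def a3_def a4_def
  have rp: "rectpath a1 a3 = linepath a1 a2 +++ linepath a2 a3 +++ linepath a3 a4 +++ linepath a4 a1"
    unfolding rectpath_def Let_def a by simp
  have im: "path_image (rectpath a1 a3) \<subseteq> {w. \<bar>Im w\<bar> < pi} - {of_real (ln q)}"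
    using \<theta> A0 A unfolding a by (subst path_image_rectpath) (auto simp: abs_less_iff)
  have cont: "continuous_on (path_image (rectpath a1 a3)) (Hq q)"
    by (rule Hq_continuous[OF q]) (use im in auto)
  have seg: "continuous_on (closed_segment a1 a2) (Hq q)" "continuous_on (closed_segment a2 a3) (Hq q)"
     "continuous_on (closed_segment a3 a4) (Hq q)" "continuous_on (closed_segment a4 a1) (Hq q)"
    by (rule continuous_on_subset[OF cont]; auto simp: rp path_image_join)+
  have "contour_integral (rectpath a1 a3) (Hq q) =
      2 * pi * \<i> * (\<Sum>p\<in>{of_real (ln q)}. winding_number (rectpath a1 a3) p * residue (Hq q) p)"
  proof (rule Residue_theorem[OF strip_open convex_connected[OF strip_convex] _ Hq_holomorphic[OF q] _ _ im])
    show "\<forall>z. z \<notin> {w. \<bar>Im w\<bar> < pi} \<longrightarrow> winding_number (rectpath a1 a3) z = 0"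
    proof (intro allI impI)
      fix z assume "z \<notin> {w. \<bar>Im w\<bar> < pi}"
      then show "winding_number (rectpath a1 a3) z = 0"
        using \<theta> A0 unfolding a by (intro winding_number_rectpath_outside) (auto simp: in_cbox_complex_iff)
    qed
  qed auto
  also have "\<dots> = 2 * of_real pi * \<i> * residue (Hq q) (of_real (ln q))"
    using A \<theta> unfolding a by (simp add: winding_number_rectpath in_box_complex_iff abs_less_iff)
  also have "\<dots> = - 2 * \<i> * of_real (pi / (q * res q))"
    unfolding residue_Hq[OF q] by simp
  finally have c1: "contour_integral (rectpath a1 a3) (Hq q) = - 2 * \<i> * of_real (pi / (q * res q))" .
  note ci = contour_integrable_continuous_linepath[OF seg(1)] contour_integrable_continuous_linepath[OF seg(2)]
    contour_integrable_continuous_linepath[OF seg(3)] contour_integrable_continuous_linepath[OF seg(4)]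
  have c2: "contour_integral (rectpath a1 a3) (Hq q) =
     contour_integral (linepath a1 a2) (Hq q) + contour_integral (linepath a2 a3) (Hq q)
      - contour_integral (linepath a4 a3) (Hq q) - contour_integral (linepath a1 a4) (Hq q)"
    unfolding rp using ci contour_integral_reverse_linepath[OF seg(3)] contour_integral_reverse_linepath[OF seg(4)]
    by (simp add: valid_path_join)
  define I where "I = integral {- A..A} (\<lambda>x. Hq q (Complex x \<theta>))"
  have l1: "contour_integral (linepath a4 a3) (Hq q) = I"
    unfolding I_def a by (rule contour_integral_linepath_same_Im) (use A0 in simp)
  have "contour_integral (linepath a1 a2) (Hq q) = integral {- A..A} (\<lambda>x. Hq q (Complex x (-\<theta>)))"
    unfolding a by (rule contour_integral_linepath_same_Im) (use A0 in simp)
  also have "(\<lambda>x. Hq q (Complex x (-\<theta>))) = (\<lambda>x. cnj (Hq q (Complex x \<theta>)))"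
    by (simp add: Hq_cnj[symmetric] complex_cnj)
  finally have l2: "contour_integral (linepath a1 a2) (Hq q) = cnj I"
    unfolding I_def Henstock_Kurzweil_Integration.integral_cnj .
  have l3: "contour_integral (linepath a2 a3) (Hq q) = \<i> * integral {-\<theta>..\<theta>} (\<lambda>y. Hq q (Complex A y))"
    by (subst contour_integral_linepath_same_Re[where c=A and a="-\<theta>" and b=\<theta>]) (use \<theta> in \<open>auto simp: a\<close>)
  have l4: "contour_integral (linepath a1 a4) (Hq q) = \<i> * integral {-\<theta>..\<theta>} (\<lambda>y. Hq q (Complex (-A) y))"
    by (subst contour_integral_linepath_same_Re[where c="-A" and a="-\<theta>" and b=\<theta>]) (use \<theta> in \<open>auto simp: a\<close>)
  \<comment> \<open>Solves the contour identity for the imaginary part, that is, divides it by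
    \<open>-2 * \<i>\<close>; \<open>R\<close> and \<open>L\<close> are the right and left
    sides.\<close>
  have alg: "x = P + (R - L) / 2" if "- 2 * \<i> * P = - 2 * \<i> * x + \<i> * (R - L)" for P x R L :: complex
  proof -
    have "2 * Im P = Im L - Im R + 2 * Im x" "- (2 * Re P) = Re R - Re L - 2 * Re x"
      using that by (auto simp: complex_eq_iff)
    then show ?thesis by (intro complex_eqI) (simp_all add: field_simps)
  qed
  have d: "cnj I - I = - 2 * \<i> * of_real (Im I)" by (simp add: complex_eq_iff)
  have "- 2 * \<i> * of_real (pi / (q * res q)) = (cnj I - I) +
     \<i> * (integral {-\<theta>..\<theta>} (\<lambda>y. Hq q (Complex A y)) - integral {-\<theta>..\<theta>} (\<lambda>y. Hq q (Complex (-A) y)))"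
    using c1 c2 unfolding l1 l2 l3 l4 by (simp add: algebra_simps)
  then have e: "of_real (Im I) = of_real (pi / (q * res q)) +
     (integral {-\<theta>..\<theta>} (\<lambda>y. Hq q (Complex A y)) - integral {-\<theta>..\<theta>} (\<lambda>y. Hq q (Complex (-A) y))) / 2"
    unfolding d by (rule alg)
  have "(\<lambda>x. Hq q (Complex x \<theta>)) integrable_on {-A..A}"
  proof (rule integrable_continuous_real, rule continuous_on_compose2[of UNIV "\<lambda>w. w"])
    show "continuous_on {-A..A} (\<lambda>x. Hq q (Complex x \<theta>))"
      by (rule continuous_on_compose2[OF Hq_continuous[OF q, of "{w. Im w = \<theta>}"]])
         (use \<theta> in \<open>auto intro!: continuous_intros simp: Complex_eq\<close>)
  qed auto
  then have "integral {-A..A} (\<lambda>x. Im (Hq q (Complex x \<theta>))) = Im I"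
    unfolding I_def using integral_linear[OF _ bounded_linear_Im] by (force simp: o_def)
  then show ?thesis using e by simp
qed

text \<open>On the right side \<open>1 / resC\<close> grows at most like \<open>exp (x / 2)\<close>
  by \<open>res_lower_bound\<close>, against a denominator of order \<open>exp x\<close>. On the
  left side the integrand is bounded and has the same real limit at every height, so only the length
  \<open>2 * \<theta>\<close> of the side enters.\<close>

lemma Hq_vertical_limits:
  assumes q: "q > 0"
  defines "\<theta> \<equiv> 3 * pi / 4"
  shows "\<exists>N. (\<lambda>n. integral {-\<theta>..\<theta>} (\<lambda>y. Hq q (Complex (real (n + N)) y))) \<longlonglongrightarrow> 0 \<and>
     (\<lambda>n. integral {-\<theta>..\<theta>} (\<lambda>y. Hq q (Complex (- real (n + N)) y))) \<longlonglongrightarrow> of_real (2 * \<theta> * ((1 / (LINT v|lborel. 1 / \<psi> v)) / q)) \<and>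
     real N > \<bar>ln q\<bar>"
proof -
  have \<theta>: "0 < \<theta>" "\<theta> < pi" "\<theta> = 3 * pi / 4" unfolding \<theta>_def using pi_gt_zero by auto
  \<comment> \<open>The margin \<open>ln 2\<close> keeps \<open>exp x\<close> at a factor of at
    least 2 from \<open>q\<close> on both vertical sides, so that \<open>of_real q - exp w\<close>
    has at least half the size of the larger of its two terms.\<close>
  obtain N where N: "real N > \<bar>ln q\<bar> + ln 2" using reals_Archimedean2 by blast
  then have N1: "real N > \<bar>ln q\<bar>" using ln_gt_zero[of 2] by linarith
  define c0 where "c0 = 1 / (LINT v|lborel. 1 / \<psi> v)"
  have int: "(\<lambda>y. Hq q (Complex x y)) integrable_on {-\<theta>..\<theta>}" if "x \<noteq> ln q" for x
  proof (rule integrable_continuous_real)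
    show "continuous_on {-\<theta>..\<theta>} (\<lambda>y. Hq q (Complex x y))"
      by (rule continuous_on_compose2[OF Hq_continuous[OF q, of "{w. \<bar>Im w\<bar> \<le> \<theta> \<and> Re w = x}"]])
         (use \<theta>(1,2) that in \<open>auto intro!: continuous_intros simp: Complex_eq\<close>)
  qed
  have nH: "norm (Hq q (Complex x y)) = 1 / (cmod (resC (of_real (exp x) * cis y)) * cmod (of_real q - of_real (exp x) * cis y))" for x y
    unfolding Hq_def by (simp add: exp_conv_cis norm_divide norm_mult)
  have ex: "2 * q \<le> exp (real (n + N))" "exp (- real (n + N)) \<le> q / 2" for n
  proof -
    have "ln (2 * q) \<le> real (n + N)" "- real (n + N) \<le> ln (q / 2)" using N q by (auto simp: ln_mult ln_div)
    then have "exp (ln (2 * q)) \<le> exp (real (n + N))" "exp (- real (n + N)) \<le> exp (ln (q / 2))"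
      unfolding exp_le_cancel_iff .
    then show "2 * q \<le> exp (real (n + N))" "exp (- real (n + N)) \<le> q / 2"
      using q by simp_all
  qed
  have right: "norm (Hq q (Complex (real (n + N)) y)) \<le> 5 / (\<kappa> * exp (real (n + N) / 2))" if y: "y \<in> {-\<theta>..\<theta>}" for n y
  proof -
    define x where "x = real (n + N)"
    have s: "sqrt (exp x) = exp (x / 2)" by (rule real_sqrt_unique) (auto simp: power2_eq_square simp flip: exp_add)
    have "exp x - q \<le> cmod (of_real q - of_real (exp x) * cis y)"
      using norm_triangle_ineq3[of "of_real q" "of_real (exp x) * cis y"] q by (simp add: norm_mult)
    then have 1: "exp x / 2 \<le> cmod (of_real q - of_real (exp x) * cis y)"
      using ex(1)[of n] unfolding x_def by linarith
    have "\<kappa> * (2 / (5 * sqrt (exp x))) \<le> \<kappa> * res (exp x)"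
      using kappa_pos by (intro mult_left_mono res_lower_bound) (auto simp: x_def)
    also have "\<dots> \<le> cmod (resC (of_real (exp x) * cis y))"
      by (rule cmod_resC_ge_kappa) (use y \<theta> in auto)
    finally have 2: "\<kappa> * (2 / (5 * exp (x / 2))) \<le> cmod (resC (of_real (exp x) * cis y))" unfolding s .
    have "1 / (cmod (resC (of_real (exp x) * cis y)) * cmod (of_real q - of_real (exp x) * cis y))
        \<le> 1 / (\<kappa> * (2 / (5 * exp (x / 2))) * (exp x / 2))"
      using 1 2 kappa_pos by (intro frac_le mult_mono mult_pos_pos) auto
    also have "\<dots> = 5 / (\<kappa> * exp (x / 2))"
    proof -
      have "exp x = exp (x / 2) * exp (x / 2)" by (simp flip: exp_add)
      then show ?thesis using kappa_pos by simp
    qed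
    finally show ?thesis unfolding nH x_def[symmetric] by simp
  qed
  have left: "norm (Hq q (Complex (- real (n + N)) y)) \<le> 2 / (\<kappa> * res 1 * q)" if y: "y \<in> {-\<theta>..\<theta>}" for n y
  proof -
    define x where "x = - real (n + N)"
    have "q - exp x \<le> cmod (of_real q - of_real (exp x) * cis y)"
      using norm_triangle_ineq2[of "of_real q" "of_real (exp x) * cis y"] q by (simp add: norm_mult)
    then have 1: "q / 2 \<le> cmod (of_real q - of_real (exp x) * cis y)"
      using ex(2)[of n] unfolding x_def by linarith
    have "\<kappa> * res 1 \<le> \<kappa> * res (exp x)"
      using kappa_pos by (intro mult_left_mono res_antimono) (auto simp: x_def)
    also have "\<dots> \<le> cmod (resC (of_real (exp x) * cis y))"
      by (rule cmod_resC_ge_kappa) (use y \<theta> in auto)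
    finally have 2: "\<kappa> * res 1 \<le> cmod (resC (of_real (exp x) * cis y))" .
    have "1 / (cmod (resC (of_real (exp x) * cis y)) * cmod (of_real q - of_real (exp x) * cis y))
        \<le> 1 / (\<kappa> * res 1 * (q / 2))"
      using 1 2 kappa_pos res_pos[of 1] q by (intro frac_le mult_mono mult_pos_pos) auto
    then show ?thesis unfolding nH x_def[symmetric] by simp
  qed
  have L1: "(\<lambda>n. integral {-\<theta>..\<theta>} (\<lambda>y. Hq q (Complex (real (n + N)) y))) \<longlonglongrightarrow> integral {-\<theta>..\<theta>} (\<lambda>y. 0)"
  proof (rule dominated_convergence(2)[where h="\<lambda>y. 5 / \<kappa>"])
    show "(\<lambda>y. Hq q (Complex (real (n + N)) y)) integrable_on {-\<theta>..\<theta>}" for n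
      by (rule int) (use N1 in linarith)
    fix y assume y: "y \<in> {-\<theta>..\<theta>}"
    have "(\<lambda>n. 5 / (\<kappa> * exp (real (n + N) / 2))) \<longlonglongrightarrow> 0" using kappa_pos by real_asymp
    then show "(\<lambda>n. Hq q (Complex (real (n + N)) y)) \<longlonglongrightarrow> 0"
      by (rule Lim_null_comparison[rotated]) (use right[OF y] in auto)
    have "5 / (\<kappa> * exp (real (n + N) / 2)) \<le> 5 / \<kappa>" for n
      using kappa_pos by (intro divide_left_mono mult_pos_pos) auto
    then show "norm (Hq q (Complex (real (n + N)) y)) \<le> 5 / \<kappa>" for n
      using right[OF y, of n] order_trans by blast
  qed auto
  have L2: "(\<lambda>n. integral {-\<theta>..\<theta>} (\<lambda>y. Hq q (Complex (- real (n + N)) y))) \<longlonglongrightarrow> integral {-\<theta>..\<theta>} (\<lambda>y. complex_of_real (c0 / q))"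
  proof (rule dominated_convergence(2)[where h="\<lambda>y. 2 / (\<kappa> * res 1 * q)"])
    show "(\<lambda>y. Hq q (Complex (- real (n + N)) y)) integrable_on {-\<theta>..\<theta>}" for n
      by (rule int) (use N1 in linarith)
    fix y assume y: "y \<in> {-\<theta>..\<theta>}"
    have e0: "(\<lambda>n. exp (- real (n + N))) \<longlonglongrightarrow> 0" by real_asymp
    then have f: "filterlim (\<lambda>n. exp (- real (n + N))) (at_right 0) sequentially"
      by (rule tendsto_imp_filterlim_at_right) simp
    have "(\<lambda>n. 1 / resC (of_real (exp (- real (n + N))) * cis y)) \<longlonglongrightarrow> of_real c0"
    proof -
      have "\<bar>y\<bar> < pi" using y \<theta> unfolding atLeastAtMost_iff by linarith
      then show ?thesis unfolding c0_def by (rule filterlim_compose[OF inverse_resC_tendsto f])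
    qed
    moreover have "(\<lambda>n. of_real q - of_real (exp (- real (n + N))) * cis y) \<longlonglongrightarrow> of_real q - of_real 0 * cis y"
      by (intro tendsto_intros e0)
    ultimately have "(\<lambda>n. 1 / resC (of_real (exp (- real (n + N))) * cis y) / (of_real q - of_real (exp (- real (n + N))) * cis y))
        \<longlonglongrightarrow> of_real c0 / (of_real q - of_real 0 * cis y)"
      by (rule tendsto_divide) (use q in auto)
    then show "(\<lambda>n. Hq q (Complex (- real (n + N)) y)) \<longlonglongrightarrow> of_real (c0 / q)"
      unfolding Hq_def exp_conv_cis by simp
    show "norm (Hq q (Complex (- real (n + N)) y)) \<le> 2 / (\<kappa> * res 1 * q)" for n
      by (rule left[OF y])
  qed auto
  show ?thesis
  proof (intro exI[of _ N] conjI)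
    have e: "integral {-\<theta>..\<theta>} (\<lambda>y. complex_of_real (c0 / q)) = of_real (2 * \<theta> * (c0 / q))"
      using \<theta>(1) by (simp add: scaleR_conv_of_real)
    show "(\<lambda>n. integral {-\<theta>..\<theta>} (\<lambda>y. Hq q (Complex (- real (n + N)) y)))
        \<longlonglongrightarrow> of_real (2 * \<theta> * ((1 / (LINT v|lborel. 1 / \<psi> v)) / q))"
      using L2 unfolding e unfolding c0_def .
    show "(\<lambda>n. integral {-\<theta>..\<theta>} (\<lambda>y. Hq q (Complex (real (n + N)) y))) \<longlonglongrightarrow> 0"
      using L1 unfolding integral_0 .
  qed (rule N1)
qed

text \<open>Up to normalization, \<open>tail\<close> is the tail of the Levy measure of the inverse local time at 0, i.e. the
  Bromwich integral of \<open>1 / (q res q)\<close> turned onto the rays of argument \<open>\<plusminus>3\<pi>/4\<close>.  The last term is the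
  contribution of the arc around 0; it is 0 by convention if \<open>1 / \<psi>\<close> is not integrable.\<close>

definition ray_integrand :: "real \<Rightarrow> real \<Rightarrow> real" where
  "ray_integrand t s = Im (exp (of_real (t * s) * cis (3 * pi / 4)) / resC (of_real s * cis (3 * pi / 4))) / s"

definition tail :: "real \<Rightarrow> real" where
  "tail t = 2 * (LINT s:{0<..}|lborel. ray_integrand t s) + 3 * pi / 2 * (1 / (LINT v|lborel. 1 / \<psi> v))"

text \<open>The Laplace transform of \<open>ray_integrand\<close> in \<open>t\<close> at
  \<open>q\<close>, with the time integral already evaluated. In the variable
  \<open>x = ln s\<close> it is the imaginary part of \<open>Hq q\<close> on the line at height
  \<open>3 * pi / 4\<close>, up to the factor \<open>1 / s\<close>.\<close>

definition laplace_ray :: "real \<Rightarrow> real \<Rightarrow> real" where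
  "laplace_ray q s = Im ((1 / resC (of_real s * cis (3 * pi / 4))) / (of_real q - of_real s * cis (3 * pi / 4))) / s"

text \<open>The integrals over \<open>{exp (- A)..exp A}\<close> have a limit from the rectangle
  identity and another from exhausting the half-line. The left side of the rectangle enters halved
  and with a minus sign, which turns the full opening \<open>3 * pi / 2\<close> into
  \<open>3 * pi / 4\<close>.\<close>

lemma integral_laplace_ray:
  assumes q: "q > 0" and i: "set_integrable lborel {0<..} (laplace_ray q)"
  shows "(LINT s:{0<..}|lborel. laplace_ray q s) =
    pi / (q * res q) - 3 * pi / 4 * ((1 / (LINT v|lborel. 1 / \<psi> v)) / q)"
proof -
  define \<theta> where "\<theta> = 3 * pi / 4"
  have \<theta>: "0 < \<theta>" "\<theta> < pi" unfolding \<theta>_def using pi_gt_zero by auto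
  define c0 where "c0 = 1 / (LINT v|lborel. 1 / \<psi> v)"
  obtain N where N: "(\<lambda>n. integral {-\<theta>..\<theta>} (\<lambda>y. Hq q (Complex (real (n + N)) y))) \<longlonglongrightarrow> 0"
     "(\<lambda>n. integral {-\<theta>..\<theta>} (\<lambda>y. Hq q (Complex (- real (n + N)) y))) \<longlonglongrightarrow> of_real (2 * \<theta> * (c0 / q))"
     "real N > \<bar>ln q\<bar>"
    using Hq_vertical_limits[OF q] unfolding \<theta>_def c0_def by blast
  have "(\<lambda>n. of_real (pi / (q * res q)) + (integral {-\<theta>..\<theta>} (\<lambda>y. Hq q (Complex (real (n + N)) y))
        - integral {-\<theta>..\<theta>} (\<lambda>y. Hq q (Complex (- real (n + N)) y))) / 2)
     \<longlonglongrightarrow> of_real (pi / (q * res q)) + (0 - of_real (2 * \<theta> * (c0 / q))) / 2"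
    by (intro tendsto_intros N) simp
  also have "(\<lambda>n. of_real (pi / (q * res q)) + (integral {-\<theta>..\<theta>} (\<lambda>y. Hq q (Complex (real (n + N)) y))
        - integral {-\<theta>..\<theta>} (\<lambda>y. Hq q (Complex (- real (n + N)) y))) / 2)
     = (\<lambda>n. complex_of_real (integral {- real (n + N)..real (n + N)} (\<lambda>x. Im (Hq q (Complex x \<theta>)))))"
    unfolding \<theta>_def by (rule ext, rule Hq_rectangle[OF q, symmetric]) (use N(3) in simp)
  also have "of_real (pi / (q * res q)) + (0 - of_real (2 * \<theta> * (c0 / q))) / 2 = complex_of_real (pi / (q * res q) - \<theta> * (c0 / q))"
    by simp
  finally have lim1: "(\<lambda>n. integral {- real (n + N)..real (n + N)} (\<lambda>x. Im (Hq q (Complex x \<theta>)))) \<longlonglongrightarrow> pi / (q * res q) - \<theta> * (c0 / q)"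
    by (simp only: tendsto_of_real_iff)
  have cont: "continuous_on {a..b} (laplace_ray q)" if "a > 0" for a b
  proof -
    have "laplace_ray q s = Im (Hq q (Complex (ln s) \<theta>)) / s" if "s > 0" for s
      unfolding laplace_ray_def Hq_def exp_conv_cis \<theta>_def using that by simp
    moreover have "continuous_on {a..b} (\<lambda>s. Hq q (Complex (ln s) \<theta>))"
      by (rule continuous_on_compose2[OF Hq_continuous[OF q, of "{w. Im w = \<theta>}"]])
         (use \<theta> that in \<open>auto intro!: continuous_intros simp: Complex_eq\<close>)
    ultimately show ?thesis
      using that by (subst continuous_on_cong[OF refl, where g="\<lambda>s. Im (Hq q (Complex (ln s) \<theta>)) / s"])
        (auto intro!: continuous_intros)
  qed
  \<comment> \<open>In the substitution \<open>s = exp x\<close> the Jacobian cancels the factor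
    \<open>1 / s\<close>.\<close>
  have sub: "integral {- A..A} (\<lambda>x. Im (Hq q (Complex x \<theta>))) = integral {exp (-A)..exp A} (laplace_ray q)" if "A \<ge> 0" for A
  proof -
    have "((\<lambda>x. exp x *\<^sub>R laplace_ray q (exp x)) has_integral integral {exp (-A)..exp A} (laplace_ray q)) {-A..A}"
      by (rule has_integral_substitution[where c="exp (-A)" and d="exp A"])
         (use that in \<open>auto intro!: cont derivative_eq_intros\<close>)
    moreover have "exp x *\<^sub>R laplace_ray q (exp x) = Im (Hq q (Complex x \<theta>))" for x
      unfolding laplace_ray_def Hq_def exp_conv_cis \<theta>_def by simp
    ultimately show ?thesis by (simp add: integral_unique)
  qed
  have U: "(\<Union>n. {exp (- real (n + N))..exp (real (n + N))}) = {0<..}"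
  proof safe
    fix s :: real assume s: "0 < s"
    obtain n where "real n \<ge> \<bar>ln s\<bar>" using real_arch_simple by blast
    then have "- real (n + N) \<le> ln s" "ln s \<le> real (n + N)" by auto
    then have "s \<in> {exp (- real (n + N))..exp (real (n + N))}"
      using s by (simp add: ln_ge_iff[symmetric]) (metis exp_le_cancel_iff exp_ln)
    then show "s \<in> (\<Union>n. {exp (- real (n + N))..exp (real (n + N))})" by blast
  qed (auto intro: less_le_trans[OF exp_gt_zero])
  have "(\<lambda>n. LINT s:{exp (- real (n + N))..exp (real (n + N))}|lborel. laplace_ray q s)
     \<longlonglongrightarrow> (LINT s:(\<Union>n. {exp (- real (n + N))..exp (real (n + N))})|lborel. laplace_ray q s)"
  proof (rule set_integral_cont_up)
    show "set_integrable lborel (\<Union>n. {exp (- real (n + N))..exp (real (n + N))}) (laplace_ray q)"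
      unfolding U by (rule i)
  qed (auto simp: incseq_def)
  moreover have "(LINT s:{exp (- real (n + N))..exp (real (n + N))}|lborel. laplace_ray q s)
      = integral {- real (n + N)..real (n + N)} (\<lambda>x. Im (Hq q (Complex x \<theta>)))" for n
    by (subst sub, simp, rule set_borel_integral_eq_integral(2), rule set_integrable_subset[OF i])
       (auto intro: less_le_trans[OF exp_gt_zero])
  ultimately have lim2: "(\<lambda>n. integral {- real (n + N)..real (n + N)} (\<lambda>x. Im (Hq q (Complex x \<theta>))))
     \<longlonglongrightarrow> (LINT s:{0<..}|lborel. laplace_ray q s)"
    unfolding U by simp
  show ?thesis using LIMSEQ_unique[OF lim2 lim1] unfolding \<theta>_def c0_def .
qed

end

section \<open>The Laplace transform of the tail\<close>

lemma cis_three_quarters: "Re (cis (3 * pi / 4)) = - (1 / sqrt 2)" "Im (cis (3 * pi / 4)) = 1 / sqrt 2"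
proof -
  have e: "3 * pi / 4 = pi - pi / 4" by simp
  show "Re (cis (3 * pi / 4)) = - (1 / sqrt 2)"
    unfolding cis.sel e cos_pi_minus cos_45 by (simp add: real_div_sqrt field_simps)
  show "Im (cis (3 * pi / 4)) = 1 / sqrt 2"
    unfolding cis.sel e sin_pi_minus sin_45 by (simp add: real_div_sqrt field_simps)
qed

lemma set_integrable_powr_three_halves:
  "set_integrable lborel {1..} (\<lambda>s::real. s powr (- 3 / 2))"
proof -
  have "(\<lambda>s::real. s powr (- 3 / 2)) integrable_on {1..}"
    using has_integral_powr_to_inf[of "-3/2" 1] by (auto simp: integrable_on_def)
  then have "(\<lambda>s::real. s powr (- 3 / 2)) absolutely_integrable_on {1..}"
    by (intro nonnegative_absolutely_integrable_1) auto
  then show ?thesis unfolding set_integrable_def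
    by (subst (asm) integrable_completion) auto
qed

lemma integral_exp_real:
  fixes a :: real
  assumes "a > 0"
  shows "set_integrable lborel {0<..} (\<lambda>t. exp (- (a * t)))"
    and "(LINT t:{0<..}|lborel. exp (- (a * t))) = 1 / a"
proof -
  show i: "set_integrable lborel {0<..} (\<lambda>t. exp (- (a * t)))"
    using integrable_I0i_exp_mscale[OF assms] by (simp add: mult.commute)
  have "complex_of_real (LINT t:{0<..}|lborel. exp (- (a * t))) = (LINT t:{0<..}|lborel. exp (- (of_real t * complex_of_real a)))"
    unfolding set_lebesgue_integral_def integral_complex_of_real[symmetric]
    by (intro Bochner_Integration.integral_cong refl) (simp add: exp_of_real[symmetric] scaleR_conv_of_real mult.commute)
  also have "\<dots> = 1 / complex_of_real a" by (rule integral_exp_complex(2)) (use assms in simp)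
  also have "\<dots> = complex_of_real (1 / a)" by simp
  finally show "(LINT t:{0<..}|lborel. exp (- (a * t))) = 1 / a" by (simp only: of_real_eq_iff)
qed

section \<open>Integrability along the ray and exchange of the two integrals\<close>

context levy_exponent
begin

lemma ray_integrand_measurable [measurable]:
  "(\<lambda>(s, t). ray_integrand t s) \<in> borel_measurable (borel \<Otimes>\<^sub>M borel)"
  unfolding ray_integrand_def by measurable

lemma ray_integrand_measurable1 [measurable]: "ray_integrand t \<in> borel_measurable borel"
  unfolding ray_integrand_def by measurable

lemma cmod_exp_ray: "cmod (exp (of_real (t * s) * cis (3 * pi / 4))) = exp (- (t * s / sqrt 2))"
  by (simp add: norm_exp_eq_Re cis_three_quarters del: cis.sel)

lemma cmod_inverse_resC_le:
  assumes "s > 0"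
  shows "cmod (1 / resC (of_real s * cis (3 * pi / 4))) \<le> 1 / (\<kappa> * res s)"
proof -
  have "\<kappa> * res s \<le> cmod (resC (of_real s * cis (3 * pi / 4)))"
    by (rule cmod_resC_ge_kappa[OF assms]) (use pi_gt_zero in auto)
  then show ?thesis using kappa_pos res_pos[OF assms] by (simp add: norm_divide frac_le)
qed

lemma abs_ray_integrand_le:
  assumes s: "s > 0"
  shows "\<bar>ray_integrand t s\<bar> \<le> exp (- (t * s / sqrt 2)) / (\<kappa> * res s) / s"
proof -
  have "\<bar>Im (exp (of_real (t * s) * cis (3 * pi / 4)) / resC (of_real s * cis (3 * pi / 4)))\<bar>
      \<le> cmod (exp (of_real (t * s) * cis (3 * pi / 4)) * (1 / resC (of_real s * cis (3 * pi / 4))))"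
    using abs_Im_le_cmod by simp
  also have "\<dots> \<le> exp (- (t * s / sqrt 2)) * (1 / (\<kappa> * res s))"
    unfolding norm_mult cmod_exp_ray by (intro mult_left_mono cmod_inverse_resC_le s) simp
  finally have "\<bar>Im (exp (of_real (t * s) * cis (3 * pi / 4)) / resC (of_real s * cis (3 * pi / 4)))\<bar> / \<bar>s\<bar>
      \<le> exp (- (t * s / sqrt 2)) * (1 / (\<kappa> * res s)) / \<bar>s\<bar>"
    by (rule divide_right_mono) simp
  then show ?thesis unfolding ray_integrand_def abs_divide using s by simp
qed

lemma abs_ray_integrand_large:
  assumes s: "s \<ge> 1"
  shows "\<bar>ray_integrand t s\<bar> \<le> exp (- (t * s / sqrt 2)) * (5 / (2 * \<kappa>) / sqrt s)"
proof -
  have "\<kappa> * (2 / (5 * sqrt s)) \<le> \<kappa> * res s"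
    using kappa_pos s by (intro mult_left_mono res_lower_bound) auto
  moreover have "0 < \<kappa> * (2 / (5 * sqrt s))" using kappa_pos s by simp
  ultimately have "exp (- (t * s / sqrt 2)) / (\<kappa> * res s) / s \<le> exp (- (t * s / sqrt 2)) / (\<kappa> * (2 / (5 * sqrt s))) / s"
    using s by (intro divide_right_mono divide_left_mono mult_pos_pos) (auto simp: kappa_pos intro: res_pos)
  also have "\<dots> = exp (- (t * s / sqrt 2)) * (5 / (2 * \<kappa>)) * (sqrt s / s)"
    using kappa_pos by simp
  also have "sqrt s / s = 1 / sqrt s" using s by (simp add: real_div_sqrt field_simps)
  finally have "exp (- (t * s / sqrt 2)) / (\<kappa> * res s) / s \<le> exp (- (t * s / sqrt 2)) * (5 / (2 * \<kappa>) / sqrt s)"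
    by simp
  then show ?thesis using abs_ray_integrand_le[of s t] s by linarith
qed

text \<open>The estimate through moduli alone is of order \<open>1 / (s * res s)\<close>, which is
  not integrable at 0 when \<open>1 / res\<close> has a positive limit. In
  \<open>Re E * Im W + Im E * Re W\<close>, however, each product contains an imaginary part with an
  additional factor \<open>s\<close>: that of \<open>E\<close> is at most \<open>t * s\<close>, that
  of \<open>W\<close> is governed by \<open>s * res2 s\<close>. The power
  \<open>\<kappa> ^ 4\<close> is \<open>\<kappa>\<^sup>2\<close> from \<open>abs_Im_resC_le\<close>
  times \<open>\<kappa>\<^sup>2\<close> from the squared modulus of \<open>resC\<close>.\<close>

lemma abs_ray_integrand_small:
  assumes s: "0 < s" "s < 1" and t: "t \<ge> 0"
  shows "\<bar>ray_integrand t s\<bar> \<le> res2 s / (res s)\<^sup>2 / \<kappa> ^ 4 + t / (\<kappa> * res 1)"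
proof -
  define E where "E = exp (of_real (t * s) * cis (3 * pi / 4))"
  define W where "W = 1 / resC (of_real s * cis (3 * pi / 4))"
  have th: "\<bar>3 * pi / 4\<bar> < pi" using pi_gt_zero by auto
  have k: "cos (3 * pi / 4 / 2) = \<kappa>" unfolding \<kappa>_def by simp
  have kr: "\<kappa> * res s \<le> cmod (resC (of_real s * cis (3 * pi / 4)))" "0 < \<kappa> * res s"
    using cmod_resC_ge[OF s(1) th] kappa_pos res_pos[OF s(1)] unfolding k by auto
  have E1: "cmod E \<le> 1" unfolding E_def cmod_exp_ray using s t by simp
  have "Im E = exp (- (t * s / sqrt 2)) * sin (t * s / sqrt 2)"
    unfolding E_def by (simp add: Im_exp cis_three_quarters del: cis.sel)
  also have "\<bar>\<dots>\<bar> \<le> 1 * \<bar>t * s / sqrt 2\<bar>"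
    unfolding abs_mult using s t by (intro mult_mono abs_sin_x_le_abs_x) auto
  also have "\<dots> \<le> t * s"
    using s t by (simp add: divide_le_eq mult_le_cancel_left1) (smt (verit) mult_nonneg_nonneg real_sqrt_ge_one mult_left_le)
  finally have E2: "\<bar>Im E\<bar> \<le> t * s" .
  have W1: "cmod W \<le> 1 / (\<kappa> * res s)" unfolding W_def by (rule cmod_inverse_resC_le[OF s(1)])
  have "\<bar>Im W\<bar> = \<bar>Im (resC (of_real s * cis (3 * pi / 4)))\<bar> / (cmod (resC (of_real s * cis (3 * pi / 4))))\<^sup>2"
    unfolding W_def by (simp add: Im_divide cmod_power2)
  also have "\<dots> \<le> (s * res2 s / \<kappa>\<^sup>2) / (\<kappa> * res s)\<^sup>2"
    using abs_Im_resC_le[OF s(1) th] kr unfolding k by (intro frac_le power_mono) auto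
  also have "\<dots> = s * (res2 s / (res s)\<^sup>2 / \<kappa> ^ 4)"
    by (simp add: power_mult_distrib power4_eq_xxxx power2_eq_square)
  finally have W2: "\<bar>Im W\<bar> \<le> s * (res2 s / (res s)\<^sup>2 / \<kappa> ^ 4)" .
  have "\<bar>Im (E * W)\<bar> \<le> \<bar>Re E\<bar> * \<bar>Im W\<bar> + \<bar>Im E\<bar> * \<bar>Re W\<bar>"
    by (simp add: abs_mult[symmetric] abs_triangle_ineq)
  also have "\<dots> \<le> 1 * (s * (res2 s / (res s)\<^sup>2 / \<kappa> ^ 4)) + t * s * (1 / (\<kappa> * res 1))"
  proof (intro add_mono mult_mono)
    show "\<bar>Re E\<bar> \<le> 1" using abs_Re_le_cmod[of E] E1 by linarith
    have "1 / (\<kappa> * res s) \<le> 1 / (\<kappa> * res 1)"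
      using kappa_pos res_pos[of 1] res_antimono[OF s(1), of 1] s by (intro frac_le mult_left_mono) auto
    then show "\<bar>Re W\<bar> \<le> 1 / (\<kappa> * res 1)" using abs_Re_le_cmod[of W] W1 by linarith
  qed (use E2 W2 s t in auto)
  also have "\<dots> = (res2 s / (res s)\<^sup>2 / \<kappa> ^ 4 + t / (\<kappa> * res 1)) * s" by (simp add: algebra_simps)
  finally have "\<bar>Im (E * W)\<bar> \<le> (res2 s / (res s)\<^sup>2 / \<kappa> ^ 4 + t / (\<kappa> * res 1)) * s" .
  moreover have "\<bar>ray_integrand t s\<bar> = \<bar>Im (E * W)\<bar> / s"
    unfolding ray_integrand_def E_def W_def using s by simp
  ultimately show ?thesis using s by (simp add: pos_divide_le_eq)
qed

text \<open>Bounds the integral over \<open>t\<close> of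
  \<open>exp (- (q * t)) * \<bar>ray_integrand t s\<bar>\<close>. For \<open>s < 1\<close> the
  factor \<open>2 / q\<close> occurs twice because \<open>t\<close> is absorbed by half of the
  exponential weight, \<open>t \<le> 2 / q * exp (q / 2 * t)\<close>, and the other half is then
  integrated. For \<open>s \<ge> 1\<close> the exponent -3/2 combines \<open>1 / sqrt s\<close> from
  the size of the integrand with \<open>1 / s\<close> from its decay in \<open>t\<close>.\<close>

definition ray_bound :: "real \<Rightarrow> real \<Rightarrow> real" where
  "ray_bound q s = indicator {0<..<1} s * (res2 s / (res s)\<^sup>2 / \<kappa> ^ 4 / q + 2 / q / (\<kappa> * res 1) * (2 / q))
     + indicator {1..} s * (5 * sqrt 2 / (2 * \<kappa>) * s powr (- 3 / 2))"

lemma ray_bound_integrable: "integrable lborel (ray_bound q)"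
proof -
  have "integrable lborel (\<lambda>s. indicator {0<..<1} s * (res2 s / (res s)\<^sup>2))"
    using integrable_res2_divide_res by (simp add: set_integrable_def)
  then have 1: "integrable lborel (\<lambda>s. (1 / \<kappa> ^ 4 / q) * (indicator {0<..<1} s * (res2 s / (res s)\<^sup>2)))"
    by (rule integrable_mult_right)
  have 2: "integrable lborel (\<lambda>s. (2 / q / (\<kappa> * res 1) * (2 / q)) * indicator {0<..<1::real} s)"
    by (rule integrable_mult_right) simp
  have "integrable lborel (\<lambda>s. indicator {1..} s * (s powr (- 3 / 2) :: real))"
    using set_integrable_powr_three_halves by (simp add: set_integrable_def)
  then have 3: "integrable lborel (\<lambda>s. (5 * sqrt 2 / (2 * \<kappa>)) * (indicator {1..} s * (s powr (- 3 / 2) :: real)))"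
    by (rule integrable_mult_right)
  have eq: "ray_bound q = (\<lambda>s. (1 / \<kappa> ^ 4 / q) * (indicator {0<..<1} s * (res2 s / (res s)\<^sup>2))
      + (2 / q / (\<kappa> * res 1) * (2 / q)) * indicator {0<..<1::real} s
      + (5 * sqrt 2 / (2 * \<kappa>)) * (indicator {1..} s * (s powr (- 3 / 2) :: real)))"
    unfolding ray_bound_def by (intro ext) (simp add: algebra_simps)
  show ?thesis unfolding eq
    by (intro Bochner_Integration.integrable_add 1 2 3)
qed

lemma ray_inner_bound:
  assumes q: "q > 0" and s: "s > 0"
  shows "set_integrable lborel {0<..} (\<lambda>t. exp (- (q * t)) * ray_integrand t s)"
    and "(LINT t:{0<..}|lborel. norm (exp (- (q * t)) * ray_integrand t s)) \<le> ray_bound q s"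
proof -
  have main: "set_integrable lborel {0<..} (\<lambda>t. exp (- (q * t)) * ray_integrand t s) \<and>
    (LINT t:{0<..}|lborel. norm (exp (- (q * t)) * ray_integrand t s)) \<le> (LINT t:{0<..}|lborel. g t)"
    if g: "set_integrable lborel {0<..} g" "\<And>t. t > 0 \<Longrightarrow> norm (exp (- (q * t)) * ray_integrand t s) \<le> g t" for g
  proof
    show i: "set_integrable lborel {0<..} (\<lambda>t. exp (- (q * t)) * ray_integrand t s)"
      by (rule set_integrable_bound[OF g(1)]) (use g(2) in \<open>force simp: set_borel_measurable_def\<close>)+
    show "(LINT t:{0<..}|lborel. norm (exp (- (q * t)) * ray_integrand t s)) \<le> (LINT t:{0<..}|lborel. g t)"
      by (rule set_integral_mono[OF set_integrable_norm[OF i] g(1)]) (use g(2) in auto)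
  qed
  have "\<exists>g. set_integrable lborel {0<..} g \<and> (\<forall>t>0. norm (exp (- (q * t)) * ray_integrand t s) \<le> g t) \<and>
     (LINT t:{0<..}|lborel. g t) \<le> ray_bound q s"
  proof (cases "s < 1")
    case True
    define D where "D = res2 s / (res s)\<^sup>2 / \<kappa> ^ 4"
    define C where "C = 2 / q / (\<kappa> * res 1)"
    have C: "C \<ge> 0" unfolding C_def using q kappa_pos res_pos[of 1] by simp
    define g where "g t = D * exp (- (q * t)) + C * exp (- (q / 2 * t))" for t
    have i: "set_integrable lborel {0<..} (\<lambda>t. D * exp (- (q * t)))" "set_integrable lborel {0<..} (\<lambda>t. C * exp (- (q / 2 * t)))"
      using integral_exp_real(1)[of q] integral_exp_real(1)[of "q / 2"] q by auto
    have "(LINT t:{0<..}|lborel. g t) = (LINT t:{0<..}|lborel. D * exp (- (q * t))) + (LINT t:{0<..}|lborel. C * exp (- (q / 2 * t)))"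
      unfolding g_def by (rule set_integral_add(2)[OF i])
    also have "\<dots> = D * (1 / q) + C * (1 / (q / 2))"
      using integral_exp_real(2)[of q] integral_exp_real(2)[of "q / 2"] q by (simp only: set_integral_mult_right)
    also have "\<dots> = ray_bound q s" unfolding ray_bound_def D_def C_def using s True by simp
    finally have v: "(LINT t:{0<..}|lborel. g t) = ray_bound q s" .
    have "norm (exp (- (q * t)) * ray_integrand t s) \<le> g t" if t: "t > 0" for t
    proof -
      have "q / 2 * t \<le> exp (q / 2 * t)" using exp_ge_add_one_self[of "q / 2 * t"] by linarith
      then have "t \<le> 2 / q * exp (q / 2 * t)" using q by (simp add: field_simps)
      then have "exp (- (q * t)) * t \<le> exp (- (q * t)) * (2 / q * exp (q / 2 * t))" by (intro mult_left_mono) auto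
      also have "\<dots> = 2 / q * exp (- (q / 2 * t))" by (simp add: exp_add[symmetric])
      finally have "exp (- (q * t)) * t / (\<kappa> * res 1) \<le> 2 / q * exp (- (q / 2 * t)) / (\<kappa> * res 1)"
        using kappa_pos res_pos[of 1] by (intro divide_right_mono) auto
      then have "exp (- (q * t)) * t / (\<kappa> * res 1) \<le> C * exp (- (q / 2 * t))"
        unfolding C_def by simp
      moreover have "norm (exp (- (q * t)) * ray_integrand t s) \<le> exp (- (q * t)) * (D + t / (\<kappa> * res 1))"
        unfolding D_def using abs_ray_integrand_small[OF s True, of t] t by (simp add: abs_mult)
      ultimately show ?thesis unfolding g_def by (simp add: algebra_simps)
    qed
    moreover have "set_integrable lborel {0<..} g" unfolding g_def by (rule set_integral_add(1)[OF i])
    ultimately show ?thesis using v by (intro exI[of _ g]) auto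
  next
    case False
    define C where "C = 5 / (2 * \<kappa>) / sqrt s"
    have C: "C \<ge> 0" unfolding C_def using s kappa_pos by simp
    have a: "q + s / sqrt 2 > 0" using q s by (intro add_pos_pos) auto
    define g where "g t = C * exp (- ((q + s / sqrt 2) * t))" for t
    have i: "set_integrable lborel {0<..} g" unfolding g_def using integral_exp_real(1)[OF a] by simp
    have "(LINT t:{0<..}|lborel. g t) = C * (1 / (q + s / sqrt 2))"
      unfolding g_def using integral_exp_real(2)[OF a] by simp
    \<comment> \<open>The rate \<open>q\<close> is dropped in favour of \<open>s / sqrt 2\<close>,
      the source of the extra power of \<open>s\<close>.\<close>
    also have "\<dots> \<le> C * (1 / (s / sqrt 2))" using C q s by (intro mult_left_mono frac_le) auto
    also have "\<dots> = 5 * sqrt 2 / (2 * \<kappa>) * (1 / (sqrt s * s))" unfolding C_def by simp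
    also have "sqrt s * s = s powr (3 / 2)" using s by (simp add: powr_half_sqrt[symmetric] powr_mult_base mult.commute)
    also have "1 / s powr (3 / 2) = s powr (- 3 / 2)" by (simp add: powr_minus_divide)
    finally have v: "(LINT t:{0<..}|lborel. g t) \<le> ray_bound q s" unfolding ray_bound_def using False by simp
    have "norm (exp (- (q * t)) * ray_integrand t s) \<le> g t" if t: "t > 0" for t
    proof -
      have "norm (exp (- (q * t)) * ray_integrand t s) \<le> exp (- (q * t)) * (exp (- (t * s / sqrt 2)) * C)"
      proof -
        have "\<bar>ray_integrand t s\<bar> \<le> exp (- (t * s / sqrt 2)) * C"
          unfolding C_def using False by (intro abs_ray_integrand_large) simp
        then have "exp (- (q * t)) * \<bar>ray_integrand t s\<bar> \<le> exp (- (q * t)) * (exp (- (t * s / sqrt 2)) * C)"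
          by (rule mult_left_mono) simp
        then show ?thesis by (simp only: real_norm_def abs_mult abs_exp_cancel)
      qed
      also have "\<dots> = g t" unfolding g_def by (simp add: algebra_simps exp_add[symmetric])
      finally show ?thesis .
    qed
    then show ?thesis using i v by blast
  qed
  then obtain g where g: "set_integrable lborel {0<..} g" "\<And>t. t > 0 \<Longrightarrow> norm (exp (- (q * t)) * ray_integrand t s) \<le> g t"
     "(LINT t:{0<..}|lborel. g t) \<le> ray_bound q s" by blast
  show "set_integrable lborel {0<..} (\<lambda>t. exp (- (q * t)) * ray_integrand t s)"
    using main[OF g(1,2)] by blast
  show "(LINT t:{0<..}|lborel. norm (exp (- (q * t)) * ray_integrand t s)) \<le> ray_bound q s"
    using main[OF g(1,2)] g(3) by linarith
qed

lemma ray_inner_integral: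
  assumes q: "q > 0" and s: "s > 0"
  shows "(LINT t:{0<..}|lborel. exp (- (q * t)) * ray_integrand t s) = laplace_ray q s"
proof -
  define \<omega> where "\<omega> = cis (3 * pi / 4)"
  define W where "W = 1 / resC (of_real s * \<omega>)"
  define a where "a = of_real q - of_real s * \<omega>"
  \<comment> \<open>Positive because the ray points into the left half-plane: the time integral
    converges for every \<open>q > 0\<close>, however large \<open>s\<close> is.\<close>
  have a: "Re a > 0" unfolding a_def \<omega>_def using q s by (simp add: cis_three_quarters add_pos_pos del: cis.sel)
  have "exp (- (q * t)) * ray_integrand t s = Im (exp (- (of_real t * a)) * W) / s" for t
  proof -
    have "of_real (exp (- (q * t))) * (exp (of_real (t * s) * \<omega>) / resC (of_real s * \<omega>)) = exp (- (of_real t * a)) * W"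
      unfolding W_def a_def exp_of_real[symmetric] by (simp add: exp_add[symmetric] algebra_simps)
    note eq = this
    have r: "c * Im z = Im (of_real c * z)" for c z by simp
    have "exp (- (q * t)) * ray_integrand t s
        = exp (- (q * t)) * Im (exp (of_real (t * s) * \<omega>) / resC (of_real s * \<omega>)) / s"
      unfolding ray_integrand_def \<omega>_def[symmetric] by (rule times_divide_eq_right)
    then show ?thesis unfolding r eq .
  qed
  then have "(LINT t:{0<..}|lborel. exp (- (q * t)) * ray_integrand t s) = (LINT t:{0<..}|lborel. Im (exp (- (of_real t * a)) * W)) / s"
    by simp
  also have "(LINT t:{0<..}|lborel. Im (exp (- (of_real t * a)) * W)) = Im ((LINT t:{0<..}|lborel. exp (- (of_real t * a))) * W)"
  proof -
    have i: "integrable lborel (\<lambda>t. (indicator {0<..} t *\<^sub>R exp (- (of_real t * a))) * W)"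
      using integral_exp_complex(1)[OF a] unfolding set_integrable_def by (rule integrable_mult_left)
    have "(LINT t:{0<..}|lborel. Im (exp (- (of_real t * a)) * W)) = (LINT t|lborel. Im ((indicator {0<..} t *\<^sub>R exp (- (of_real t * a))) * W))"
      unfolding set_lebesgue_integral_def by (rule Bochner_Integration.integral_cong) (auto simp: indicator_def)
    also have "\<dots> = Im (LINT t|lborel. (indicator {0<..} t *\<^sub>R exp (- (of_real t * a))) * W)" by (rule integral_Im[OF i])
    also have "\<dots> = Im ((LINT t:{0<..}|lborel. exp (- (of_real t * a))) * W)"
      unfolding set_lebesgue_integral_def integral_mult_left_zero ..
    finally show ?thesis .
  qed
  also have "\<dots> = Im (W / a)" unfolding integral_exp_complex(2)[OF a] by simp
  finally show ?thesis unfolding laplace_ray_def W_def a_def \<omega>_def .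
qed

definition ray_joint :: "real \<Rightarrow> real \<Rightarrow> real \<Rightarrow> real" where
  "ray_joint q s t = indicator {0<..} s * (indicator {0<..} t * (exp (- (q * t)) * ray_integrand t s))"

lemma ray_joint_integrable:
  assumes q: "q > 0"
  shows "integrable (lborel \<Otimes>\<^sub>M lborel) (case_prod (ray_joint q))"
proof (rule lborel_pair.Fubini_integrable)
  show "case_prod (ray_joint q) \<in> borel_measurable (lborel \<Otimes>\<^sub>M lborel)"
    unfolding ray_joint_def by measurable
  have eq: "(LINT t|lborel. norm (ray_joint q s t)) = indicator {0<..} s * (LINT t:{0<..}|lborel. norm (exp (- (q * t)) * ray_integrand t s))" for s
    unfolding ray_joint_def set_lebesgue_integral_def
    by (simp add: abs_mult mult.assoc[symmetric] flip: integral_mult_right_zero)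
  show "integrable lborel (\<lambda>s. LINT t|lborel. norm (case (s, t) of (s, t) \<Rightarrow> ray_joint q s t))"
  proof (rule Bochner_Integration.integrable_bound[OF ray_bound_integrable[of q]])
    show "(\<lambda>s. LINT t|lborel. norm (case (s, t) of (s, t) \<Rightarrow> ray_joint q s t)) \<in> borel_measurable lborel"
      unfolding ray_joint_def by measurable
    have "norm (LINT t|lborel. norm (ray_joint q s t)) \<le> norm (ray_bound q s)" for s
    proof -
      have "0 \<le> (LINT t|lborel. norm (ray_joint q s t))" by (rule integral_nonneg_AE) auto
      moreover have "(LINT t|lborel. norm (ray_joint q s t)) \<le> \<bar>ray_bound q s\<bar>"
        unfolding eq using ray_inner_bound(2)[OF q, of s] by (cases "s > 0") auto
      ultimately show ?thesis by simp
    qed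
    then show "AE s in lborel. norm (LINT t|lborel. norm (case (s, t) of (s, t) \<Rightarrow> ray_joint q s t)) \<le> norm (ray_bound q s)"
      by simp
  qed
  show "AE s in lborel. integrable lborel (\<lambda>t. case (s, t) of (s, t) \<Rightarrow> ray_joint q s t)"
    using ray_inner_bound(1)[OF q] unfolding ray_joint_def set_integrable_def
    by (intro always_eventually allI) (auto simp: indicator_def)
qed

lemma laplace_ray_integrable:
  assumes q: "q > 0"
  shows "set_integrable lborel {0<..} (laplace_ray q)"
proof -
  have "(LINT t|lborel. ray_joint q s t) = indicator {0<..} s * laplace_ray q s" for s
    using ray_inner_integral[OF q, of s] unfolding ray_joint_def set_lebesgue_integral_def by (simp add: indicator_def)
  then show ?thesis
    using lborel_pair.integrable_fst[OF ray_joint_integrable[OF q]] by (simp add: set_integrable_def)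
qed

text \<open>The constant in \<open>tail\<close> transforms into \<open>3 * pi / 2 * c0 / q\<close>
  and cancels twice the arc contribution subtracted in \<open>integral_laplace_ray\<close>; what
  remains comes from the residue.\<close>

lemma tail_laplace:
  assumes q: "q > 0"
  shows "set_integrable lborel {0<..} (\<lambda>t. exp (- (q * t)) * tail t)"
    and "(LINT t:{0<..}|lborel. exp (- (q * t)) * tail t) = 2 * pi / (q * res q)"
proof -
  define c0 where "c0 = 1 / (LINT v|lborel. 1 / \<psi> v)"
  have inner_s: "(LINT s|lborel. ray_joint q s t) = indicator {0<..} t * (exp (- (q * t)) * (LINT s:{0<..}|lborel. ray_integrand t s))" for t
  proof -
    have "(LINT s|lborel. ray_joint q s t) = (LINT s|lborel. (indicator {0<..} t * exp (- (q * t))) * (indicator {0<..} s * ray_integrand t s))"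
      unfolding ray_joint_def by (simp add: mult_ac)
    then show ?thesis unfolding set_lebesgue_integral_def by simp
  qed
  have inner_t: "(LINT t|lborel. ray_joint q s t) = indicator {0<..} s * laplace_ray q s" for s
    using ray_inner_integral[OF q, of s] unfolding ray_joint_def set_lebesgue_integral_def by (simp add: indicator_def)
  have i1: "set_integrable lborel {0<..} (\<lambda>t. 2 * (exp (- (q * t)) * (LINT s:{0<..}|lborel. ray_integrand t s)))"
  proof -
    have "set_integrable lborel {0<..} (\<lambda>t. exp (- (q * t)) * (LINT s:{0<..}|lborel. ray_integrand t s))"
      using lborel_pair.integrable_snd[OF ray_joint_integrable[OF q]] unfolding inner_s by (simp add: set_integrable_def)
    then show ?thesis by (intro set_integrable_mult_right)
  qed
  have i2: "set_integrable lborel {0<..} (\<lambda>t. 3 * pi / 2 * c0 * exp (- (q * t)))"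
    using integral_exp_real(1)[OF q] by simp
  have e: "exp (- (q * t)) * tail t = 2 * (exp (- (q * t)) * (LINT s:{0<..}|lborel. ray_integrand t s)) + 3 * pi / 2 * c0 * exp (- (q * t))" for t
    unfolding tail_def c0_def by (simp add: algebra_simps)
  show "set_integrable lborel {0<..} (\<lambda>t. exp (- (q * t)) * tail t)"
    unfolding e by (rule set_integral_add(1)[OF i1 i2])
  have "(LINT t:{0<..}|lborel. exp (- (q * t)) * tail t) =
      (LINT t:{0<..}|lborel. 2 * (exp (- (q * t)) * (LINT s:{0<..}|lborel. ray_integrand t s))) + (LINT t:{0<..}|lborel. 3 * pi / 2 * c0 * exp (- (q * t)))"
    unfolding e by (rule set_integral_add(2)[OF i1 i2])
  also have "(LINT t:{0<..}|lborel. 3 * pi / 2 * c0 * exp (- (q * t))) = 3 * pi / 2 * c0 / q"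
    using integral_exp_real(2)[OF q] by simp
  also have "(LINT t:{0<..}|lborel. 2 * (exp (- (q * t)) * (LINT s:{0<..}|lborel. ray_integrand t s)))
      = 2 * (LINT t|lborel. LINT s|lborel. ray_joint q s t)"
    unfolding set_integral_mult_right inner_s set_lebesgue_integral_def[of _ "{0<..}" "\<lambda>t. exp (- (q * t)) * _ t"] by simp
  also have "(LINT t|lborel. LINT s|lborel. ray_joint q s t) = (LINT s:{0<..}|lborel. laplace_ray q s)"
    unfolding lborel_pair.Fubini_integral[OF ray_joint_integrable[OF q]] inner_t by (simp add: set_lebesgue_integral_def)
  also have "\<dots> = pi / (q * res q) - 3 * pi / 4 * (c0 / q)"
    unfolding c0_def by (rule integral_laplace_ray[OF q laplace_ray_integrable[OF q]])
  finally show "(LINT t:{0<..}|lborel. exp (- (q * t)) * tail t) = 2 * pi / (q * res q)"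
    by (simp add: algebra_simps)
qed

text \<open>Inversion by monotonicity identifies the limit at continuity points of
  \<open>tail\<close>, so continuity at \<open>T\<close> has to be supplied. Dominated convergence
  applies since for \<open>t\<close> near \<open>T > 0\<close> the exponential decay in
  \<open>s\<close> is uniform.\<close>

lemma isCont_tail:
  assumes T: "T > 0"
  shows "isCont tail T"
proof -
  \<comment> \<open>Valid for all \<open>t\<close> between \<open>T / 2\<close> and
    \<open>2 * T\<close>: the upper end controls the term linear in \<open>t\<close> near
    \<open>s = 0\<close>, the lower end the exponential at infinity.\<close>
  define b where "b s = indicator {0<..<1} s * (res2 s / (res s)\<^sup>2 / \<kappa> ^ 4 + 2 * T / (\<kappa> * res 1))
     + indicator {0<..} s * (5 / (2 * \<kappa>) * exp (- (T / 2 / sqrt 2 * s)))" for s :: real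
  have ib: "integrable lborel b"
  proof -
    have "integrable lborel (\<lambda>s. indicator {0<..<1} s * (res2 s / (res s)\<^sup>2))"
      using integrable_res2_divide_res by (simp add: set_integrable_def)
    then have 1: "integrable lborel (\<lambda>s. (1 / \<kappa> ^ 4) * (indicator {0<..<1} s * (res2 s / (res s)\<^sup>2)))"
      by (rule integrable_mult_right)
    have 2: "integrable lborel (\<lambda>s. (2 * T / (\<kappa> * res 1)) * indicator {0<..<1::real} s)"
      by (rule integrable_mult_right) simp
    have "integrable lborel (\<lambda>s. indicator {0<..} s * exp (- (T / 2 / sqrt 2 * s)))"
      using integral_exp_real(1)[of "T / 2 / sqrt 2"] T by (simp add: set_integrable_def)
    then have 3: "integrable lborel (\<lambda>s. 5 / (2 * \<kappa>) * (indicator {0<..} s * exp (- (T / 2 / sqrt 2 * s))))"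
      by (rule integrable_mult_right)
    have eq: "b = (\<lambda>s. (1 / \<kappa> ^ 4) * (indicator {0<..<1} s * (res2 s / (res s)\<^sup>2))
        + (2 * T / (\<kappa> * res 1)) * indicator {0<..<1::real} s + 5 / (2 * \<kappa>) * (indicator {0<..} s * exp (- (T / 2 / sqrt 2 * s))))"
      unfolding b_def by (intro ext) (simp add: algebra_simps)
    show ?thesis unfolding eq by (intro Bochner_Integration.integrable_add 1 2 3)
  qed
  have bound: "norm (indicator {0<..} s *\<^sub>R ray_integrand t s) \<le> b s" if t: "T / 2 < t" "t < 2 * T" for s t
  proof (cases "s > 0")
    case False
    then show ?thesis unfolding b_def by simp
  next
    case s: True
    have n: "0 \<le> 5 / (2 * \<kappa>) * exp (- (T / 2 / sqrt 2 * s))" using kappa_pos by simp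
    show ?thesis
    proof (cases "s < 1")
      case True
      have "t / (\<kappa> * res 1) \<le> 2 * T / (\<kappa> * res 1)"
        using t kappa_pos res_pos[of 1] by (intro divide_right_mono) auto
      then show ?thesis unfolding b_def using abs_ray_integrand_small[OF s True, of t] t T s True n by simp
    next
      case False
      have "exp (- (t * s / sqrt 2)) * (5 / (2 * \<kappa>) / sqrt s) \<le> exp (- (T / 2 / sqrt 2 * s)) * (5 / (2 * \<kappa>) / 1)"
      proof (intro mult_mono divide_left_mono)
        have "T / 2 * s / sqrt 2 \<le> t * s / sqrt 2" using t s by (intro divide_right_mono mult_right_mono) auto
        then show "exp (- (t * s / sqrt 2)) \<le> exp (- (T / 2 / sqrt 2 * s))" by simp
      qed (use False kappa_pos s in auto)
      then show ?thesis unfolding b_def using abs_ray_integrand_large[of s t] False s by simp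
    qed
  qed
  have "isCont (\<lambda>t. LINT s:{0<..}|lborel. ray_integrand t s) T"
    unfolding continuous_at_sequentially o_def
  proof (intro allI impI)
    fix x :: "nat \<Rightarrow> real" assume "x \<longlonglongrightarrow> T"
    \<comment> \<open>The sequence is clamped to a compact part of that range, so that the
      domination holds for every \<open>n\<close>; eventually \<open>y n = x n\<close>.\<close>
    define y where "y n = max (3 * T / 4) (min (3 * T / 2) (x n))" for n
    have y: "y \<longlonglongrightarrow> max (3 * T / 4) (min (3 * T / 2) T)" unfolding y_def by (intro tendsto_intros \<open>x \<longlonglongrightarrow> T\<close>)
    then have y: "y \<longlonglongrightarrow> T" using T by (simp add: max_def min_def)
    have "\<forall>\<^sub>F n in sequentially. x n \<in> {3 * T / 4<..<3 * T / 2}"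
      by (rule topological_tendstoD[OF \<open>x \<longlonglongrightarrow> T\<close>]) (use T in auto)
    then have xy: "\<forall>\<^sub>F n in sequentially. x n = y n" by eventually_elim (auto simp: y_def)
    have "(\<lambda>n. LINT s:{0<..}|lborel. ray_integrand (y n) s) \<longlonglongrightarrow> (LINT s:{0<..}|lborel. ray_integrand T s)"
      unfolding set_lebesgue_integral_def
    proof (rule integral_dominated_convergence[OF _ _ ib])
      show "AE s in lborel. (\<lambda>n. indicator {0<..} s *\<^sub>R ray_integrand (y n) s) \<longlonglongrightarrow> indicator {0<..} s *\<^sub>R ray_integrand T s"
      proof (intro always_eventually allI)
        fix s :: real
        show "(\<lambda>n. indicator {0<..} s *\<^sub>R ray_integrand (y n) s) \<longlonglongrightarrow> indicator {0<..} s *\<^sub>R ray_integrand T s"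
        proof (cases "s > 0")
          case True
          then have "resC (of_real s * cis (3 * pi / 4)) \<noteq> 0" by (rule resC_nonzero) simp
          then show ?thesis using True unfolding ray_integrand_def by (intro tendsto_intros y) simp_all
        qed simp
      qed
      show "AE s in lborel. norm (indicator {0<..} s *\<^sub>R ray_integrand (y n) s) \<le> b s" for n
        by (intro always_eventually allI bound) (use T in \<open>auto simp: y_def\<close>)
    qed measurable
    then show "(\<lambda>n. LINT s:{0<..}|lborel. ray_integrand (x n) s) \<longlonglongrightarrow> (LINT s:{0<..}|lborel. ray_integrand T s)"
      by (rule Lim_transform_eventually) (use xy in \<open>auto elim!: eventually_mono\<close>)
  qed
  then show ?thesis unfolding tail_def by (intro continuous_intros)
qed

end

section \<open>Increments of the difference of two independent stable processes\<close>

text \<open>The defining property of the process concerns a conditional expectation; tested against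
  a bounded weight known at time \<open>s\<close>, it becomes a factorization of expectations.
  Weights are complex, while \<open>complex_cond_exp\<close> is assembled from real conditional
  expectations, so the real version is applied to both parts of \<open>W\<close>.\<close>

lemma stable_increment_integral:
  fixes W :: "'a \<Rightarrow> complex"
  assumes M: "prob_space M" and F: "filtration_on M F" and X: "symmetric_stable_process M F \<alpha> X"
    and st: "0 \<le> s" "s < t"
    and W [measurable]: "W \<in> borel_measurable (F s)" and B: "\<And>\<omega>. cmod (W \<omega>) \<le> B"
  shows "(LINT \<omega>|M. W \<omega> * exp (\<i> * of_real (u * (X t \<omega> - X s \<omega>)))) =
     of_real (exp (- (t - s) * \<bar>u\<bar> powr \<alpha>)) * (LINT \<omega>|M. W \<omega>)"
proof -
  interpret prob_space M by (rule M)
  have sub: "subalgebra M (F r)" if "0 \<le> r" for r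
    using F that unfolding filtration_on_def by auto
  interpret sub: finite_measure_subalgebra M "F s"
    by unfold_locales (rule sub[OF st(1)])
  have Xm [measurable]: "X r \<in> borel_measurable M" if "0 \<le> r" for r
    using X that measurable_from_subalg[OF sub[OF that]] unfolding symmetric_stable_process_def adapted_to_def by blast
  have WM [measurable]: "W \<in> borel_measurable M" by (rule measurable_from_subalg[OF sub[OF st(1)] W])
  have Xst [measurable]: "X s \<in> borel_measurable M" "X t \<in> borel_measurable M" using st by auto
  define c where "c = exp (- (t - s) * \<bar>u\<bar> powr \<alpha>)"
  define C where "C \<omega> = cos (u * (X t \<omega> - X s \<omega>))" for \<omega>
  define S where "S \<omega> = sin (u * (X t \<omega> - X s \<omega>))" for \<omega>
  have [measurable]: "C \<in> borel_measurable M" "S \<in> borel_measurable M" unfolding C_def S_def by measurable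
  have e: "exp (\<i> * of_real (u * (X t \<omega> - X s \<omega>))) = Complex (C \<omega>) (S \<omega>)" for \<omega>
    unfolding C_def S_def by (simp add: complex_eq_iff Re_exp Im_exp)
  have ae: "AE \<omega> in M. complex_cond_exp M (F s) (\<lambda>\<omega>. Complex (C \<omega>) (S \<omega>)) \<omega> = of_real c"
    using X st unfolding symmetric_stable_process_def c_def e[symmetric] by blast
  have aeC: "AE \<omega> in M. real_cond_exp M (F s) C \<omega> = c" and aeS: "AE \<omega> in M. real_cond_exp M (F s) S \<omega> = 0"
    using ae unfolding complex_cond_exp_def by (auto simp: complex_eq_iff)
  have int: "integrable M g" if "g \<in> borel_measurable M" "\<And>\<omega>. \<bar>g \<omega>\<bar> \<le> B" for g :: "'a \<Rightarrow> real"
    by (rule integrable_const_bound[of _ B]) (use that in auto)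
  have B0: "0 \<le> B" using B[of undefined] norm_ge_zero order_trans by blast
  have bnd: "\<bar>w \<omega> * C \<omega>\<bar> \<le> B" "\<bar>w \<omega> * S \<omega>\<bar> \<le> B" if "\<bar>w \<omega>\<bar> \<le> B" for w \<omega>
    using that B0 mult_mono[of "\<bar>w \<omega>\<bar>" B "\<bar>C \<omega>\<bar>" 1] mult_mono[of "\<bar>w \<omega>\<bar>" B "\<bar>S \<omega>\<bar>" 1]
    unfolding C_def S_def by (auto simp: abs_mult)
  have wC: "(LINT \<omega>|M. w \<omega> * C \<omega>) = c * (LINT \<omega>|M. w \<omega>)" and wS: "(LINT \<omega>|M. w \<omega> * S \<omega>) = 0"
    and wCi: "integrable M (\<lambda>\<omega>. w \<omega> * C \<omega>)" and wSi: "integrable M (\<lambda>\<omega>. w \<omega> * S \<omega>)"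
    if w [measurable]: "w \<in> borel_measurable (F s)" and wB: "\<And>\<omega>. \<bar>w \<omega>\<bar> \<le> B" for w
  proof -
    have [measurable]: "w \<in> borel_measurable M" by (rule measurable_from_subalg[OF sub[OF st(1)] w])
    show i1: "integrable M (\<lambda>\<omega>. w \<omega> * C \<omega>)" by (rule int) (auto intro: bnd wB)
    show i2: "integrable M (\<lambda>\<omega>. w \<omega> * S \<omega>)" by (rule int) (auto intro: bnd wB)
    have "(LINT \<omega>|M. w \<omega> * C \<omega>) = (LINT \<omega>|M. w \<omega> * real_cond_exp M (F s) C \<omega>)"
      using sub.real_cond_exp_intg(2)[OF i1 w] by simp
    also have "\<dots> = (LINT \<omega>|M. w \<omega> * c)" by (rule integral_cong_AE) (use aeC in auto)
    finally show "(LINT \<omega>|M. w \<omega> * C \<omega>) = c * (LINT \<omega>|M. w \<omega>)" by simp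
    have "(LINT \<omega>|M. w \<omega> * S \<omega>) = (LINT \<omega>|M. w \<omega> * real_cond_exp M (F s) S \<omega>)"
      using sub.real_cond_exp_intg(2)[OF i2 w] by simp
    also have "\<dots> = (LINT \<omega>|M. w \<omega> * 0)" by (rule integral_cong_AE) (use aeS in auto)
    finally show "(LINT \<omega>|M. w \<omega> * S \<omega>) = 0" by simp
  qed
  have ReW: "(\<lambda>\<omega>. Re (W \<omega>)) \<in> borel_measurable (F s)" "\<And>\<omega>. \<bar>Re (W \<omega>)\<bar> \<le> B"
    and ImW: "(\<lambda>\<omega>. Im (W \<omega>)) \<in> borel_measurable (F s)" "\<And>\<omega>. \<bar>Im (W \<omega>)\<bar> \<le> B"
    using order_trans[OF abs_Re_le_cmod B] order_trans[OF abs_Im_le_cmod B] by auto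
  note R = wC[OF ReW] wS[OF ReW] wCi[OF ReW] wSi[OF ReW]
  note I = wC[OF ImW] wS[OF ImW] wCi[OF ImW] wSi[OF ImW]
  have iW: "integrable M W" by (rule integrable_const_bound[of _ B]) (auto intro: B)
  have iE: "integrable M (\<lambda>\<omega>. W \<omega> * Complex (C \<omega>) (S \<omega>))"
  proof (rule integrable_const_bound[of _ B])
    have "cmod (Complex (C \<omega>) (S \<omega>)) = 1" for \<omega> unfolding e[symmetric] by simp
    then show "AE \<omega> in M. cmod (W \<omega> * Complex (C \<omega>) (S \<omega>)) \<le> B" by (simp add: norm_mult B)
    show "(\<lambda>\<omega>. W \<omega> * Complex (C \<omega>) (S \<omega>)) \<in> borel_measurable M" unfolding e[symmetric] by measurable
  qed
  have "Re (LINT \<omega>|M. W \<omega> * Complex (C \<omega>) (S \<omega>)) = (LINT \<omega>|M. Re (W \<omega>) * C \<omega> - Im (W \<omega>) * S \<omega>)"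
    using iE by (subst integral_Re[symmetric]) auto
  also have "\<dots> = c * Re (LINT \<omega>|M. W \<omega>)" using R I iW by (simp add: integral_Re)
  finally have 1: "Re (LINT \<omega>|M. W \<omega> * Complex (C \<omega>) (S \<omega>)) = c * Re (LINT \<omega>|M. W \<omega>)" .
  have "Im (LINT \<omega>|M. W \<omega> * Complex (C \<omega>) (S \<omega>)) = (LINT \<omega>|M. Re (W \<omega>) * S \<omega> + Im (W \<omega>) * C \<omega>)"
    using iE by (subst integral_Im[symmetric]) auto
  also have "\<dots> = c * Im (LINT \<omega>|M. W \<omega>)" using R I iW by (simp add: integral_Im)
  finally have 2: "Im (LINT \<omega>|M. W \<omega> * Complex (C \<omega>) (S \<omega>)) = c * Im (LINT \<omega>|M. W \<omega>)" .
  show ?thesis unfolding e c_def[symmetric] using 1 2 by (simp add: complex_eq_iff)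
qed

text \<open>Decoupling: the two arguments are evaluated at separate sample points, so either path
  can be frozen while the other is integrated. Both orders are provided, since
  \<open>increment_integral\<close> freezes first one path and then the other.\<close>

lemma (in prob_space) indep_var_double_integral:
  fixes G :: "_ \<Rightarrow> complex"
  assumes ind: "indep_var S A S' B"
    and G [measurable]: "G \<in> borel_measurable (S \<Otimes>\<^sub>M S')" and Gb: "\<And>p. cmod (G p) \<le> K"
  shows "(LINT \<omega>|M. G (A \<omega>, B \<omega>)) = (LINT \<omega>'|M. LINT \<omega>|M. G (A \<omega>, B \<omega>'))"
    and "(LINT \<omega>|M. G (A \<omega>, B \<omega>)) = (LINT \<omega>|M. LINT \<omega>'|M. G (A \<omega>, B \<omega>'))"
proof -
  have [measurable]: "A \<in> measurable M S" "B \<in> measurable M S'"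
    using ind by (auto dest: indep_var_rv1 indep_var_rv2)
  interpret A: prob_space "distr M S A" by (rule prob_space_distr) simp
  interpret B: prob_space "distr M S' B" by (rule prob_space_distr) simp
  interpret AB: pair_prob_space "distr M S A" "distr M S' B" ..
  have d: "distr M (S \<Otimes>\<^sub>M S') (\<lambda>\<omega>. (A \<omega>, B \<omega>)) = distr M S A \<Otimes>\<^sub>M distr M S' B"
    using ind unfolding indep_var_distribution_eq by simp
  have sets: "sets (distr M S A \<Otimes>\<^sub>M distr M S' B) = sets (S \<Otimes>\<^sub>M S')" by (rule sets_pair_measure_cong) auto
  have Gm: "G \<in> borel_measurable (distr M S A \<Otimes>\<^sub>M distr M S' B)"
    using G by (simp cong: measurable_cong_sets add: sets)
  have i: "integrable (distr M S A \<Otimes>\<^sub>M distr M S' B) G"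
    by (rule AB.P.integrable_const_bound[of _ K]) (auto intro: Gb Gm)
  have "(LINT \<omega>|M. G (A \<omega>, B \<omega>)) = integral\<^sup>L (distr M S A \<Otimes>\<^sub>M distr M S' B) G"
    unfolding d[symmetric] by (rule integral_distr[symmetric]) auto
  also have "\<dots> = (LINT x|distr M S A. LINT y|distr M S' B. G (x, y))"
    by (rule AB.integral_fst'[symmetric, OF i])
  finally have 1: "(LINT \<omega>|M. G (A \<omega>, B \<omega>)) = (LINT x|distr M S A. LINT y|distr M S' B. G (x, y))" .
  have 2: "(LINT x|distr M S A. LINT y|distr M S' B. G (x, y)) = (LINT y|distr M S' B. LINT x|distr M S A. G (x, y))"
    by (rule AB.Fubini_integral[symmetric]) (use i in simp)
  have sB: "sets (S \<Otimes>\<^sub>M distr M S' B) = sets (S \<Otimes>\<^sub>M S')" by (rule sets_pair_measure_cong) auto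
  have sA: "sets (S' \<Otimes>\<^sub>M distr M S A) = sets (S' \<Otimes>\<^sub>M S)" by (rule sets_pair_measure_cong) auto
  have Bm: "(\<lambda>x. LINT y|distr M S' B. G (x, y)) \<in> borel_measurable S"
  proof (rule B.borel_measurable_lebesgue_integral)
    have "(\<lambda>p. G (fst p, snd p)) \<in> borel_measurable (S \<Otimes>\<^sub>M S')" by measurable
    then show "(\<lambda>(x, y). G (x, y)) \<in> borel_measurable (S \<Otimes>\<^sub>M distr M S' B)"
      unfolding case_prod_beta measurable_cong_sets[OF sB refl] .
  qed
  have Am: "(\<lambda>y. LINT x|distr M S A. G (x, y)) \<in> borel_measurable S'"
  proof (rule A.borel_measurable_lebesgue_integral)
    have "(\<lambda>p. G (snd p, fst p)) \<in> borel_measurable (S' \<Otimes>\<^sub>M S)" by measurable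
    then show "(\<lambda>(y, x). G (x, y)) \<in> borel_measurable (S' \<Otimes>\<^sub>M distr M S A)"
      unfolding case_prod_beta measurable_cong_sets[OF sA refl] .
  qed
  have inA: "(LINT x|distr M S A. G (x, y)) = (LINT \<omega>|M. G (A \<omega>, y))" if "y \<in> space S'" for y
    by (rule integral_distr) (use that in measurable)
  have inB: "(LINT y|distr M S' B. G (x, y)) = (LINT \<omega>|M. G (x, B \<omega>))" if "x \<in> space S" for x
    by (rule integral_distr) (use that in measurable)
  have "(LINT x|distr M S A. LINT y|distr M S' B. G (x, y)) = (LINT \<omega>|M. LINT y|distr M S' B. G (A \<omega>, y))"
    by (rule integral_distr) (use Bm in auto)
  also have "\<dots> = (LINT \<omega>|M. LINT \<omega>'|M. G (A \<omega>, B \<omega>'))"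
    by (rule Bochner_Integration.integral_cong[OF refl], rule inB) (use measurable_space[of A M S] in auto)
  finally show "(LINT \<omega>|M. G (A \<omega>, B \<omega>)) = (LINT \<omega>|M. LINT \<omega>'|M. G (A \<omega>, B \<omega>'))" using 1 by simp
  have "(LINT y|distr M S' B. LINT x|distr M S A. G (x, y)) = (LINT \<omega>'|M. LINT x|distr M S A. G (x, B \<omega>'))"
    by (rule integral_distr) (use Am in auto)
  also have "\<dots> = (LINT \<omega>'|M. LINT \<omega>|M. G (A \<omega>, B \<omega>'))"
    by (rule Bochner_Integration.integral_cong[OF refl], rule inA) (use measurable_space[of B M S'] in auto)
  finally show "(LINT \<omega>|M. G (A \<omega>, B \<omega>)) = (LINT \<omega>'|M. LINT \<omega>|M. G (A \<omega>, B \<omega>'))" using 1 2 by simp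
qed

locale stable_pair = prob_space M
  for M :: "'a measure" and F :: "real \<Rightarrow> 'a measure" and X Y :: "real \<Rightarrow> 'a \<Rightarrow> real" and \<alpha>\<^sub>1 \<alpha>\<^sub>2 :: real +
  assumes filt: "filtration_on M F"
    and stableX: "symmetric_stable_process M F \<alpha>\<^sub>1 X"
    and stableY: "symmetric_stable_process M F \<alpha>\<^sub>2 Y"
    and indep: "independent_processes M X Y"
begin

definition psi :: "real \<Rightarrow> real" where "psi v = \<bar>v\<bar> powr \<alpha>\<^sub>1 + \<bar>v\<bar> powr \<alpha>\<^sub>2"

definition path_space :: "real \<Rightarrow> (real \<Rightarrow> real) measure" where
  "path_space s = Pi\<^sub>M {0..s} (\<lambda>_. borel)"

text \<open>Each process has a prescribed conditional law given \<open>F s\<close>, but nothing is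
  assumed about the conditional law of the pair. The weight is therefore a functional of the two
  paths up to \<open>s\<close>: with the path of \<open>Y\<close> frozen, the property of
  \<open>X\<close> extracts its factor, and after recoupling the same is done for \<open>Y\<close>
  with \<open>X\<close> frozen.\<close>

lemma increment_integral:
  fixes w :: "(real \<Rightarrow> real) \<times> (real \<Rightarrow> real) \<Rightarrow> complex"
  assumes st: "0 \<le> s" "s < t"
    and w [measurable]: "w \<in> borel_measurable (path_space s \<Otimes>\<^sub>M path_space s)" and wB: "\<And>p. cmod (w p) \<le> K"
  shows "(LINT \<omega>|M. w (\<lambda>r\<in>{0..s}. X r \<omega>, \<lambda>r\<in>{0..s}. Y r \<omega>) * exp (\<i> * of_real (u * ((X t \<omega> - Y t \<omega>) - (X s \<omega> - Y s \<omega>)))))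
    = of_real (exp (- (t - s) * psi u)) * (LINT \<omega>|M. w (\<lambda>r\<in>{0..s}. X r \<omega>, \<lambda>r\<in>{0..s}. Y r \<omega>))"
proof -
  define S where "S = Pi\<^sub>M {0::real..} (\<lambda>_. borel :: real measure)"
  define PX where "PX \<omega> = (\<lambda>t\<in>{0..}. X t \<omega>)" for \<omega>
  define PY where "PY \<omega> = (\<lambda>t\<in>{0..}. Y t \<omega>)" for \<omega>
  have ind: "indep_var S PX S PY" using indep unfolding independent_processes_def S_def PX_def PY_def .
  define a where "a = complex_of_real (exp (- (t - s) * \<bar>u\<bar> powr \<alpha>\<^sub>1))"
  define b where "b = complex_of_real (exp (- (t - s) * \<bar>u\<bar> powr \<alpha>\<^sub>2))"
  define h where "h p = w (restrict (fst p) {0..s}, restrict (snd p) {0..s})" for p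
  define ex where "ex x = exp (\<i> * of_real (u * (x t - x s)))" for x :: "real \<Rightarrow> real"
  \<comment> \<open>\<open>Y\<close> enters the difference with a minus sign, hence the frequency
    \<open>- u\<close>; the factor \<open>b\<close> is unaffected because its exponent depends on
    \<open>\<bar>u\<bar>\<close>.\<close>
  define ey where "ey y = exp (\<i> * of_real ((- u) * (y t - y s)))" for y :: "real \<Rightarrow> real"
  have rm: "(\<lambda>x. restrict x {0..s}) \<in> measurable S (path_space s)"
    unfolding S_def path_space_def by (rule measurable_restrict_subset) auto
  have hm [measurable]: "h \<in> borel_measurable (S \<Otimes>\<^sub>M S)"
    unfolding h_def using rm by measurable
  have cm: "(\<lambda>x. x r) \<in> borel_measurable S" if "0 \<le> r" for r
    unfolding S_def using that by (intro measurable_component_singleton) auto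
  have [measurable]: "ex \<in> borel_measurable S" "ey \<in> borel_measurable S"
    unfolding ex_def ey_def using cm[of s] cm[of t] st by auto
  have n1: "cmod (ex x) = 1" "cmod (ey x) = 1" for x unfolding ex_def ey_def by auto
  have hB: "cmod (h p) \<le> K" for p unfolding h_def by (rule wB)
  have adX: "X r \<in> borel_measurable (F s)" if "0 \<le> r" "r \<le> s" for r
  proof -
    have "X r \<in> borel_measurable (F r)" using stableX that unfolding symmetric_stable_process_def adapted_to_def by auto
    moreover have "subalgebra (F s) (F r)" using filt that unfolding filtration_on_def by auto
    ultimately show ?thesis by (rule measurable_from_subalg[rotated])
  qed
  have adY: "Y r \<in> borel_measurable (F s)" if "0 \<le> r" "r \<le> s" for r
  proof -
    have "Y r \<in> borel_measurable (F r)" using stableY that unfolding symmetric_stable_process_def adapted_to_def by auto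
    moreover have "subalgebra (F s) (F r)" using filt that unfolding filtration_on_def by auto
    ultimately show ?thesis by (rule measurable_from_subalg[rotated])
  qed
  have rX: "restrict (PX \<omega>) {0..s} = (\<lambda>r\<in>{0..s}. X r \<omega>)" and rY: "restrict (PY \<omega>) {0..s} = (\<lambda>r\<in>{0..s}. Y r \<omega>)" for \<omega>
    unfolding PX_def PY_def by (auto simp: restrict_def)
  have rXm: "(\<lambda>\<omega>. restrict (PX \<omega>) {0..s}) \<in> measurable (F s) (path_space s)"
    unfolding rX path_space_def by (rule measurable_restrict) (use adX in auto)
  have rYm: "(\<lambda>\<omega>. restrict (PY \<omega>) {0..s}) \<in> measurable (F s) (path_space s)"
    unfolding rY path_space_def by (rule measurable_restrict) (use adY in auto)
  have PXs: "PX \<omega> \<in> space S" "PY \<omega> \<in> space S" for \<omega> unfolding S_def PX_def PY_def by (auto simp: space_PiM)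
  have inX: "(LINT \<omega>|M. h (PX \<omega>, y) * ex (PX \<omega>)) = a * (LINT \<omega>|M. h (PX \<omega>, y))" if y: "y \<in> space S" for y
  proof -
    have m: "(\<lambda>\<omega>. h (PX \<omega>, y)) \<in> borel_measurable (F s)"
      unfolding h_def fst_conv snd_conv
      by (rule measurable_compose[OF measurable_Pair w, OF rXm measurable_const]) (rule measurable_space[OF rm y])
    have "ex (PX \<omega>) = exp (\<i> * of_real (u * (X t \<omega> - X s \<omega>)))" for \<omega>
      unfolding ex_def PX_def using st by simp
    then show ?thesis
      unfolding a_def using stable_increment_integral[OF prob_space_axioms filt stableX st m hB] by simp
  qed
  have inY: "(LINT \<omega>|M. h (x, PY \<omega>) * ey (PY \<omega>)) = b * (LINT \<omega>|M. h (x, PY \<omega>))" if x: "x \<in> space S" for x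
  proof -
    have m: "(\<lambda>\<omega>. h (x, PY \<omega>)) \<in> borel_measurable (F s)"
      unfolding h_def fst_conv snd_conv
      by (rule measurable_compose[OF measurable_Pair w, OF measurable_const rYm]) (rule measurable_space[OF rm x])
    have "ey (PY \<omega>) = exp (\<i> * of_real ((- u) * (Y t \<omega> - Y s \<omega>)))" for \<omega>
      unfolding ey_def PY_def using st by simp
    then show ?thesis
      unfolding b_def using stable_increment_integral[OF prob_space_axioms filt stableY st m hB, of "- u"] by simp
  qed
  define G1 where "G1 p = h p * ex (fst p) * ey (snd p)" for p
  define G2 where "G2 p = h p * ey (snd p)" for p
  have G1: "G1 \<in> borel_measurable (S \<Otimes>\<^sub>M S)" "\<And>p. cmod (G1 p) \<le> K"
    unfolding G1_def by (measurable, simp add: norm_mult n1 hB)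
  have G2: "G2 \<in> borel_measurable (S \<Otimes>\<^sub>M S)" "\<And>p. cmod (G2 p) \<le> K"
    unfolding G2_def by (measurable, simp add: norm_mult n1 hB)
  have "(LINT \<omega>|M. G1 (PX \<omega>, PY \<omega>)) = (LINT \<omega>'|M. LINT \<omega>|M. G1 (PX \<omega>, PY \<omega>'))"
    by (rule indep_var_double_integral(1)[OF ind G1])
  also have "\<dots> = (LINT \<omega>'|M. (LINT \<omega>|M. h (PX \<omega>, PY \<omega>') * ex (PX \<omega>)) * ey (PY \<omega>'))"
    unfolding G1_def by simp
  \<comment> \<open>\<open>G2\<close> is what remains once the increment of \<open>X\<close> has
    been integrated out; its double integral is put back together and then split in the other
    order.\<close>
  also have "\<dots> = (LINT \<omega>'|M. a * (LINT \<omega>|M. G2 (PX \<omega>, PY \<omega>')))"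
    unfolding G2_def inX[OF PXs(2)] by (simp add: mult.assoc)
  also have "\<dots> = a * (LINT \<omega>|M. G2 (PX \<omega>, PY \<omega>))"
    unfolding integral_mult_right_zero indep_var_double_integral(1)[OF ind G2] ..
  also have "(LINT \<omega>|M. G2 (PX \<omega>, PY \<omega>)) = (LINT \<omega>|M. LINT \<omega>'|M. G2 (PX \<omega>, PY \<omega>'))"
    by (rule indep_var_double_integral(2)[OF ind G2])
  also have "\<dots> = b * (LINT \<omega>|M. LINT \<omega>'|M. h (PX \<omega>, PY \<omega>'))"
    unfolding G2_def fst_conv snd_conv inY[OF PXs(1)] by simp
  also have "(LINT \<omega>|M. LINT \<omega>'|M. h (PX \<omega>, PY \<omega>')) = (LINT \<omega>|M. h (PX \<omega>, PY \<omega>))"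
    by (rule indep_var_double_integral(2)[OF ind hm hB, symmetric])
  finally have main: "(LINT \<omega>|M. G1 (PX \<omega>, PY \<omega>)) = a * (b * (LINT \<omega>|M. h (PX \<omega>, PY \<omega>)))" .
  have "G1 (PX \<omega>, PY \<omega>) = w (\<lambda>r\<in>{0..s}. X r \<omega>, \<lambda>r\<in>{0..s}. Y r \<omega>) * exp (\<i> * of_real (u * ((X t \<omega> - Y t \<omega>) - (X s \<omega> - Y s \<omega>))))" for \<omega>
  proof -
    have "ex (PX \<omega>) * ey (PY \<omega>) = exp (\<i> * of_real (u * ((X t \<omega> - Y t \<omega>) - (X s \<omega> - Y s \<omega>))))"
      unfolding ex_def ey_def PX_def PY_def using st by (simp add: exp_add[symmetric] algebra_simps)
    then show ?thesis unfolding G1_def h_def fst_conv snd_conv rX rY by (simp add: mult.assoc)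
  qed
  moreover have "h (PX \<omega>, PY \<omega>) = w (\<lambda>r\<in>{0..s}. X r \<omega>, \<lambda>r\<in>{0..s}. Y r \<omega>)" for \<omega>
    unfolding h_def fst_conv snd_conv rX rY ..
  moreover have "a * b = of_real (exp (- (t - s) * psi u))"
    unfolding a_def b_def psi_def by (simp flip: of_real_mult exp_add) (simp add: algebra_simps)
  ultimately show ?thesis using main by (simp add: mult.assoc[symmetric])
qed

end

section \<open>Killing along the occupation integral\<close>

lemma exp_minus_quadratic:
  fixes d :: real
  assumes "0 \<le> d"
  shows "\<bar>exp (- d) - 1 + d\<bar> \<le> d\<^sup>2"
proof -
  have 1: "1 - d \<le> exp (- d)" using exp_ge_add_one_self[of "- d"] by simp
  have "exp (- d) \<le> 1 / (1 + d)"
    using exp_ge_add_one_self[of d] assms by (simp add: exp_minus inverse_eq_divide frac_le)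
  moreover have "1 / (1 + d) \<le> 1 - d + d\<^sup>2"
  proof -
    have "(1 - d + d\<^sup>2) * (1 + d) = 1 + d * d * d" by (simp add: power2_eq_square algebra_simps)
    then have "1 \<le> (1 - d + d\<^sup>2) * (1 + d)" using assms by simp
    then show ?thesis using assms by (subst pos_divide_le_eq) auto
  qed
  ultimately show ?thesis using 1 by simp
qed

text \<open>The integrand is only assumed measurable, so the fundamental theorem of calculus is replaced by a
  quadratic increment bound.\<close>

lemma exp_integral_equation:
  fixes v :: "real \<Rightarrow> real"
  assumes v [measurable]: "v \<in> borel_measurable borel" and vb: "\<And>r. 0 \<le> v r" "\<And>r. v r \<le> K"
    and \<mu>: "\<mu> \<ge> 0" and t: "t \<ge> 0"
  defines "A \<equiv> \<lambda>t. LINT r:{0..t}|lborel. v r"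
  shows "exp (- (\<mu> * A t)) = 1 - \<mu> * (LINT s:{0..t}|lborel. v s * exp (- (\<mu> * A s)))"
proof -
  have K: "K \<ge> 0" using vb order_trans by blast
  have vi: "set_integrable lborel S v" if S: "S \<in> sets borel" "emeasure lborel S < \<infinity>" for S
    unfolding set_integrable_def
  proof (rule Bochner_Integration.integrable_bound[of _ "\<lambda>r. K * indicator S r"])
    show "integrable lborel (\<lambda>r. K * indicator S r)" using S by simp
    show "(\<lambda>r. indicator S r *\<^sub>R v r) \<in> borel_measurable lborel" using S(1) by measurable
    show "AE r in lborel. norm (indicator S r *\<^sub>R v r) \<le> norm (K * indicator S r)"
      using vb K by (auto simp: indicator_def)
  qed
  have vI: "set_integrable lborel {a<..b} v" for a b
    by (cases "a \<le> b") (auto intro!: vi)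
  have cI: "set_integrable lborel {a<..b} (\<lambda>_. c)" for a b c :: real
    by (cases "a \<le> b") (auto simp: set_integrable_def)
  have inc: "A b = A a + (LINT r:{a<..b}|lborel. v r)" if "0 \<le> a" "a \<le> b" for a b
  proof -
    have e: "{0..b} = {0..a} \<union> {a<..b}" using that by auto
    show ?thesis unfolding A_def e by (rule set_integral_Un) (use that in \<open>auto intro!: vi vI\<close>)
  qed
  have incb: "0 \<le> (LINT r:{a<..b}|lborel. v r)" "(LINT r:{a<..b}|lborel. v r) \<le> K * (b - a)" if "a \<le> b" for a b
  proof -
    show "0 \<le> (LINT r:{a<..b}|lborel. v r)"
      unfolding set_lebesgue_integral_def by (rule integral_nonneg_AE) (use vb in auto)
    have "(LINT r:{a<..b}|lborel. v r) \<le> (LINT r:{a<..b}|lborel. K)"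
      by (rule set_integral_mono[OF vI cI]) (use vb in auto)
    also have "\<dots> = K * (b - a)" using that by (simp add: set_lebesgue_integral_def)
    finally show "(LINT r:{a<..b}|lborel. v r) \<le> K * (b - a)" .
  qed
  have A0: "0 \<le> A s" for s
    unfolding A_def set_lebesgue_integral_def by (rule integral_nonneg_AE) (use vb in auto)
  have Am [measurable]: "A \<in> borel_measurable borel"
  proof -
    have "A = (\<lambda>t. LINT r|lborel. (if 0 \<le> r \<and> r \<le> t then v r else 0))"
      unfolding A_def set_lebesgue_integral_def
      by (intro ext Bochner_Integration.integral_cong) (auto simp: indicator_def)
    then show ?thesis by simp
  qed
  define w where "w s = v s * exp (- (\<mu> * A s))" for s
  have w_meas [measurable]: "w \<in> borel_measurable borel" unfolding w_def by measurable
  have e1: "exp (- (\<mu> * A s)) \<le> 1" for s using \<mu> A0 by simp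
  have wb: "0 \<le> w s" "w s \<le> K" for s
  proof -
    show "0 \<le> w s" unfolding w_def using vb by simp
    have "v s * exp (- (\<mu> * A s)) \<le> K * 1" using vb e1 K by (intro mult_mono) auto
    then show "w s \<le> K" unfolding w_def by simp
  qed
  have wi: "set_integrable lborel S w" if S: "S \<in> sets borel" "emeasure lborel S < \<infinity>" for S
    unfolding set_integrable_def
  proof (rule Bochner_Integration.integrable_bound[of _ "\<lambda>r. K * indicator S r"])
    show "integrable lborel (\<lambda>r. K * indicator S r)" using S by simp
    show "(\<lambda>r. indicator S r *\<^sub>R w r) \<in> borel_measurable lborel" using S(1) by measurable
    show "AE r in lborel. norm (indicator S r *\<^sub>R w r) \<le> norm (K * indicator S r)"
      using wb K by (auto simp: indicator_def)
  qed
  have wI: "set_integrable lborel {a<..b} w" for a b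
    by (cases "a \<le> b") (auto intro!: wi)
  define F where "F t = exp (- (\<mu> * A t)) + \<mu> * (LINT s:{0..t}|lborel. w s)" for t
  \<comment> \<open>Two errors of size \<open>(\<mu> * K)\<^sup>2 * (b - a)\<^sup>2\<close>: one
    from the second-order remainder of the exponential, one from replacing
    \<open>exp (- (\<mu> * A s))\<close> by its value at \<open>a\<close> inside the
    integral.\<close>
  define C where "C = 2 * (\<mu> * K)\<^sup>2"
  have Fb: "\<bar>F b - F a\<bar> \<le> C * (b - a)\<^sup>2" if ab: "0 \<le> a" "a \<le> b" for a b
  proof -
    define d where "d = (LINT r:{a<..b}|lborel. v r)"
    define E where "E = exp (- (\<mu> * A a))"
    have d: "0 \<le> d" "d \<le> K * (b - a)" unfolding d_def using incb[OF ab(2)] by auto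
    have E: "0 \<le> E" "E \<le> 1" unfolding E_def using e1 by auto
    have Ab: "A b = A a + d" unfolding d_def by (rule inc[OF ab])
    have e: "{0..b} = {0..a} \<union> {a<..b}" using ab by auto
    have Wb: "(LINT s:{0..b}|lborel. w s) = (LINT s:{0..a}|lborel. w s) + (LINT s:{a<..b}|lborel. w s)"
      unfolding e by (rule set_integral_Un) (use ab in \<open>auto intro!: wi wI\<close>)
    have Ed: "E * d = (LINT s:{a<..b}|lborel. E * v s)" unfolding d_def by simp
    have Evi: "set_integrable lborel {a<..b} (\<lambda>s. E * v s)" by (intro set_integrable_mult_right vI)
    have "(LINT s:{a<..b}|lborel. w s) - E * d = (LINT s:{a<..b}|lborel. w s - E * v s)"
      unfolding Ed by (rule set_integral_diff(2)[symmetric]) (use Evi wI in auto)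
    also have "\<bar>\<dots>\<bar> \<le> (LINT s:{a<..b}|lborel. K * (\<mu> * (K * (b - a))))"
      unfolding real_norm_def[symmetric]
    proof (rule order_trans[OF set_integral_norm_bound set_integral_mono])
      show i: "set_integrable lborel {a<..b} (\<lambda>s. w s - E * v s)"
        by (intro set_integral_diff(1)) (use Evi wI in auto)
      show "set_integrable lborel {a<..b} (\<lambda>s. norm (w s - E * v s))" by (rule set_integrable_norm[OF i])
      show "set_integrable lborel {a<..b} (\<lambda>s. K * (\<mu> * (K * (b - a))))" by (rule cI)
      fix s assume s: "s \<in> {a<..b}"
      define ds where "ds = (LINT r:{a<..s}|lborel. v r)"
      have ds: "0 \<le> ds" "ds \<le> K * (s - a)" unfolding ds_def using incb[of a s] s by auto
      have As: "A s = A a + ds" unfolding ds_def by (rule inc) (use s ab in auto)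
      have "w s - E * v s = E * v s * (exp (- (\<mu> * ds)) - 1)"
        unfolding w_def E_def As by (simp add: algebra_simps exp_add[symmetric])
      moreover have "\<bar>E * v s\<bar> * \<bar>exp (- (\<mu> * ds)) - 1\<bar> \<le> K * (\<mu> * (K * (b - a)))"
      proof (rule mult_mono)
        show "\<bar>E * v s\<bar> \<le> K" using E vb[of s] mult_mono[of E 1 "v s" K] by (simp add: abs_mult)
        have "\<bar>exp (- (\<mu> * ds)) - 1\<bar> \<le> \<mu> * ds"
          using exp_ge_add_one_self[of "- (\<mu> * ds)"] \<mu> ds by (simp add: abs_le_iff)
        moreover have "K * (s - a) \<le> K * (b - a)" using s K by (intro mult_left_mono) auto
        then have "\<mu> * ds \<le> \<mu> * (K * (b - a))" using ds(2) \<mu> by (intro mult_left_mono) linarith+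
        ultimately show "\<bar>exp (- (\<mu> * ds)) - 1\<bar> \<le> \<mu> * (K * (b - a))" by linarith
      qed (use K in auto)
      ultimately show "norm (w s - E * v s) \<le> K * (\<mu> * (K * (b - a)))"
        by (simp only: real_norm_def abs_mult)
    qed
    also have "\<dots> = (K * (\<mu> * (K * (b - a)))) * (b - a)" using ab by (simp add: set_lebesgue_integral_def)
    finally have 1: "\<bar>(LINT s:{a<..b}|lborel. w s) - E * d\<bar> \<le> (K * (\<mu> * (K * (b - a)))) * (b - a)" .
    have "\<bar>exp (- (\<mu> * d)) - 1 + \<mu> * d\<bar> \<le> (\<mu> * d)\<^sup>2" using \<mu> d by (intro exp_minus_quadratic) simp
    also have "\<dots> \<le> (\<mu> * (K * (b - a)))\<^sup>2" using \<mu> d by (intro power_mono mult_left_mono mult_nonneg_nonneg) auto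
    finally have 2: "\<bar>E * (exp (- (\<mu> * d)) - 1 + \<mu> * d)\<bar> \<le> (\<mu> * (K * (b - a)))\<^sup>2"
      unfolding abs_mult using E mult_left_le_one_le[of "\<bar>exp (- (\<mu> * d)) - 1 + \<mu> * d\<bar>" E] by simp
    have "F b - F a = E * (exp (- (\<mu> * d)) - 1 + \<mu> * d) + \<mu> * ((LINT s:{a<..b}|lborel. w s) - E * d)"
      unfolding F_def Ab Wb E_def by (simp add: algebra_simps exp_add[symmetric])
    also have "\<bar>\<dots>\<bar> \<le> (\<mu> * (K * (b - a)))\<^sup>2 + \<mu> * ((K * (\<mu> * (K * (b - a)))) * (b - a))"
    proof (rule order_trans[OF abs_triangle_ineq add_mono[OF 2]])
      show "\<bar>\<mu> * ((LINT s:{a<..b}|lborel. w s) - E * d)\<bar> \<le> \<mu> * ((K * (\<mu> * (K * (b - a)))) * (b - a))"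
        unfolding abs_mult using \<mu> 1 by (simp add: mult_left_mono)
    qed
    also have "\<dots> = C * (b - a)\<^sup>2" unfolding C_def by (simp add: power2_eq_square algebra_simps)
    finally show ?thesis .
  qed
  have Fb': "\<bar>F y - F x\<bar> \<le> C * (y - x)\<^sup>2" if "x \<ge> 0" "y \<ge> 0" for x y
    using Fb[of x y] Fb[of y x] that by (cases "x \<le> y") (auto simp: abs_minus_commute power2_commute)
  have "(F has_field_derivative 0) (at x within {0..})" if x: "x \<in> {0..}" for x
    unfolding has_field_derivative_iff
  proof (rule Lim_null_comparison)
    have "((\<lambda>y. C * \<bar>y - x\<bar>) \<longlongrightarrow> C * \<bar>x - x\<bar>) (at x within {0..})" by (intro tendsto_intros)
    then show "((\<lambda>y. C * \<bar>y - x\<bar>) \<longlongrightarrow> 0) (at x within {0..})" by simp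
    show "\<forall>\<^sub>F y in at x within {0..}. norm ((F y - F x) / (y - x)) \<le> C * \<bar>y - x\<bar>"
      unfolding eventually_at
    proof (intro exI[of _ 1] conjI ballI impI)
      fix y assume y: "y \<in> {0..}" "y \<noteq> x \<and> dist y x < 1"
      then have "\<bar>F y - F x\<bar> \<le> C * \<bar>y - x\<bar> * \<bar>y - x\<bar>"
        using Fb'[of x y] x by (simp add: power2_eq_square abs_mult[symmetric] mult.assoc)
      then show "norm ((F y - F x) / (y - x)) \<le> C * \<bar>y - x\<bar>"
        using y by (simp add: pos_divide_le_eq)
    qed simp
  qed
  then obtain c where "\<And>x. x \<in> {0..} \<Longrightarrow> F x = c"
    using has_field_derivative_zero_constant[of "{0::real..}" F] by auto
  then have "F t = F 0" using t by simp
  also have "F 0 = 1"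
  proof -
    have "AE r in lborel. indicator {0..0::real} r *\<^sub>R g r = 0" for g :: "real \<Rightarrow> real"
      using AE_lborel_singleton[of "0::real"] by eventually_elim auto
    then have "(LINT r:{0..0}|lborel. g r) = 0" for g :: "real \<Rightarrow> real"
      unfolding set_lebesgue_integral_def by (rule integral_eq_zero_AE)
    then show ?thesis unfolding F_def A_def by simp
  qed
  finally show ?thesis unfolding F_def w_def by simp
qed

text \<open>The point \<open>grid n (grid_index n t)\<close> lies strictly to the right of \<open>t\<close>, so that right-continuity applies.\<close>

definition grid :: "nat \<Rightarrow> int \<Rightarrow> real" where
  "grid n k = max 0 ((of_int k + 1) / (real n + 1))"

definition grid_index :: "nat \<Rightarrow> real \<Rightarrow> int" where
  "grid_index n t = \<lfloor>(real n + 1) * t\<rfloor>"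

lemma grid_index_measurable [measurable]: "grid_index n \<in> measurable borel (count_space UNIV)"
  unfolding grid_index_def by measurable

lemma grid_gt: "t \<ge> 0 \<Longrightarrow> t < grid n (grid_index n t)"
proof -
  assume "t \<ge> 0"
  have "(real n + 1) * t < of_int \<lfloor>(real n + 1) * t\<rfloor> + 1" by linarith
  then show ?thesis unfolding grid_def grid_index_def by (simp add: less_max_iff_disj pos_less_divide_eq mult.commute)
qed

lemma grid_le: "t \<ge> 0 \<Longrightarrow> grid n (grid_index n t) \<le> t + 1 / (real n + 1)"
proof -
  assume t: "t \<ge> 0"
  have "of_int \<lfloor>(real n + 1) * t\<rfloor> + 1 \<le> (real n + 1) * t + 1" by linarith
  then have "(of_int \<lfloor>(real n + 1) * t\<rfloor> + 1) / (real n + 1) \<le> ((real n + 1) * t + 1) / (real n + 1)"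
    by (intro divide_right_mono) auto
  also have "\<dots> = t + 1 / (real n + 1)" by (simp add: add_divide_distrib)
  finally show ?thesis using t unfolding grid_def grid_index_def by simp
qed

lemma grid_tendsto: "t \<ge> 0 \<Longrightarrow> (\<lambda>n. grid n (grid_index n t)) \<longlonglongrightarrow> t"
proof (rule tendsto_sandwich[of "\<lambda>_. t" _ _ "\<lambda>n. t + 1 / (real n + 1)"])
  show "(\<lambda>n. t + 1 / (real n + 1)) \<longlonglongrightarrow> t" by real_asymp
qed (auto intro!: always_eventually grid_le less_imp_le[OF grid_gt])

lemma grid_filterlim: "t \<ge> 0 \<Longrightarrow> filterlim (\<lambda>n. grid n (grid_index n t)) (at_right t) sequentially"
  by (rule tendsto_imp_filterlim_at_right[OF grid_tendsto]) (auto simp: grid_gt)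

text \<open>Sampling at the next grid point gives a jointly measurable function because only
  countably many times occur, and right-continuity makes the samples converge to \<open>Z\<close>.
  Clamping time at 0 lets the statement range over the whole real line.\<close>

lemma right_continuous_jointly_measurable:
  fixes Z :: "real \<Rightarrow> 'a \<Rightarrow> real"
  assumes m: "\<And>t. t \<ge> 0 \<Longrightarrow> Z t \<in> borel_measurable M"
    and rc: "\<And>\<omega> t. \<omega> \<in> space M \<Longrightarrow> t \<ge> 0 \<Longrightarrow> ((\<lambda>r. Z r \<omega>) \<longlongrightarrow> Z t \<omega>) (at_right t)"
  shows "(\<lambda>(t, \<omega>). Z (max 0 t) \<omega>) \<in> borel_measurable (borel \<Otimes>\<^sub>M M)"
proof (rule borel_measurable_LIMSEQ_real)
  fix n
  have "(\<lambda>p. Z (grid n (grid_index n (max 0 (fst p)))) (snd p)) \<in> borel_measurable (borel \<Otimes>\<^sub>M M)"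
  proof (rule measurable_compose_countable[where f="\<lambda>k p. Z (grid n k) (snd p)" and g="\<lambda>p. grid_index n (max 0 (fst p))"])
    fix k
    have "Z (grid n k) \<in> borel_measurable M" by (rule m) (simp add: grid_def)
    then show "(\<lambda>p. Z (grid n k) (snd p)) \<in> borel_measurable (borel \<Otimes>\<^sub>M M)" by measurable
  qed measurable
  then show "(\<lambda>p. Z (grid n (grid_index n (max 0 (fst p)))) (snd p)) \<in> borel_measurable (borel \<Otimes>\<^sub>M M)" .
next
  fix p :: "real \<times> 'a" assume "p \<in> space (borel \<Otimes>\<^sub>M M)"
  then have "snd p \<in> space M" by (auto simp: space_pair_measure)
  then show "(\<lambda>n. Z (grid n (grid_index n (max 0 (fst p)))) (snd p)) \<longlonglongrightarrow> (case p of (t, \<omega>) \<Rightarrow> Z (max 0 t) \<omega>)"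
    unfolding case_prod_beta by (intro filterlim_compose[OF rc grid_filterlim]) auto
qed

text \<open>A product of integrable bounds, one in each variable, is the form in which most
  exchanges of integrals below are justified.\<close>

lemma (in pair_sigma_finite) integrable_product_bound:
  fixes f :: "'a \<times> 'b \<Rightarrow> 'c :: {banach, second_countable_topology}"
  assumes f [measurable]: "f \<in> borel_measurable (M1 \<Otimes>\<^sub>M M2)"
    and b1: "integrable M1 b1" and b2: "integrable M2 b2"
    and le: "\<And>x y. x \<in> space M1 \<Longrightarrow> y \<in> space M2 \<Longrightarrow> norm (f (x, y)) \<le> b1 x * (b2 y :: real)"
  shows "integrable (M1 \<Otimes>\<^sub>M M2) f"
proof (rule Fubini_integrable[OF f])
  have i: "integrable M2 (\<lambda>y. f (x, y))" if x: "x \<in> space M1" for x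
    by (rule Bochner_Integration.integrable_bound[OF integrable_mult_right[OF b2, of "b1 x"]])
       (use x le[OF x] in \<open>auto intro: order_trans[OF _ abs_ge_self]\<close>)
  show "AE x in M1. integrable M2 (\<lambda>y. f (x, y))" using i by (intro AE_I2)
  show "integrable M1 (\<lambda>x. LINT y|M2. norm (f (x, y)))"
  proof (rule Bochner_Integration.integrable_bound[OF integrable_mult_left[OF b1, of "LINT y|M2. b2 y"]])
    show "AE x in M1. norm (LINT y|M2. norm (f (x, y))) \<le> norm (b1 x * (LINT y|M2. b2 y))"
    proof (rule AE_I2)
      fix x assume x: "x \<in> space M1"
      have "(LINT y|M2. norm (f (x, y))) \<le> (LINT y|M2. b1 x * b2 y)"
        by (rule integral_mono) (use i[OF x] b2 le[OF x] in auto)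
      moreover have "0 \<le> (LINT y|M2. norm (f (x, y)))" by (rule integral_nonneg_AE) simp
      ultimately show "norm (LINT y|M2. norm (f (x, y))) \<le> norm (b1 x * (LINT y|M2. b2 y))" by simp
    qed
  qed measurable
qed

section \<open>Bounds and Fourier representation of the Gaussian kernel\<close>

lemma normal_density_bounds:
  assumes "\<sigma> > 0"
  shows "0 \<le> normal_density 0 \<sigma> x" "normal_density 0 \<sigma> x \<le> 1 / \<sigma>"
proof -
  show "0 \<le> normal_density 0 \<sigma> x" by simp
  have "1 \<le> sqrt (2 * pi)" using pi_ge_two by simp
  then have s: "\<sigma> \<le> sqrt (2 * pi * \<sigma>\<^sup>2)" using assms by (simp add: real_sqrt_mult)
  have "normal_density 0 \<sigma> x \<le> 1 / sqrt (2 * pi * \<sigma>\<^sup>2) * 1"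
    unfolding normal_density_def by (intro mult_left_mono) auto
  also have "\<dots> \<le> 1 / \<sigma>" using s assms by (simp add: frac_le)
  finally show "normal_density 0 \<sigma> x \<le> 1 / \<sigma>" .
qed

text \<open>The characteristic function of the standard normal law, rescaled by \<sigma>. It writes
  the kernel as a superposition of characters, so that expectations weighted by the kernel reduce to
  characteristic functions of \<open>Z\<close>.\<close>

lemma normal_density_fourier:
  assumes \<sigma>: "\<sigma> > 0"
  shows "integrable lborel (\<lambda>v. exp (- (\<sigma>\<^sup>2 * v\<^sup>2 / 2)))"
    and "(LINT v|lborel. exp (\<i> * of_real (v * x)) * of_real (exp (- (\<sigma>\<^sup>2 * v\<^sup>2 / 2)))) = of_real (2 * pi * normal_density 0 \<sigma> x)"
proof -
  have g: "exp (- (\<sigma>\<^sup>2 * v\<^sup>2 / 2)) = sqrt (2 * pi) / \<sigma> * normal_density 0 (1 / \<sigma>) v" for v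
  proof -
    have "sqrt (2 * pi * (1 / \<sigma>)\<^sup>2) = sqrt (2 * pi) / \<sigma>" using \<sigma> by (simp add: real_sqrt_mult real_sqrt_divide power_divide)
    moreover have "(v - 0)\<^sup>2 / (2 * (1 / \<sigma>)\<^sup>2) = \<sigma>\<^sup>2 * v\<^sup>2 / 2" using \<sigma> by (simp add: power_divide)
    ultimately show ?thesis unfolding normal_density_def using \<sigma> by simp
  qed
  have i0: "integrable lborel (normal_density 0 (1 / \<sigma>))" using \<sigma> by (intro integrable_normal_density) simp
  show "integrable lborel (\<lambda>v. exp (- (\<sigma>\<^sup>2 * v\<^sup>2 / 2)))" unfolding g by (intro integrable_mult_right i0)
  have "(LINT y|lborel. std_normal_density y *\<^sub>R iexp (x / \<sigma> * y)) = complex_of_real (exp (- ((x / \<sigma>)\<^sup>2 / 2)))"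
    using fun_cong[OF char_std_normal_distribution, of "x / \<sigma>"]
    unfolding char_def by (subst (asm) integral_density) auto
  also have "(LINT y|lborel. std_normal_density y *\<^sub>R iexp (x / \<sigma> * y))
      = \<sigma> *\<^sub>R (LINT v|lborel. std_normal_density (0 + \<sigma> * v) *\<^sub>R iexp (x / \<sigma> * (0 + \<sigma> * v)))"
    using \<sigma> by (subst lborel_integral_real_affine[where c=\<sigma> and t=0]) auto
  also have "\<dots> = \<sigma> *\<^sub>R (LINT v|lborel. (1 / sqrt (2 * pi)) *\<^sub>R (exp (\<i> * of_real (v * x)) * of_real (exp (- (\<sigma>\<^sup>2 * v\<^sup>2 / 2)))))"
  proof -
    have "std_normal_density (0 + \<sigma> * v) *\<^sub>R iexp (x / \<sigma> * (0 + \<sigma> * v))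
      = (1 / sqrt (2 * pi)) *\<^sub>R (exp (\<i> * of_real (v * x)) * of_real (exp (- (\<sigma>\<^sup>2 * v\<^sup>2 / 2))))" for v
    proof -
      have "x / \<sigma> * (0 + \<sigma> * v) = v * x" using \<sigma> by simp
      then show ?thesis unfolding std_normal_density_def by (simp only: scaleR_conv_of_real power_mult_distrib of_real_mult mult_ac add_0) simp
    qed
    then show ?thesis by (simp only:)
  qed
  finally have "(\<sigma> / sqrt (2 * pi)) *\<^sub>R (LINT v|lborel. exp (\<i> * of_real (v * x)) * of_real (exp (- (\<sigma>\<^sup>2 * v\<^sup>2 / 2))))
     = complex_of_real (exp (- ((x / \<sigma>)\<^sup>2 / 2)))" by simp
  then have "(LINT v|lborel. exp (\<i> * of_real (v * x)) * of_real (exp (- (\<sigma>\<^sup>2 * v\<^sup>2 / 2))))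
     = of_real (sqrt (2 * pi) / \<sigma> * exp (- ((x / \<sigma>)\<^sup>2 / 2)))"
    using \<sigma> by (simp add: scaleR_conv_of_real field_simps)
  also have "sqrt (2 * pi) / \<sigma> * exp (- ((x / \<sigma>)\<^sup>2 / 2)) = 2 * pi * normal_density 0 \<sigma> x"
  proof -
    have "2 * pi / sqrt (2 * pi * \<sigma>\<^sup>2) = sqrt (2 * pi) / \<sigma>"
      using \<sigma> by (simp add: real_sqrt_mult real_div_sqrt field_simps)
    moreover have "2 * pi * normal_density 0 \<sigma> x = 2 * pi / sqrt (2 * pi * \<sigma>\<^sup>2) * exp (- ((x / \<sigma>)\<^sup>2 / 2))"
      unfolding normal_density_def by (simp add: power_divide mult.commute)
    ultimately show ?thesis by (simp only:)
  qed
  finally show "(LINT v|lborel. exp (\<i> * of_real (v * x)) * of_real (exp (- (\<sigma>\<^sup>2 * v\<^sup>2 / 2)))) = of_real (2 * pi * normal_density 0 \<sigma> x)" .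
qed

section \<open>The difference process, its occupation integral and the killed law\<close>

context stable_pair
begin

text \<open>Time is clamped at 0 so that \<open>Z\<close> is jointly measurable on the whole real
  line; \<open>occ\<close> reads it at nonnegative times only.\<close>

definition Z :: "real \<Rightarrow> 'a \<Rightarrow> real" where
  "Z t \<omega> = X (max 0 t) \<omega> - Y (max 0 t) \<omega>"

definition occ :: "real \<Rightarrow> real \<Rightarrow> 'a \<Rightarrow> real" where
  "occ \<sigma> t \<omega> = (LINT r:{0..t}|lborel. normal_density 0 \<sigma> (Z r \<omega>))"

lemma XY_measurable:
  assumes "0 \<le> t"
  shows "X t \<in> borel_measurable M" "Y t \<in> borel_measurable M"
proof -
  have s: "subalgebra M (F t)" using filt assms unfolding filtration_on_def by auto
  have "X t \<in> borel_measurable (F t)" "Y t \<in> borel_measurable (F t)"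
    using stableX stableY assms unfolding symmetric_stable_process_def adapted_to_def by auto
  then show "X t \<in> borel_measurable M" "Y t \<in> borel_measurable M"
    using measurable_from_subalg[OF s] by auto
qed

lemma Z_right_continuous:
  assumes "\<omega> \<in> space M" "t \<ge> 0"
  shows "((\<lambda>r. Z r \<omega>) \<longlongrightarrow> Z t \<omega>) (at_right t)"
proof -
  have "((\<lambda>r. X r \<omega> - Y r \<omega>) \<longlongrightarrow> X t \<omega> - Y t \<omega>) (at_right t)"
    using stableX stableY assms unfolding symmetric_stable_process_def cadlag_def by (intro tendsto_diff) auto
  then have "((\<lambda>r. Z r \<omega>) \<longlongrightarrow> X t \<omega> - Y t \<omega>) (at_right t)"
    by (rule Lim_transform_eventually)
       (use assms(2) in \<open>auto simp: Z_def eventually_at_right_field intro!: exI[of _ "t + 1"]\<close>)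
  then show ?thesis using assms(2) by (simp add: Z_def)
qed

lemma Z_jointly_measurable: "(\<lambda>p. Z (fst p) (snd p)) \<in> borel_measurable (borel \<Otimes>\<^sub>M M)"
proof -
  have "(\<lambda>(t, \<omega>). (\<lambda>t \<omega>. X t \<omega> - Y t \<omega>) (max 0 t) \<omega>) \<in> borel_measurable (borel \<Otimes>\<^sub>M M)"
  proof (rule right_continuous_jointly_measurable)
    show "(\<lambda>\<omega>. X t \<omega> - Y t \<omega>) \<in> borel_measurable M" if "t \<ge> 0" for t
      using XY_measurable[OF that] by measurable
    show "((\<lambda>r. X r \<omega> - Y r \<omega>) \<longlongrightarrow> X t \<omega> - Y t \<omega>) (at_right t)" if "\<omega> \<in> space M" "t \<ge> 0" for \<omega> t
      using stableX stableY that unfolding symmetric_stable_process_def cadlag_def by (intro tendsto_diff) auto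
  qed
  then show ?thesis unfolding Z_def case_prod_beta .
qed

lemma Z_measurable [measurable (raw)]:
  assumes "f \<in> borel_measurable N" "g \<in> measurable N M"
  shows "(\<lambda>x. Z (f x) (g x)) \<in> borel_measurable N"
  using measurable_compose[OF measurable_Pair[OF assms] Z_jointly_measurable] by simp

lemma occ_measurable [measurable (raw)]:
  assumes [measurable]: "f \<in> borel_measurable N" "g \<in> measurable N M"
  shows "(\<lambda>x. occ \<sigma> (f x) (g x)) \<in> borel_measurable N"
proof -
  have "occ \<sigma> (f x) (g x) = (LINT r|lborel. (if 0 \<le> r \<and> r \<le> f x then normal_density 0 \<sigma> (Z r (g x)) else 0))" for x
    unfolding occ_def set_lebesgue_integral_def by (intro Bochner_Integration.integral_cong) (auto simp: indicator_def)
  then show ?thesis by simp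
qed

lemma occ_nonneg: "0 \<le> occ \<sigma> t \<omega>"
  unfolding occ_def set_lebesgue_integral_def by (rule integral_nonneg_AE) auto

lemma density_Z_integrable:
  assumes "\<sigma> > 0" "\<omega> \<in> space M"
  shows "set_integrable lborel {0..t} (\<lambda>r. normal_density 0 \<sigma> (Z r \<omega>))"
  unfolding set_integrable_def
proof (rule Bochner_Integration.integrable_bound[of _ "\<lambda>r. 1 / \<sigma> * indicator {0..t} r"])
  show "integrable lborel (\<lambda>r. 1 / \<sigma> * indicator {0..t} r)"
    by (rule integrable_mult_right) (simp add: emeasure_lborel_Icc_eq)
  show "(\<lambda>r. indicator {0..t} r *\<^sub>R normal_density 0 \<sigma> (Z r \<omega>)) \<in> borel_measurable lborel"
    using assms(2) by measurable
  show "AE r in lborel. norm (indicator {0..t} r *\<^sub>R normal_density 0 \<sigma> (Z r \<omega>)) \<le> norm (1 / \<sigma> * indicator {0..t} r)"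
    using normal_density_bounds[OF assms(1)] assms(1) by (auto simp: indicator_def)
qed

lemma occ_mono:
  assumes "\<sigma> > 0" "\<omega> \<in> space M" "s \<le> t"
  shows "occ \<sigma> s \<omega> \<le> occ \<sigma> t \<omega>"
  unfolding occ_def set_lebesgue_integral_def
proof (rule integral_mono)
  show "indicator {0..s} r *\<^sub>R normal_density 0 \<sigma> (Z r \<omega>) \<le> indicator {0..t} r *\<^sub>R normal_density 0 \<sigma> (Z r \<omega>)" for r
    using assms(3) by (auto simp: indicator_def)
qed (use density_Z_integrable[OF assms(1,2)] in \<open>auto simp: set_integrable_def\<close>)

definition kill :: "real \<Rightarrow> real \<Rightarrow> real \<Rightarrow> 'a \<Rightarrow> real" where
  "kill \<sigma> \<mu> t \<omega> = exp (- (\<mu> * occ \<sigma> t \<omega>))"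

lemma kill_measurable [measurable (raw)]:
  assumes [measurable]: "f \<in> borel_measurable N" "g \<in> measurable N M"
  shows "(\<lambda>x. kill \<sigma> \<mu> (f x) (g x)) \<in> borel_measurable N"
  unfolding kill_def by measurable

lemma kill_bounds:
  assumes "\<mu> \<ge> 0"
  shows "0 \<le> kill \<sigma> \<mu> t \<omega>" "kill \<sigma> \<mu> t \<omega> \<le> 1"
  using assms occ_nonneg[of \<sigma> t \<omega>] unfolding kill_def by auto

lemma abs_kill [simp]: "\<bar>kill \<sigma> \<mu> t \<omega>\<bar> = kill \<sigma> \<mu> t \<omega>"
  unfolding kill_def by simp

text \<open>Characteristic functions of the law of \<open>Z t\<close> after killing at rate \<open>\<mu>\<close> times the Gaussian kernel, and of the
  same law weighted by the kernel.  Their Laplace transforms in time are \<open>Rq\<close> and \<open>Sq\<close> below; \<open>gk\<close>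
  and \<open>Sr\<close> are the real values at frequency 0.\<close>

definition rho :: "real \<Rightarrow> real \<Rightarrow> real \<Rightarrow> real \<Rightarrow> complex" where
  "rho \<sigma> \<mu> u t = (LINT \<omega>|M. exp (\<i> * of_real (u * Z t \<omega>)) * of_real (kill \<sigma> \<mu> t \<omega>))"

definition sig :: "real \<Rightarrow> real \<Rightarrow> real \<Rightarrow> real \<Rightarrow> complex" where
  "sig \<sigma> \<mu> u t = (LINT \<omega>|M. exp (\<i> * of_real (u * Z t \<omega>)) * of_real (normal_density 0 \<sigma> (Z t \<omega>) * kill \<sigma> \<mu> t \<omega>))"

lemma rho_measurable [measurable (raw)]:
  assumes [measurable]: "f \<in> borel_measurable N" "g \<in> borel_measurable N"
  shows "(\<lambda>x. rho \<sigma> \<mu> (f x) (g x)) \<in> borel_measurable N"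
  unfolding rho_def by measurable

lemma sig_measurable [measurable (raw)]:
  assumes [measurable]: "f \<in> borel_measurable N" "g \<in> borel_measurable N"
  shows "(\<lambda>x. sig \<sigma> \<mu> (f x) (g x)) \<in> borel_measurable N"
  unfolding sig_def by measurable

lemma norm_exp_i [simp]: "cmod (exp (\<i> * of_real a)) = 1"
  by (simp add: norm_exp_i_times)

lemma density_kill_bounds:
  assumes "\<sigma> > 0" "\<mu> \<ge> 0"
  shows "0 \<le> normal_density 0 \<sigma> z * kill \<sigma> \<mu> t \<omega>" "normal_density 0 \<sigma> z * kill \<sigma> \<mu> t \<omega> \<le> 1 / \<sigma>"
proof -
  note n = normal_density_bounds[OF assms(1), of z] and k = kill_bounds[OF assms(2), of \<sigma> t \<omega>]
  show "0 \<le> normal_density 0 \<sigma> z * kill \<sigma> \<mu> t \<omega>" using n k by (intro mult_nonneg_nonneg) auto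
  show "normal_density 0 \<sigma> z * kill \<sigma> \<mu> t \<omega> \<le> 1 / \<sigma>"
    using mult_mono[of "normal_density 0 \<sigma> z" "1 / \<sigma>" "kill \<sigma> \<mu> t \<omega>" 1] n k assms(1) by auto
qed

lemma norm_rho_le: "\<mu> \<ge> 0 \<Longrightarrow> cmod (rho \<sigma> \<mu> u t) \<le> 1"
  unfolding rho_def
  by (rule order_trans[OF integral_norm_bound], rule integral_le_const[OF integrable_const_bound[of _ 1]])
     (use kill_bounds in \<open>auto simp: norm_mult\<close>)

lemma norm_sig_le: "\<sigma> > 0 \<Longrightarrow> \<mu> \<ge> 0 \<Longrightarrow> cmod (sig \<sigma> \<mu> u t) \<le> 1 / \<sigma>"
  unfolding sig_def
  by (rule order_trans[OF integral_norm_bound], rule integral_le_const[OF integrable_const_bound[of _ "1 / \<sigma>"]])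
     (use density_kill_bounds in \<open>auto simp: norm_mult abs_mult[symmetric] simp del: abs_mult\<close>)

lemma char_Z:
  assumes t: "t \<ge> 0"
  shows "(LINT \<omega>|M. exp (\<i> * of_real (u * Z t \<omega>))) = of_real (exp (- (t * psi u)))"
proof (cases "t = 0")
  case True
  have "(LINT \<omega>|M. exp (\<i> * of_real (u * Z t \<omega>))) = (LINT \<omega>|M. 1)"
    by (rule Bochner_Integration.integral_cong)
       (use stableX stableY True in \<open>auto simp: symmetric_stable_process_def Z_def\<close>)
  then show ?thesis using True by (simp add: prob_space)
next
  case False
  have "(LINT \<omega>|M. exp (\<i> * of_real (u * Z t \<omega>))) =
      (LINT \<omega>|M. 1 * exp (\<i> * of_real (u * ((X t \<omega> - Y t \<omega>) - (X 0 \<omega> - Y 0 \<omega>)))))"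
    by (rule Bochner_Integration.integral_cong)
       (use stableX stableY t in \<open>auto simp: symmetric_stable_process_def Z_def max_def\<close>)
  also have "\<dots> = of_real (exp (- (t - 0) * psi u)) * (LINT \<omega>|M. 1)"
    using increment_integral[of 0 t "\<lambda>_. 1" 1 u] False t by simp
  finally show ?thesis by (simp add: prob_space)
qed

text \<open>The occupation integral is a limit of functionals of the path up to time \<open>s\<close> that are measurable
  for the cylinder sigma-algebra; evaluation at a varying time is not.\<close>

lemma markov_sig:
  assumes \<sigma>: "\<sigma> > 0" and \<mu>: "\<mu> \<ge> 0" and st: "0 \<le> s" "s \<le> t"
  shows "(LINT \<omega>|M. exp (\<i> * of_real (u * Z t \<omega>)) * of_real (normal_density 0 \<sigma> (Z s \<omega>) * kill \<sigma> \<mu> s \<omega>))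
     = of_real (exp (- ((t - s) * psi u))) * sig \<sigma> \<mu> u s"
proof (cases "s = t")
  case True
  then show ?thesis by (simp add: sig_def)
next
  case False
  then have st': "s < t" using st by simp
  define V where "V = normal_density 0 \<sigma>"
  have Vm [measurable]: "V \<in> borel_measurable borel" unfolding V_def by measurable
  have Vb: "0 \<le> V x" "V x \<le> 1 / \<sigma>" for x unfolding V_def using normal_density_bounds[OF \<sigma>] by auto
  have Vc: "isCont V x" for x unfolding V_def normal_density_def using \<sigma> by (intro continuous_intros) auto
  \<comment> \<open>Capping at \<open>s\<close> keeps the sample times in \<open>{0..s}\<close>, so
    that the approximation depends only on the paths up to \<open>s\<close>.\<close>
  define \<tau> where "\<tau> n k = min s (grid n k)" for n k
  have \<tau>: "\<tau> n k \<in> {0..s}" for n k unfolding \<tau>_def grid_def using st by auto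
  define An where "An n p = (LINT r:{0..s}|lborel. V (fst p (\<tau> n (grid_index n r)) - snd p (\<tau> n (grid_index n r))))"
    for n and p :: "(real \<Rightarrow> real) \<times> (real \<Rightarrow> real)"
  define wn where "wn n p = exp (\<i> * of_real (u * (fst p s - snd p s))) * of_real (V (fst p s - snd p s) * exp (- (\<mu> * An n p)))"
    for n and p :: "(real \<Rightarrow> real) \<times> (real \<Rightarrow> real)"
  have comp: "(\<lambda>x. x r) \<in> borel_measurable (path_space s)" if "r \<in> {0..s}" for r
    unfolding path_space_def using that by (rule measurable_component_singleton)
  have compk: "(\<lambda>x. x (\<tau> n k)) \<in> borel_measurable (path_space s)" for n k by (rule comp[OF \<tau>])
  have comps: "(\<lambda>x. x s) \<in> borel_measurable (path_space s)" by (rule comp) (use st in auto)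
  have An_m: "An n \<in> borel_measurable (path_space s \<Otimes>\<^sub>M path_space s)" for n
  proof -
    note compk [measurable]
    have "(\<lambda>x. V (fst (fst x) (\<tau> n (grid_index n (snd x))) - snd (fst x) (\<tau> n (grid_index n (snd x)))))
       \<in> borel_measurable ((path_space s \<Otimes>\<^sub>M path_space s) \<Otimes>\<^sub>M lborel)"
      by (rule measurable_compose_countable[where f="\<lambda>k x. V (fst (fst x) (\<tau> n k) - snd (fst x) (\<tau> n k))"
             and g="\<lambda>x. grid_index n (snd x)"]) measurable
    then have "(\<lambda>x. indicator {0..s} (snd x) *\<^sub>R V (fst (fst x) (\<tau> n (grid_index n (snd x))) - snd (fst x) (\<tau> n (grid_index n (snd x)))))
       \<in> borel_measurable ((path_space s \<Otimes>\<^sub>M path_space s) \<Otimes>\<^sub>M lborel)"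
      by measurable
    then show ?thesis unfolding An_def set_lebesgue_integral_def
      by (intro lborel.borel_measurable_lebesgue_integral) (simp add: case_prod_beta)
  qed
  have wn_m: "wn n \<in> borel_measurable (path_space s \<Otimes>\<^sub>M path_space s)" for n
  proof -
    note comps [measurable] An_m [measurable]
    show ?thesis unfolding wn_def by measurable
  qed
  have An0: "0 \<le> An n p" for n p
    unfolding An_def set_lebesgue_integral_def by (rule integral_nonneg_AE) (use Vb in auto)
  have wn_b: "cmod (wn n p) \<le> 1 / \<sigma>" for n p
  proof -
    have "V (fst p s - snd p s) * exp (- (\<mu> * An n p)) \<le> 1 / \<sigma> * 1"
      using Vb \<mu> An0[of n p] \<sigma> by (intro mult_mono) auto
    then show ?thesis unfolding wn_def using Vb by (simp add: norm_mult abs_mult)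
  qed
  define P where "P \<omega> = (\<lambda>r\<in>{0..s}. X r \<omega>, \<lambda>r\<in>{0..s}. Y r \<omega>)" for \<omega>
  have Pev: "fst (P \<omega>) r - snd (P \<omega>) r = Z r \<omega>" if "r \<in> {0..s}" for r \<omega>
    unfolding P_def Z_def using that by simp
  have Pm: "P \<in> measurable M (path_space s \<Otimes>\<^sub>M path_space s)"
    unfolding P_def path_space_def
    by (intro measurable_Pair measurable_restrict) (use XY_measurable in auto)
  have An_P: "An n (P \<omega>) = (LINT r:{0..s}|lborel. V (Z (\<tau> n (grid_index n r)) \<omega>))" for n \<omega>
    unfolding An_def Pev[OF \<tau>] ..
  have Alim: "(\<lambda>n. An n (P \<omega>)) \<longlonglongrightarrow> occ \<sigma> s \<omega>" if \<omega>: "\<omega> \<in> space M" for \<omega>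
    unfolding An_P occ_def V_def[symmetric] set_lebesgue_integral_def
  proof (rule integral_dominated_convergence[where w="\<lambda>r. 1 / \<sigma> * indicator {0..s} r"])
    show "(\<lambda>r. indicator {0..s} r *\<^sub>R V (Z r \<omega>)) \<in> borel_measurable lborel" using \<omega> by measurable
    show "(\<lambda>r. indicator {0..s} r *\<^sub>R V (Z (\<tau> n (grid_index n r)) \<omega>)) \<in> borel_measurable lborel" for n
      unfolding \<tau>_def grid_def using \<omega> by measurable
    show "integrable lborel (\<lambda>r. 1 / \<sigma> * indicator {0..s} r)"
      by (rule integrable_mult_right) (simp add: emeasure_lborel_Icc_eq)
    show "AE r in lborel. norm (indicator {0..s} r *\<^sub>R V (Z (\<tau> n (grid_index n r)) \<omega>)) \<le> 1 / \<sigma> * indicator {0..s} r" for n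
      using Vb by (auto simp: indicator_def)
    show "AE r in lborel. (\<lambda>n. indicator {0..s} r *\<^sub>R V (Z (\<tau> n (grid_index n r)) \<omega>)) \<longlonglongrightarrow> indicator {0..s} r *\<^sub>R V (Z r \<omega>)"
    proof (intro always_eventually allI)
      fix r
      show "(\<lambda>n. indicator {0..s} r *\<^sub>R V (Z (\<tau> n (grid_index n r)) \<omega>)) \<longlonglongrightarrow> indicator {0..s} r *\<^sub>R V (Z r \<omega>)"
      proof (cases "r \<in> {0..s}")
        case r: True
        have "(\<lambda>n. Z (\<tau> n (grid_index n r)) \<omega>) \<longlonglongrightarrow> Z r \<omega>"
        proof (cases "r = s")
          case True
          \<comment> \<open>At the right end the grid point overshoots \<open>s\<close> and the cap
            returns \<open>s\<close> itself: the sequence is constant and right-continuity is not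
            called upon.\<close>
          have "\<tau> n (grid_index n s) = s" for n unfolding \<tau>_def using grid_gt[OF st(1), of n] by simp
          then show ?thesis using True by simp
        next
          case False
          have r0: "0 \<le> r" "r < s" using r False by auto
          have "(\<lambda>n. \<tau> n (grid_index n r)) \<longlonglongrightarrow> min s r" unfolding \<tau>_def by (intro tendsto_intros grid_tendsto r0)
          then have "(\<lambda>n. \<tau> n (grid_index n r)) \<longlonglongrightarrow> r" using r0 by simp
          then have "filterlim (\<lambda>n. \<tau> n (grid_index n r)) (at_right r) sequentially"
            by (rule tendsto_imp_filterlim_at_right) (use r0 grid_gt[OF r0(1)] in \<open>auto simp: \<tau>_def\<close>)
          then show ?thesis by (rule filterlim_compose[OF Z_right_continuous[OF \<omega> r0(1)]])
        qed
        then have "(\<lambda>n. V (Z (\<tau> n (grid_index n r)) \<omega>)) \<longlonglongrightarrow> V (Z r \<omega>)" by (rule isCont_tendsto_compose[OF Vc])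
        then show ?thesis by (intro tendsto_intros)
      qed simp
    qed
  qed
  define w where "w \<omega> = exp (\<i> * of_real (u * Z s \<omega>)) * of_real (V (Z s \<omega>) * kill \<sigma> \<mu> s \<omega>)" for \<omega>
  define e where "e \<omega> = exp (\<i> * of_real (u * ((X t \<omega> - Y t \<omega>) - (X s \<omega> - Y s \<omega>))))" for \<omega>
  have wlim: "(\<lambda>n. wn n (P \<omega>)) \<longlonglongrightarrow> w \<omega>" if "\<omega> \<in> space M" for \<omega>
    unfolding wn_def w_def kill_def using Pev[of s \<omega>] st Alim[OF that]
    by (auto intro!: tendsto_intros)
  have em [measurable]: "e \<in> borel_measurable M"
  proof -
    have [measurable]: "X t \<in> borel_measurable M" "Y t \<in> borel_measurable M" "X s \<in> borel_measurable M" "Y s \<in> borel_measurable M"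
      using XY_measurable st by auto
    show ?thesis unfolding e_def by measurable
  qed
  have wm [measurable]: "w \<in> borel_measurable M" unfolding w_def by measurable
  have wnPm [measurable]: "(\<lambda>\<omega>. wn n (P \<omega>)) \<in> borel_measurable M" for n by (rule measurable_compose[OF Pm wn_m])
  have n1: "cmod (e \<omega>) = 1" for \<omega> unfolding e_def by simp
  have "(\<lambda>n. LINT \<omega>|M. wn n (P \<omega>) * e \<omega>) \<longlonglongrightarrow> (LINT \<omega>|M. w \<omega> * e \<omega>)"
    by (rule integral_dominated_convergence[where w="\<lambda>_. 1 / \<sigma>"])
       (auto simp: norm_mult n1 wn_b intro!: tendsto_intros wlim)
  moreover have "(\<lambda>n. LINT \<omega>|M. wn n (P \<omega>)) \<longlonglongrightarrow> (LINT \<omega>|M. w \<omega>)"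
    by (rule integral_dominated_convergence[where w="\<lambda>_. 1 / \<sigma>"]) (auto simp: wn_b intro!: wlim)
  then have "(\<lambda>n. of_real (exp (- (t - s) * psi u)) * (LINT \<omega>|M. wn n (P \<omega>))) \<longlonglongrightarrow> of_real (exp (- (t - s) * psi u)) * (LINT \<omega>|M. w \<omega>)"
    by (intro tendsto_intros)
  moreover have "(LINT \<omega>|M. wn n (P \<omega>) * e \<omega>) = of_real (exp (- (t - s) * psi u)) * (LINT \<omega>|M. wn n (P \<omega>))" for n
    unfolding P_def e_def by (rule increment_integral[OF st(1) st' wn_m wn_b])
  ultimately have main: "(LINT \<omega>|M. w \<omega> * e \<omega>) = of_real (exp (- (t - s) * psi u)) * (LINT \<omega>|M. w \<omega>)"
    by (simp add: LIMSEQ_unique)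
  have we: "w \<omega> * e \<omega> = exp (\<i> * of_real (u * Z t \<omega>)) * of_real (normal_density 0 \<sigma> (Z s \<omega>) * kill \<sigma> \<mu> s \<omega>)" for \<omega>
  proof -
    have "exp (\<i> * of_real (u * Z s \<omega>)) * e \<omega> = exp (\<i> * of_real (u * Z t \<omega>))"
      unfolding e_def Z_def using st by (simp add: exp_add[symmetric] algebra_simps)
    then show ?thesis unfolding w_def V_def by (simp add: mult_ac)
  qed
  show ?thesis using main unfolding we unfolding w_def V_def sig_def by (simp only: mult_minus_left)
qed


section \<open>Perturbation equations for the killed law and their Laplace transforms\<close>

lemma psi_measurable [measurable]: "psi \<in> borel_measurable borel"
  unfolding psi_def by measurable

lemma psi_nonneg: "0 \<le> psi u"
  unfolding psi_def by simp

lemma kill_equation: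
  assumes \<sigma>: "\<sigma> > 0" and \<mu>: "\<mu> \<ge> 0" and t: "t \<ge> 0" and \<omega>: "\<omega> \<in> space M"
  shows "kill \<sigma> \<mu> t \<omega> = 1 - \<mu> * (LINT s:{0..t}|lborel. normal_density 0 \<sigma> (Z s \<omega>) * kill \<sigma> \<mu> s \<omega>)"
  unfolding kill_def occ_def
  by (rule exp_integral_equation[where K="1 / \<sigma>"]) (use \<mu> t \<omega> normal_density_bounds[OF \<sigma>] in auto)

lemma pair_lborel: "pair_sigma_finite lborel M"
  by unfold_locales

text \<open>A perturbation formula of Feynman-Kac type: the equation for \<open>kill\<close> is
  multiplied by the character at time \<open>t\<close> and integrated, and the Markov property moves
  the character from \<open>t\<close> back to \<open>s\<close> at the cost of the factor
  \<open>exp (- ((t - s) * psi u))\<close>.\<close>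

lemma rho_equation:
  assumes \<sigma>: "\<sigma> > 0" and \<mu>: "\<mu> \<ge> 0" and t: "t \<ge> 0"
  shows "rho \<sigma> \<mu> u t = of_real (exp (- (t * psi u)))
     - of_real \<mu> * (LINT s:{0..t}|lborel. of_real (exp (- ((t - s) * psi u))) * sig \<sigma> \<mu> u s)"
proof -
  interpret P: pair_sigma_finite lborel M by (rule pair_lborel)
  define f where "f s \<omega> = indicator {0..t} s *\<^sub>R (exp (\<i> * of_real (u * Z t \<omega>)) * of_real (normal_density 0 \<sigma> (Z s \<omega>) * kill \<sigma> \<mu> s \<omega>))" for s \<omega>
  have fm: "case_prod f \<in> borel_measurable (lborel \<Otimes>\<^sub>M M)" unfolding f_def by measurable
  have fi: "integrable (lborel \<Otimes>\<^sub>M M) (case_prod f)"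
  proof (rule P.integrable_product_bound[OF fm, of "indicator {0..t}" "\<lambda>_. 1 / \<sigma>"])
    show "norm (case_prod f (s, \<omega>)) \<le> indicator {0..t} s * (1 / \<sigma>)" for s \<omega>
      unfolding f_def using density_kill_bounds[OF \<sigma> \<mu>, of "Z s \<omega>" s \<omega>]
      by (auto simp: indicator_def norm_mult abs_mult[symmetric] simp del: abs_mult)
  qed (auto simp: emeasure_lborel_Icc_eq)
  have in_s: "(LINT s|lborel. f s \<omega>) = exp (\<i> * of_real (u * Z t \<omega>)) * of_real (LINT s:{0..t}|lborel. normal_density 0 \<sigma> (Z s \<omega>) * kill \<sigma> \<mu> s \<omega>)" for \<omega>
  proof -
    have "(LINT s|lborel. f s \<omega>) = (LINT s|lborel. exp (\<i> * of_real (u * Z t \<omega>)) * of_real (indicator {0..t} s *\<^sub>R (normal_density 0 \<sigma> (Z s \<omega>) * kill \<sigma> \<mu> s \<omega>)))"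
      unfolding f_def by (intro Bochner_Integration.integral_cong refl) (simp add: scaleR_conv_of_real mult_ac)
    then show ?thesis unfolding set_lebesgue_integral_def by (simp only: integral_mult_right_zero integral_complex_of_real)
  qed
  have in_\<omega>: "(LINT \<omega>|M. f s \<omega>) = indicator {0..t} s *\<^sub>R (of_real (exp (- ((t - s) * psi u))) * sig \<sigma> \<mu> u s)" for s
  proof (cases "s \<in> {0..t}")
    case True
    then show ?thesis unfolding f_def by (simp add: markov_sig[OF \<sigma> \<mu>] del: of_real_mult)
  qed (simp add: f_def)
  have ie: "integrable M (\<lambda>\<omega>. exp (\<i> * of_real (u * Z t \<omega>)))" by (rule integrable_const_bound[of _ 1]) auto
  have "rho \<sigma> \<mu> u t = (LINT \<omega>|M. exp (\<i> * of_real (u * Z t \<omega>)) - of_real \<mu> * (LINT s|lborel. f s \<omega>))"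
    unfolding rho_def in_s
    by (intro Bochner_Integration.integral_cong refl) (simp add: kill_equation[OF \<sigma> \<mu> t] algebra_simps)
  also have "\<dots> = (LINT \<omega>|M. exp (\<i> * of_real (u * Z t \<omega>))) - (LINT \<omega>|M. of_real \<mu> * (LINT s|lborel. f s \<omega>))"
    by (intro Bochner_Integration.integral_diff ie integrable_mult_right P.integrable_snd fi)
  also have "\<dots> = of_real (exp (- (t * psi u))) - of_real \<mu> * (LINT \<omega>|M. LINT s|lborel. f s \<omega>)"
    unfolding char_Z[OF t] by simp
  also have "(LINT \<omega>|M. LINT s|lborel. f s \<omega>) = (LINT s|lborel. LINT \<omega>|M. f s \<omega>)"
    by (rule P.Fubini_integral[OF fi])
  finally show ?thesis unfolding in_\<omega> set_lebesgue_integral_def .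
qed

definition Rq :: "real \<Rightarrow> real \<Rightarrow> real \<Rightarrow> real \<Rightarrow> complex" where
  "Rq \<sigma> \<mu> q u = (LINT t:{0<..}|lborel. of_real (exp (- (q * t))) * rho \<sigma> \<mu> u t)"

definition Sq :: "real \<Rightarrow> real \<Rightarrow> real \<Rightarrow> real \<Rightarrow> complex" where
  "Sq \<sigma> \<mu> q u = (LINT t:{0<..}|lborel. of_real (exp (- (q * t))) * sig \<sigma> \<mu> u t)"

lemma exp_weight_integrable: "q > 0 \<Longrightarrow> integrable lborel (\<lambda>t::real. indicator {0<..} t * exp (- (q * t)))"
  using integral_exp_real(1)[of q] by (simp add: set_integrable_def)

lemma exp_weight_integrable_mult:
  fixes g :: "real \<Rightarrow> complex"
  assumes q: "q > 0" and g [measurable]: "g \<in> borel_measurable borel" and b: "\<And>t. cmod (g t) \<le> B"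
  shows "set_integrable lborel {0<..} (\<lambda>t. of_real (exp (- (q * t))) * g t)"
  unfolding set_integrable_def
  by (rule Bochner_Integration.integrable_bound[OF integrable_mult_right[OF exp_weight_integrable[OF q], of B]])
     (use b in \<open>auto simp: indicator_def norm_mult mult.commute[of _ "exp _"] intro!: mult_left_mono order_trans[OF _ abs_ge_self]\<close>)

text \<open>The integral in \<open>rho_equation\<close> is a convolution in time, so its Laplace
  transform is the product of \<open>Sq\<close> with \<open>1 / (q + psi u)\<close>, the transform
  of the free factor.\<close>

lemma resolvent_equation:
  assumes \<sigma>: "\<sigma> > 0" and \<mu>: "\<mu> \<ge> 0" and q: "q > 0"
  shows "Rq \<sigma> \<mu> q u = (1 - of_real \<mu> * Sq \<sigma> \<mu> q u) / of_real (q + psi u)"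
proof -
  define a where "a = psi u"
  have a: "a \<ge> 0" "q + a > 0" unfolding a_def using psi_nonneg[of u] q by auto
  define g where "g s t = (if 0 < s \<and> s < t then of_real (exp (- (q * t)) * exp (- ((t - s) * a))) * sig \<sigma> \<mu> u s else 0)" for s t
  have gm: "case_prod g \<in> borel_measurable (lborel \<Otimes>\<^sub>M lborel)" unfolding g_def by measurable
  have gi: "integrable (lborel \<Otimes>\<^sub>M lborel) (case_prod g)"
  proof (rule lborel_pair.integrable_product_bound[OF gm])
    show "integrable lborel (\<lambda>s. 1 / \<sigma> * (indicator {0<..} s * exp (- (q / 2 * s))))"
      using q by (intro integrable_mult_right exp_weight_integrable) simp
    show "integrable lborel (\<lambda>s. indicator {0<..} s * exp (- (q / 2 * s)))"
      using q by (intro exp_weight_integrable) simp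
    fix s t :: real
    show "norm (case_prod g (s, t)) \<le> 1 / \<sigma> * (indicator {0<..} s * exp (- (q / 2 * s))) * (indicator {0<..} t * exp (- (q / 2 * t)))"
    proof (cases "0 < s \<and> s < t")
      case True
      \<comment> \<open>As \<open>s \<le> t\<close>, half of the weight in \<open>t\<close> can be
        traded for a weight in \<open>s\<close>, giving a dominating function in product
        form.\<close>
      have "exp (- (q * t)) \<le> exp (- (q / 2 * s)) * exp (- (q / 2 * t))"
      proof -
        have "q * s \<le> q * t" using True q by (intro mult_left_mono) auto
        then show ?thesis unfolding exp_add[symmetric] by simp
      qed
      moreover have "exp (- ((t - s) * a)) \<le> 1" using True a by simp
      ultimately have "exp (- (q * t)) * exp (- ((t - s) * a)) * cmod (sig \<sigma> \<mu> u s) \<le> (exp (- (q / 2 * s)) * exp (- (q / 2 * t))) * 1 * (1 / \<sigma>)"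
        using norm_sig_le[OF \<sigma> \<mu>, of u s] by (intro mult_mono) auto
      then show ?thesis unfolding g_def using True by (simp add: norm_mult mult_ac)
    next
      case False
      then show ?thesis unfolding g_def using \<sigma> by auto
    qed
  qed
  have in_s: "(LINT s|lborel. g s t) = indicator {0<..} t *\<^sub>R (of_real (exp (- (q * t))) * (LINT s:{0..t}|lborel. of_real (exp (- ((t - s) * a))) * sig \<sigma> \<mu> u s))" for t
  proof (cases "t > 0")
    case True
    have "(LINT s|lborel. g s t) = (LINT s|lborel. of_real (exp (- (q * t))) * (indicator {0..t} s *\<^sub>R (of_real (exp (- ((t - s) * a))) * sig \<sigma> \<mu> u s)))"
    proof (rule integral_cong_AE)
      show "AE s in lborel. g s t = of_real (exp (- (q * t))) * (indicator {0..t} s *\<^sub>R (of_real (exp (- ((t - s) * a))) * sig \<sigma> \<mu> u s))"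
        using AE_lborel_singleton[of 0] AE_lborel_singleton[of t]
        by eventually_elim (auto simp: g_def indicator_def)
      show "(\<lambda>s. g s t) \<in> borel_measurable lborel" unfolding g_def by measurable
    qed measurable
    also have "\<dots> = of_real (exp (- (q * t))) * (LINT s:{0..t}|lborel. of_real (exp (- ((t - s) * a))) * sig \<sigma> \<mu> u s)"
      unfolding set_lebesgue_integral_def by (rule integral_mult_right_zero)
    finally show ?thesis using True by simp
  next
    case False
    then have "g s t = 0" for s unfolding g_def by auto
    then show ?thesis using False by simp
  qed
  have in_t: "(LINT t|lborel. g s t) = indicator {0<..} s *\<^sub>R (of_real (exp (- (q * s))) * sig \<sigma> \<mu> u s) / of_real (q + a)" for s
  proof (cases "s > 0")
    case True
    have "(LINT t|lborel. g s t) = (LINT x|lborel. g s (s + 1 * x))"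
      by (subst lborel_integral_real_affine[where c=1 and t=s]) auto
    also have "\<dots> = (LINT x|lborel. (of_real (exp (- (q * s))) * sig \<sigma> \<mu> u s) * (indicator {0<..} x *\<^sub>R exp (- (of_real x * of_real (q + a)))))"
    proof (rule Bochner_Integration.integral_cong[OF refl])
      fix x :: real
      have "complex_of_real (exp (- (q * (s + x))) * exp (- (x * a))) = of_real (exp (- (q * s))) * exp (- (of_real x * of_real (q + a)))"
        by (simp add: exp_of_real[symmetric] exp_add[symmetric] algebra_simps)
      then show "g s (s + 1 * x) = (of_real (exp (- (q * s))) * sig \<sigma> \<mu> u s) * (indicator {0<..} x *\<^sub>R exp (- (of_real x * of_real (q + a))))"
        unfolding g_def using True by (simp add: indicator_def)
    qed
    also have "\<dots> = (of_real (exp (- (q * s))) * sig \<sigma> \<mu> u s) * (1 / of_real (q + a))"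
      using integral_exp_complex(2)[of "of_real (q + a)"] a unfolding set_lebesgue_integral_def
      by (subst integral_mult_right_zero) simp
    finally show ?thesis using True by simp
  next
    case False
    then have "g s t = 0" for t unfolding g_def by auto
    then show ?thesis using False by simp
  qed
  have i1: "set_integrable lborel {0<..} (\<lambda>t. of_real (exp (- (q * t))) * complex_of_real (exp (- (t * a))))"
  proof -
    have "set_integrable lborel {0<..} (\<lambda>t. of_real (exp (- (q * t))) * complex_of_real (exp (- (\<bar>t\<bar> * a))))"
      using a by (intro exp_weight_integrable_mult[OF q, of _ 1]) auto
    then show ?thesis unfolding set_integrable_def
      by (rule Bochner_Integration.integrable_cong[THEN iffD1, rotated 2]) (auto simp: indicator_def)
  qed
  have i2: "integrable lborel (\<lambda>t. of_real \<mu> * (LINT s|lborel. g s t))"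
    by (intro integrable_mult_right lborel_pair.integrable_snd gi)
  have "Rq \<sigma> \<mu> q u = (LINT t|lborel. indicator {0<..} t *\<^sub>R (of_real (exp (- (q * t))) * complex_of_real (exp (- (t * a)))) - of_real \<mu> * (LINT s|lborel. g s t))"
    unfolding Rq_def set_lebesgue_integral_def[of lborel "{0<..}"]
  proof (rule Bochner_Integration.integral_cong[OF refl])
    fix t :: real
    show "indicator {0<..} t *\<^sub>R (of_real (exp (- (q * t))) * rho \<sigma> \<mu> u t) =
       indicator {0<..} t *\<^sub>R (of_real (exp (- (q * t))) * complex_of_real (exp (- (t * a)))) - of_real \<mu> * (LINT s|lborel. g s t)"
    proof (cases "t > 0")
      case True
      then show ?thesis unfolding in_s
        by (subst rho_equation[OF \<sigma> \<mu>]) (simp_all add: a_def right_diff_distrib mult.left_commute)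
    next
      case False
      then show ?thesis unfolding in_s by simp
    qed
  qed
  also have "\<dots> = (LINT t:{0<..}|lborel. of_real (exp (- (q * t))) * complex_of_real (exp (- (t * a)))) - of_real \<mu> * (LINT t|lborel. LINT s|lborel. g s t)"
    using i1 i2 unfolding set_lebesgue_integral_def set_integrable_def
    by (subst Bochner_Integration.integral_diff) auto
  also have "(LINT t:{0<..}|lborel. of_real (exp (- (q * t))) * complex_of_real (exp (- (t * a)))) = (LINT t:{0<..}|lborel. exp (- (of_real t * of_real (q + a))))"
    by (intro set_lebesgue_integral_cong) (auto simp: exp_of_real[symmetric] exp_add[symmetric] algebra_simps)
  also have "\<dots> = 1 / of_real (q + a)" by (rule integral_exp_complex(2)) (use a in simp)
  also have "(LINT t|lborel. LINT s|lborel. g s t) = (LINT s|lborel. LINT t|lborel. g s t)"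
    by (rule lborel_pair.Fubini_integral[OF gi])
  also have "\<dots> = Sq \<sigma> \<mu> q u / of_real (q + a)"
    unfolding in_t Sq_def set_lebesgue_integral_def by simp
  finally show ?thesis unfolding a_def by (simp add: diff_divide_distrib)
qed

text \<open>Expanding the kernel into characters expresses the kernel-weighted expectation at
  frequency 0 through \<open>rho\<close> at all frequencies, the converse direction to
  \<open>rho_equation\<close>.\<close>

lemma sig_fourier:
  assumes \<sigma>: "\<sigma> > 0" and \<mu>: "\<mu> \<ge> 0"
  shows "of_real (2 * pi) * sig \<sigma> \<mu> 0 t = (LINT v|lborel. of_real (exp (- (\<sigma>\<^sup>2 * v\<^sup>2 / 2))) * rho \<sigma> \<mu> v t)"
proof -
  interpret P: pair_sigma_finite lborel M by (rule pair_lborel)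
  define f where "f v \<omega> = exp (\<i> * of_real (v * Z t \<omega>)) * of_real (exp (- (\<sigma>\<^sup>2 * v\<^sup>2 / 2))) * of_real (kill \<sigma> \<mu> t \<omega>)" for v \<omega>
  have fi: "integrable (lborel \<Otimes>\<^sub>M M) (case_prod f)"
  proof (rule P.integrable_product_bound)
    show "case_prod f \<in> borel_measurable (lborel \<Otimes>\<^sub>M M)" unfolding f_def by measurable
    show "integrable lborel (\<lambda>v. exp (- (\<sigma>\<^sup>2 * v\<^sup>2 / 2)))" by (rule normal_density_fourier(1)[OF \<sigma>])
    show "integrable M (\<lambda>_. 1)" by simp
    show "norm (case_prod f (v, \<omega>)) \<le> exp (- (\<sigma>\<^sup>2 * v\<^sup>2 / 2)) * 1" for v \<omega>
      unfolding f_def using kill_bounds[OF \<mu>, of \<sigma> t \<omega>] by (simp add: norm_mult)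
  qed
  have "of_real (2 * pi) * sig \<sigma> \<mu> 0 t = (LINT \<omega>|M. of_real (2 * pi * normal_density 0 \<sigma> (Z t \<omega>)) * of_real (kill \<sigma> \<mu> t \<omega>))"
    unfolding sig_def by (subst integral_mult_right_zero[symmetric]) (simp add: mult_ac)
  also have "\<dots> = (LINT \<omega>|M. LINT v|lborel. f v \<omega>)"
    unfolding f_def normal_density_fourier(2)[OF \<sigma>, symmetric] by simp
  also have "\<dots> = (LINT v|lborel. LINT \<omega>|M. f v \<omega>)" by (rule P.Fubini_integral[OF fi])
  also have "\<dots> = (LINT v|lborel. of_real (exp (- (\<sigma>\<^sup>2 * v\<^sup>2 / 2))) * rho \<sigma> \<mu> v t)"
    unfolding rho_def f_def
    by (intro Bochner_Integration.integral_cong refl, subst integral_mult_right_zero[symmetric]) (simp add: mult_ac)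
  finally show ?thesis .
qed

text \<open>Combined with \<open>resolvent_equation\<close> under the integral, this becomes an
  equation for \<open>Sq\<close> alone.\<close>

lemma Sq_fourier:
  assumes \<sigma>: "\<sigma> > 0" and \<mu>: "\<mu> \<ge> 0" and q: "q > 0"
  shows "of_real (2 * pi) * Sq \<sigma> \<mu> q 0 = (LINT v|lborel. of_real (exp (- (\<sigma>\<^sup>2 * v\<^sup>2 / 2))) * Rq \<sigma> \<mu> q v)"
proof -
  define f where "f v t = indicator {0<..} t *\<^sub>R (of_real (exp (- (q * t))) * (of_real (exp (- (\<sigma>\<^sup>2 * v\<^sup>2 / 2))) * rho \<sigma> \<mu> v t))" for v t
  have fi: "integrable (lborel \<Otimes>\<^sub>M lborel) (case_prod f)"
  proof (rule lborel_pair.integrable_product_bound)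
    show "case_prod f \<in> borel_measurable (lborel \<Otimes>\<^sub>M lborel)" unfolding f_def by measurable
    show "integrable lborel (\<lambda>v. exp (- (\<sigma>\<^sup>2 * v\<^sup>2 / 2)))" by (rule normal_density_fourier(1)[OF \<sigma>])
    show "integrable lborel (\<lambda>t. indicator {0<..} t * exp (- (q * t)))" by (rule exp_weight_integrable[OF q])
    show "norm (case_prod f (v, t)) \<le> exp (- (\<sigma>\<^sup>2 * v\<^sup>2 / 2)) * (indicator {0<..} t * exp (- (q * t)))" for v t
      unfolding f_def using norm_rho_le[OF \<mu>, of \<sigma> v t] by (auto simp: norm_mult indicator_def mult_left_le)
  qed
  have "of_real (2 * pi) * Sq \<sigma> \<mu> q 0 = (LINT t|lborel. indicator {0<..} t *\<^sub>R (of_real (exp (- (q * t))) * (of_real (2 * pi) * sig \<sigma> \<mu> 0 t)))"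
    unfolding Sq_def set_lebesgue_integral_def by (subst integral_mult_right_zero[symmetric]) (simp add: scaleR_conv_of_real mult_ac)
  also have "\<dots> = (LINT t|lborel. LINT v|lborel. f v t)"
    unfolding f_def sig_fourier[OF \<sigma> \<mu>] by simp
  also have "\<dots> = (LINT v|lborel. LINT t|lborel. f v t)" by (rule lborel_pair.Fubini_integral[OF fi])
  also have "\<dots> = (LINT v|lborel. of_real (exp (- (\<sigma>\<^sup>2 * v\<^sup>2 / 2))) * Rq \<sigma> \<mu> q v)"
    unfolding Rq_def f_def set_lebesgue_integral_def
    by (intro Bochner_Integration.integral_cong refl, subst integral_mult_right_zero[symmetric]) (simp add: scaleR_conv_of_real mult_ac)
  finally show ?thesis .
qed

end

text \<open>In the variable \<open>x = \<bar>z\<bar> / \<sigma>\<close> both are bounds on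
  \<open>x * exp (- (x\<^sup>2 / 2))\<close>. The kernel at 0 blows up as \<sigma> tends to 0, but
  after multiplication by \<open>\<bar>z\<bar>\<close> it stays bounded and vanishes pointwise; this
  is the form in which concentration at 0 is used.\<close>

lemma abs_mult_normal_density_le:
  assumes \<sigma>: "\<sigma> > 0"
  shows "\<bar>z\<bar> * normal_density 0 \<sigma> z \<le> 1"
    and "z \<noteq> 0 \<Longrightarrow> \<bar>z\<bar> * normal_density 0 \<sigma> z \<le> 2 / \<bar>z\<bar> * \<sigma>"
proof -
  define x where "x = \<bar>z\<bar> / \<sigma>"
  have x0: "x \<ge> 0" unfolding x_def using \<sigma> by simp
  have "1 \<le> sqrt (2 * pi)" using pi_ge_two by simp
  have "normal_density 0 \<sigma> z = 1 / (sqrt (2 * pi) * \<sigma>) * exp (- (x\<^sup>2 / 2))"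
    unfolding normal_density_def x_def using \<sigma> by (simp add: real_sqrt_mult power_divide)
  then have "\<bar>z\<bar> * normal_density 0 \<sigma> z = x * exp (- (x\<^sup>2 / 2)) / sqrt (2 * pi)"
    unfolding x_def by simp
  also have "\<dots> \<le> x * exp (- (x\<^sup>2 / 2)) / 1"
    using x0 \<open>1 \<le> sqrt (2 * pi)\<close> by (intro divide_left_mono) auto
  finally have le: "\<bar>z\<bar> * normal_density 0 \<sigma> z \<le> x * exp (- (x\<^sup>2 / 2))" by simp
  have e: "exp (- (x\<^sup>2 / 2)) = 1 / exp (x\<^sup>2 / 2)" by (simp add: exp_minus inverse_eq_divide)
  have "0 \<le> (x - 1)\<^sup>2" by simp
  then have "x \<le> 1 + x\<^sup>2 / 2" by (simp add: power2_eq_square algebra_simps)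
  also have "\<dots> \<le> exp (x\<^sup>2 / 2)" by (rule exp_ge_add_one_self)
  finally have "x * exp (- (x\<^sup>2 / 2)) \<le> 1" unfolding e by simp
  then show "\<bar>z\<bar> * normal_density 0 \<sigma> z \<le> 1" using le by linarith
  assume z: "z \<noteq> 0"
  then have xp: "x > 0" unfolding x_def using \<sigma> by simp
  have "x\<^sup>2 / 2 \<le> exp (x\<^sup>2 / 2)" using exp_ge_add_one_self[of "x\<^sup>2 / 2"] by linarith
  then have "x * (1 / exp (x\<^sup>2 / 2)) \<le> x * (1 / (x\<^sup>2 / 2))"
    using xp by (intro mult_left_mono divide_left_mono) auto
  also have "\<dots> = 2 / \<bar>z\<bar> * \<sigma>"
  proof -
    define w where "w = \<bar>z\<bar>"
    have "w > 0" unfolding w_def using z by simp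
    then show ?thesis unfolding x_def w_def[symmetric] using \<sigma> by (simp add: power2_eq_square)
  qed
  finally show "\<bar>z\<bar> * normal_density 0 \<sigma> z \<le> 2 / \<bar>z\<bar> * \<sigma>" using le unfolding e by linarith
qed

lemma abs_mult_normal_density_tendsto:
  assumes "\<And>n. \<sigma> n > 0" "\<sigma> \<longlonglongrightarrow> 0"
  shows "(\<lambda>n. \<bar>z\<bar> * normal_density 0 (\<sigma> n) z) \<longlonglongrightarrow> 0"
proof (cases "z = 0")
  case False
  show ?thesis
  proof (rule tendsto_sandwich[of "\<lambda>_. 0" _ _ "\<lambda>n. 2 / \<bar>z\<bar> * \<sigma> n"])
    show "(\<lambda>n. 2 / \<bar>z\<bar> * \<sigma> n) \<longlonglongrightarrow> 0" using assms(2) by (rule tendsto_mult_right_zero)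
    show "\<forall>\<^sub>F n in sequentially. \<bar>z\<bar> * normal_density 0 (\<sigma> n) z \<le> 2 / \<bar>z\<bar> * \<sigma> n"
      by (intro always_eventually allI abs_mult_normal_density_le(2)[OF assms(1) False])
  qed auto
qed simp

section \<open>Limit of the killed transforms as the kernel concentrates\<close>

context stable_pair
begin

definition gk :: "real \<Rightarrow> real \<Rightarrow> real \<Rightarrow> real" where
  "gk \<sigma> \<mu> t = (LINT \<omega>|M. kill \<sigma> \<mu> t \<omega>)"

lemma gk_measurable [measurable]: "gk \<sigma> \<mu> \<in> borel_measurable borel"
  unfolding gk_def by measurable

lemma kill_integrable: "\<mu> \<ge> 0 \<Longrightarrow> integrable M (kill \<sigma> \<mu> t)"
  by (rule integrable_const_bound[of _ 1]) (use kill_bounds in auto)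

lemma gk_bounds:
  assumes "\<mu> \<ge> 0"
  shows "0 \<le> gk \<sigma> \<mu> t" "gk \<sigma> \<mu> t \<le> 1"
proof -
  show "0 \<le> gk \<sigma> \<mu> t" unfolding gk_def using kill_bounds[OF assms] by (intro integral_nonneg_AE) auto
  show "gk \<sigma> \<mu> t \<le> 1" unfolding gk_def using kill_bounds[OF assms] kill_integrable[OF assms] by (intro integral_le_const) auto
qed

lemma gk_antimono:
  assumes "\<sigma> > 0" "\<mu> \<ge> 0" "s \<le> t"
  shows "gk \<sigma> \<mu> t \<le> gk \<sigma> \<mu> s"
  unfolding gk_def
  by (rule integral_mono[OF kill_integrable kill_integrable])
     (use assms occ_mono[OF assms(1) _ assms(3)] in \<open>auto simp: kill_def intro!: mult_left_mono\<close>)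

lemma gk_weight_integrable:
  assumes "q > 0" "\<mu> \<ge> 0"
  shows "set_integrable lborel {0<..} (\<lambda>t. exp (- (q * t)) * gk \<sigma> \<mu> t)"
  unfolding set_integrable_def
  by (rule Bochner_Integration.integrable_bound[OF exp_weight_integrable[OF assms(1)]])
     (use gk_bounds[OF assms(2)] in \<open>auto simp: indicator_def intro!: mult_left_le\<close>)

lemma Rq_0:
  assumes "\<mu> \<ge> 0"
  shows "Rq \<sigma> \<mu> q 0 = of_real (LINT t:{0<..}|lborel. exp (- (q * t)) * gk \<sigma> \<mu> t)"
proof -
  have "rho \<sigma> \<mu> 0 t = of_real (gk \<sigma> \<mu> t)" for t
    unfolding rho_def gk_def by (simp flip: integral_complex_of_real)
  then show ?thesis unfolding Rq_def set_lebesgue_integral_def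
    by (simp add: scaleR_conv_of_real flip: of_real_mult integral_complex_of_real)
qed

definition Sr :: "real \<Rightarrow> real \<Rightarrow> real \<Rightarrow> real" where
  "Sr \<sigma> \<mu> q = (LINT t:{0<..}|lborel. exp (- (q * t)) * (LINT \<omega>|M. normal_density 0 \<sigma> (Z t \<omega>) * kill \<sigma> \<mu> t \<omega>))"

lemma sig_0: "sig \<sigma> \<mu> 0 t = of_real (LINT \<omega>|M. normal_density 0 \<sigma> (Z t \<omega>) * kill \<sigma> \<mu> t \<omega>)"
  unfolding sig_def by (simp flip: integral_complex_of_real)

lemma Sq_0: "Sq \<sigma> \<mu> q 0 = of_real (Sr \<sigma> \<mu> q)"
proof -
  have "Sq \<sigma> \<mu> q 0 = (LINT t|lborel. complex_of_real (indicator {0<..} t *\<^sub>R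
      (exp (- (q * t)) * (LINT \<omega>|M. normal_density 0 \<sigma> (Z t \<omega>) * kill \<sigma> \<mu> t \<omega>))))"
    unfolding Sq_def sig_0 set_lebesgue_integral_def by (simp add: scaleR_conv_of_real)
  also have "\<dots> = of_real (Sr \<sigma> \<mu> q)"
    unfolding Sr_def set_lebesgue_integral_def by (rule integral_complex_of_real)
  finally show ?thesis .
qed

lemma psi_0: "psi 0 = 0"
  by (simp add: psi_def)

text \<open>Frequency 0 of the resolvent equation, where \<open>psi\<close> vanishes.\<close>

lemma gk_laplace:
  assumes "\<sigma> > 0" "\<mu> \<ge> 0" "q > 0"
  shows "(LINT t:{0<..}|lborel. exp (- (q * t)) * gk \<sigma> \<mu> t) = (1 - \<mu> * Sr \<sigma> \<mu> q) / q"
proof -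
  have "complex_of_real (LINT t:{0<..}|lborel. exp (- (q * t)) * gk \<sigma> \<mu> t) = of_real ((1 - \<mu> * Sr \<sigma> \<mu> q) / q)"
    using resolvent_equation[OF assms, of 0] unfolding Rq_0[OF assms(2)] Sq_0 psi_0 by simp
  then show ?thesis by (simp only: of_real_eq_iff)
qed

text \<open>\<open>Sr\<close> dominates \<open>Sq\<close> at every frequency, and
  \<open>\<mu> * Sr \<le> 1\<close> because the Laplace transform of \<open>gk\<close> in
  \<open>gk_laplace\<close> cannot be negative. The bound is uniform in \<sigma>, whereas the kernel
  is only bounded by \<open>1 / \<sigma>\<close>.\<close>

lemma Sq_bound:
  assumes "\<sigma> > 0" "\<mu> > 0" "q > 0"
  shows "\<mu> * cmod (Sq \<sigma> \<mu> q v) \<le> 1"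
proof -
  have m: "\<mu> \<ge> 0" using assms by simp
  have b: "cmod (sig \<sigma> \<mu> v t) \<le> (LINT \<omega>|M. normal_density 0 \<sigma> (Z t \<omega>) * kill \<sigma> \<mu> t \<omega>)" for v t
    unfolding sig_def
  proof (rule order_trans[OF integral_norm_bound])
    have "norm (exp (\<i> * of_real (v * Z t \<omega>)) * complex_of_real (normal_density 0 \<sigma> (Z t \<omega>) * kill \<sigma> \<mu> t \<omega>))
       = normal_density 0 \<sigma> (Z t \<omega>) * kill \<sigma> \<mu> t \<omega>" for \<omega>
      unfolding norm_mult norm_exp_i norm_of_real using density_kill_bounds(1)[OF assms(1) m, of "Z t \<omega>" t \<omega>] by simp
    then show "(LINT \<omega>|M. norm (exp (\<i> * of_real (v * Z t \<omega>)) * complex_of_real (normal_density 0 \<sigma> (Z t \<omega>) * kill \<sigma> \<mu> t \<omega>)))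
       \<le> (LINT \<omega>|M. normal_density 0 \<sigma> (Z t \<omega>) * kill \<sigma> \<mu> t \<omega>)" by simp
  qed
  have i: "set_integrable lborel {0<..} (\<lambda>t. of_real (exp (- (q * t))) * sig \<sigma> \<mu> v t)" for v
    by (rule exp_weight_integrable_mult[OF assms(3), of _ "1 / \<sigma>"]) (use norm_sig_le[OF assms(1) m] in auto)
  have "cmod (Sq \<sigma> \<mu> q v) \<le> Sr \<sigma> \<mu> q"
    unfolding Sq_def Sr_def
  proof (rule order_trans[OF set_integral_norm_bound[OF i] set_integral_mono])
    show "set_integrable lborel {0<..} (\<lambda>t. norm (complex_of_real (exp (- (q * t))) * sig \<sigma> \<mu> v t))"
      by (rule set_integrable_norm[OF i])
    have "set_integrable lborel {0<..} (\<lambda>t. Re (of_real (exp (- (q * t))) * sig \<sigma> \<mu> 0 t))"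
      using integrable_Re[OF i[of 0, unfolded set_integrable_def]] by (simp add: set_integrable_def)
    then show "set_integrable lborel {0<..} (\<lambda>t. exp (- (q * t)) * (LINT \<omega>|M. normal_density 0 \<sigma> (Z t \<omega>) * kill \<sigma> \<mu> t \<omega>))"
      unfolding sig_0 by simp
    show "norm (complex_of_real (exp (- (q * t))) * sig \<sigma> \<mu> v t) \<le> exp (- (q * t)) * (LINT \<omega>|M. normal_density 0 \<sigma> (Z t \<omega>) * kill \<sigma> \<mu> t \<omega>)" for t
      unfolding norm_mult norm_of_real abs_exp_cancel using b by (intro mult_left_mono) auto
  qed
  moreover have "0 \<le> (LINT t:{0<..}|lborel. exp (- (q * t)) * gk \<sigma> \<mu> t)"
    unfolding set_lebesgue_integral_def using gk_bounds(1)[OF m] by (intro integral_nonneg_AE) auto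
  then have "0 \<le> (1 - \<mu> * Sr \<sigma> \<mu> q) / q"
    unfolding gk_laplace[OF assms(1) m assms(3)] .
  then have "\<mu> * Sr \<sigma> \<mu> q \<le> 1" using assms(3) by (simp add: zero_le_divide_iff)
  ultimately show ?thesis using assms(2) by (meson mult_left_mono less_imp_le order_trans)
qed

text \<open>A character of frequency \<open>v\<close> differs from 1 by at most
  \<open>\<bar>v\<bar> * \<bar>z\<bar>\<close> at \<open>z = Z t \<omega>\<close>, and
  \<open>\<bar>z\<bar>\<close> times the kernel tends to 0 boundedly. In the limit the kernel sees
  only the point 0, where all characters equal 1.\<close>

lemma Sq_oscillation:
  assumes \<sigma>: "\<And>n. \<sigma> n > 0" "\<sigma> \<longlonglongrightarrow> 0" and \<mu>: "\<mu> \<ge> 0" and q: "q > 0"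
  shows "(\<lambda>n. Sq (\<sigma> n) \<mu> q v - Sq (\<sigma> n) \<mu> q 0) \<longlonglongrightarrow> 0"
proof -
  define H where "H n t = (LINT \<omega>|M. \<bar>Z t \<omega>\<bar> * normal_density 0 (\<sigma> n) (Z t \<omega>))" for n t
  have Hm [measurable]: "H n \<in> borel_measurable borel" for n unfolding H_def by measurable
  have zb: "0 \<le> \<bar>z\<bar> * normal_density 0 (\<sigma> n) z" "\<bar>z\<bar> * normal_density 0 (\<sigma> n) z \<le> 1" for z n
    using abs_mult_normal_density_le(1)[OF \<sigma>(1)] by auto
  have Hi: "integrable M (\<lambda>\<omega>. \<bar>Z t \<omega>\<bar> * normal_density 0 (\<sigma> n) (Z t \<omega>))" for n t
    by (rule integrable_const_bound[of _ 1]) (use zb in auto)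
  have Hb: "0 \<le> H n t" "H n t \<le> 1" for n t
    unfolding H_def using zb Hi by (auto intro!: integral_nonneg_AE integral_le_const)
  have Hlim: "(\<lambda>n. H n t) \<longlonglongrightarrow> 0" for t
  proof -
    have "(\<lambda>n. H n t) \<longlonglongrightarrow> (LINT \<omega>|M. 0)"
      unfolding H_def
      by (rule integral_dominated_convergence[where w="\<lambda>_. 1"])
         (use zb abs_mult_normal_density_tendsto[OF \<sigma>] in auto)
    then show ?thesis by simp
  qed
  have Hw: "set_integrable lborel {0<..} (\<lambda>t. exp (- (q * t)) * H n t)" for n
    unfolding set_integrable_def
    by (rule Bochner_Integration.integrable_bound[OF exp_weight_integrable[OF q]])
       (use Hb in \<open>auto simp: indicator_def intro!: mult_left_le\<close>)
  have "(\<lambda>n. LINT t:{0<..}|lborel. exp (- (q * t)) * H n t) \<longlonglongrightarrow> (LINT t|(lborel :: real measure). 0)"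
    unfolding set_lebesgue_integral_def
  proof (rule integral_dominated_convergence[where w="\<lambda>t. indicator {0<..} t * exp (- (q * t))"])
    show "integrable lborel (\<lambda>t::real. indicator {0<..} t * exp (- (q * t)) :: real)" by (rule exp_weight_integrable[OF q])
    show "AE t in lborel. (\<lambda>n. indicator {0<..} t *\<^sub>R (exp (- (q * t)) * H n t)) \<longlonglongrightarrow> 0"
    proof (intro always_eventually allI)
      fix t :: real
      have "(\<lambda>n. indicator {0<..} t *\<^sub>R (exp (- (q * t)) * H n t)) \<longlonglongrightarrow> indicator {0<..} t *\<^sub>R (exp (- (q * t)) * 0)"
        by (intro tendsto_scaleR tendsto_mult tendsto_const Hlim)
      then show "(\<lambda>n. indicator {0<..} t *\<^sub>R (exp (- (q * t)) * H n t)) \<longlonglongrightarrow> 0" by simp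
    qed
    show "AE t in lborel. norm (indicator {0<..} t *\<^sub>R (exp (- (q * t)) * H n t)) \<le> indicator {0<..} t * exp (- (q * t))" for n
      using Hb by (auto simp: indicator_def intro!: mult_left_le)
  qed measurable
  then have lim: "(\<lambda>n. \<bar>v\<bar> * (LINT t:{0<..}|lborel. exp (- (q * t)) * H n t)) \<longlonglongrightarrow> 0"
    using tendsto_mult_right_zero by simp
  show ?thesis
  proof (rule Lim_null_comparison[OF always_eventually lim], rule allI)
    fix n
    have i: "set_integrable lborel {0<..} (\<lambda>t. of_real (exp (- (q * t))) * sig (\<sigma> n) \<mu> v t)" for v
      by (rule exp_weight_integrable_mult[OF q, of _ "1 / \<sigma> n"]) (use norm_sig_le[OF \<sigma>(1) \<mu>] in auto)
    have b: "cmod (sig (\<sigma> n) \<mu> v t - sig (\<sigma> n) \<mu> 0 t) \<le> \<bar>v\<bar> * H n t" for t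
    proof -
      define D where "D \<omega> = normal_density 0 (\<sigma> n) (Z t \<omega>) * kill (\<sigma> n) \<mu> t \<omega>" for \<omega>
      have D: "0 \<le> D \<omega>" "D \<omega> \<le> 1 / \<sigma> n" "D \<omega> \<le> normal_density 0 (\<sigma> n) (Z t \<omega>)" for \<omega>
        unfolding D_def using density_kill_bounds[OF \<sigma>(1) \<mu>] kill_bounds[OF \<mu>, of "\<sigma> n" t \<omega>] by (auto intro: mult_left_le)
      have Dm [measurable]: "D \<in> borel_measurable M" unfolding D_def by measurable
      have iD: "integrable M (\<lambda>\<omega>. exp (\<i> * of_real (v * Z t \<omega>)) * of_real (D \<omega>))" for v
        by (rule integrable_const_bound[of _ "1 / \<sigma> n"]) (use D in \<open>auto simp: norm_mult\<close>)
      have iD0: "integrable M (\<lambda>\<omega>. complex_of_real (D \<omega>))"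
        by (rule integrable_const_bound[of _ "1 / \<sigma> n"]) (use D in auto)
      have "sig (\<sigma> n) \<mu> v t - sig (\<sigma> n) \<mu> 0 t = (LINT \<omega>|M. exp (\<i> * of_real (v * Z t \<omega>)) * of_real (D \<omega>) - of_real (D \<omega>))"
        unfolding sig_def D_def[symmetric] using iD iD0 by (subst Bochner_Integration.integral_diff) auto
      also have "cmod \<dots> \<le> (LINT \<omega>|M. \<bar>v\<bar> * (\<bar>Z t \<omega>\<bar> * normal_density 0 (\<sigma> n) (Z t \<omega>)))"
      proof (rule order_trans[OF integral_norm_bound integral_mono])
        show "integrable M (\<lambda>\<omega>. norm (exp (\<i> * of_real (v * Z t \<omega>)) * of_real (D \<omega>) - complex_of_real (D \<omega>)))"
          by (intro integrable_norm Bochner_Integration.integrable_diff iD iD0)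
        show "integrable M (\<lambda>\<omega>. \<bar>v\<bar> * (\<bar>Z t \<omega>\<bar> * normal_density 0 (\<sigma> n) (Z t \<omega>)))"
          by (intro integrable_mult_right Hi)
        fix \<omega>
        have "cmod (exp (\<i> * of_real (v * Z t \<omega>)) - 1) \<le> \<bar>v * Z t \<omega>\<bar>"
          using iexp_approx1[of "v * Z t \<omega>" 0] by simp
        then have "cmod (exp (\<i> * of_real (v * Z t \<omega>)) - 1) * D \<omega> \<le> \<bar>v * Z t \<omega>\<bar> * normal_density 0 (\<sigma> n) (Z t \<omega>)"
          using D by (intro mult_mono) auto
        moreover have "exp (\<i> * of_real (v * Z t \<omega>)) * of_real (D \<omega>) - complex_of_real (D \<omega>)
            = (exp (\<i> * of_real (v * Z t \<omega>)) - 1) * of_real (D \<omega>)" by (simp add: algebra_simps)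
        ultimately show "norm (exp (\<i> * of_real (v * Z t \<omega>)) * of_real (D \<omega>) - complex_of_real (D \<omega>))
           \<le> \<bar>v\<bar> * (\<bar>Z t \<omega>\<bar> * normal_density 0 (\<sigma> n) (Z t \<omega>))"
          using D(1)[of \<omega>] by (simp add: norm_mult abs_mult mult.assoc)
      qed
      finally show ?thesis unfolding H_def by simp
    qed
    have eq: "Sq (\<sigma> n) \<mu> q v - Sq (\<sigma> n) \<mu> q 0 = (LINT t:{0<..}|lborel. of_real (exp (- (q * t))) * sig (\<sigma> n) \<mu> v t - of_real (exp (- (q * t))) * sig (\<sigma> n) \<mu> 0 t)"
      unfolding Sq_def by (rule set_integral_diff(2)[OF i i, symmetric])
    have "cmod (LINT t:{0<..}|lborel. of_real (exp (- (q * t))) * sig (\<sigma> n) \<mu> v t - of_real (exp (- (q * t))) * sig (\<sigma> n) \<mu> 0 t)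
        \<le> (LINT t:{0<..}|lborel. \<bar>v\<bar> * (exp (- (q * t)) * H n t))"
    proof (rule order_trans[OF set_integral_norm_bound set_integral_mono])
      show j: "set_integrable lborel {0<..} (\<lambda>t. of_real (exp (- (q * t))) * sig (\<sigma> n) \<mu> v t - of_real (exp (- (q * t))) * sig (\<sigma> n) \<mu> 0 t)"
        by (rule set_integral_diff(1)[OF i i])
      show "set_integrable lborel {0<..} (\<lambda>t. norm (of_real (exp (- (q * t))) * sig (\<sigma> n) \<mu> v t - of_real (exp (- (q * t))) * sig (\<sigma> n) \<mu> 0 t))"
        by (rule set_integrable_norm[OF j])
      show "set_integrable lborel {0<..} (\<lambda>t. \<bar>v\<bar> * (exp (- (q * t)) * H n t))"
        by (intro set_integrable_mult_right Hw)
      fix t :: real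
      have "norm (of_real (exp (- (q * t))) * sig (\<sigma> n) \<mu> v t - of_real (exp (- (q * t))) * sig (\<sigma> n) \<mu> 0 t)
         = exp (- (q * t)) * cmod (sig (\<sigma> n) \<mu> v t - sig (\<sigma> n) \<mu> 0 t)"
        unfolding right_diff_distrib[symmetric] norm_mult by simp
      also have "\<dots> \<le> exp (- (q * t)) * (\<bar>v\<bar> * H n t)" by (intro mult_left_mono b) simp
      finally show "norm (of_real (exp (- (q * t))) * sig (\<sigma> n) \<mu> v t - of_real (exp (- (q * t))) * sig (\<sigma> n) \<mu> 0 t)
         \<le> \<bar>v\<bar> * (exp (- (q * t)) * H n t)" by (simp add: mult_ac)
    qed
    then show "cmod (Sq (\<sigma> n) \<mu> q v - Sq (\<sigma> n) \<mu> q 0) \<le> \<bar>v\<bar> * (LINT t:{0<..}|lborel. exp (- (q * t)) * H n t)"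
      unfolding eq set_integral_mult_right .
  qed
qed

text \<open>Inserting \<open>resolvent_equation\<close> into \<open>Sq_fourier\<close> and replacing
  the Gaussian factor by 1 and \<open>Sq\<close> at \<open>v\<close> by \<open>Sq\<close> at 0
  leaves the scalar equation \<open>2 * pi * S = (1 - \<mu> * S) * res q\<close>. The error tends to
  0, and since the equation is linear in \<open>S\<close> with a nonzero coefficient, this alone
  forces \<open>S\<close> to converge to its solution.\<close>

lemma gk_laplace_limit:
  assumes le: "levy_exponent psi"
    and \<sigma>: "\<And>n. \<sigma> n > 0" "\<sigma> \<longlonglongrightarrow> 0" and \<mu>: "\<mu> > 0" and q: "q > 0"
  shows "(\<lambda>n. LINT t:{0<..}|lborel. exp (- (q * t)) * gk (\<sigma> n) \<mu> t)
     \<longlonglongrightarrow> 2 * pi / (q * (2 * pi + \<mu> * levy_exponent.res psi q))"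
proof -
  interpret L: levy_exponent psi by (rule le)
  define c where "c = L.res q"
  have c: "c > 0" unfolding c_def by (rule L.res_pos[OF q])
  have m: "\<mu> \<ge> 0" using \<mu> by simp
  define S where "S n v = Sq (\<sigma> n) \<mu> q v" for n v
  have S1: "cmod (1 - of_real \<mu> * S n v) \<le> 2" for n v
  proof -
    have "cmod (of_real \<mu> * S n v) \<le> 1" unfolding S_def using Sq_bound[OF \<sigma>(1) \<mu> q] \<mu> by (simp add: norm_mult)
    then show ?thesis using norm_triangle_ineq4[of 1 "of_real \<mu> * S n v"] by simp
  qed
  define \<gamma> where "\<gamma> n v = exp (- ((\<sigma> n)\<^sup>2 * v\<^sup>2 / 2))" for n v
  have \<gamma>: "0 \<le> \<gamma> n v" "\<gamma> n v \<le> 1" for n v unfolding \<gamma>_def by auto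
  have Sm [measurable]: "S n \<in> borel_measurable borel" for n unfolding S_def Sq_def set_lebesgue_integral_def by measurable
  have \<gamma>m [measurable]: "\<gamma> n \<in> borel_measurable borel" for n unfolding \<gamma>_def by measurable
  \<comment> \<open>The error committed by both replacements, as an integrand. The bracket is at
    most 2 + 2 in modulus, so \<open>4 / (q + psi v)\<close> dominates.\<close>
  define k where "k n v = (of_real (\<gamma> n v) * (1 - of_real \<mu> * S n v) - (1 - of_real \<mu> * S n 0)) * of_real (1 / (q + psi v))" for n v
  have qp: "q + psi v > 0" for v using q psi_nonneg[of v] by simp
  have kb: "cmod (of_real (\<gamma> n v) * (1 - of_real \<mu> * S n v) - (1 - of_real \<mu> * S n 0)) \<le> 4" for n v
  proof -
    have "cmod (of_real (\<gamma> n v) * (1 - of_real \<mu> * S n v)) \<le> 1 * 2"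
      unfolding norm_mult using \<gamma> S1 by (intro mult_mono) auto
    then show ?thesis using S1[of n 0] norm_triangle_ineq4[of "of_real (\<gamma> n v) * (1 - of_real \<mu> * S n v)" "1 - of_real \<mu> * S n 0"] by linarith
  qed
  have klim: "(\<lambda>n. k n v) \<longlonglongrightarrow> 0" for v
  proof -
    have "(\<lambda>n. 2 * \<bar>\<gamma> n v - 1\<bar> + \<mu> * cmod (S n v - S n 0)) \<longlonglongrightarrow> 2 * \<bar>exp (- (0\<^sup>2 * v\<^sup>2 / 2)) - 1\<bar> + \<mu> * 0"
      unfolding \<gamma>_def S_def using tendsto_norm_zero[OF Sq_oscillation[OF \<sigma> m q, of v]]
      by (intro tendsto_intros \<sigma>(2)) auto
    then have lim: "(\<lambda>n. 2 * \<bar>\<gamma> n v - 1\<bar> + \<mu> * cmod (S n v - S n 0)) \<longlonglongrightarrow> 0" by simp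
    have "(\<lambda>n. of_real (\<gamma> n v) * (1 - of_real \<mu> * S n v) - (1 - of_real \<mu> * S n 0)) \<longlonglongrightarrow> 0"
    proof (rule Lim_null_comparison[OF always_eventually lim], rule allI)
      fix n
      have "of_real (\<gamma> n v) * (1 - of_real \<mu> * S n v) - (1 - of_real \<mu> * S n 0)
         = of_real (\<gamma> n v - 1) * (1 - of_real \<mu> * S n v) - of_real \<mu> * (S n v - S n 0)"
        by (simp add: algebra_simps)
      also have "cmod \<dots> \<le> \<bar>\<gamma> n v - 1\<bar> * cmod (1 - of_real \<mu> * S n v) + \<mu> * cmod (S n v - S n 0)"
        by (rule order_trans[OF norm_triangle_ineq4]) (use m in \<open>simp add: norm_mult del: of_real_diff\<close>)
      also have "\<dots> \<le> 2 * \<bar>\<gamma> n v - 1\<bar> + \<mu> * cmod (S n v - S n 0)"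
        using mult_left_mono[OF S1[of n v], of "\<bar>\<gamma> n v - 1\<bar>"] by (simp add: mult.commute)
      finally show "cmod (of_real (\<gamma> n v) * (1 - of_real \<mu> * S n v) - (1 - of_real \<mu> * S n 0))
         \<le> 2 * \<bar>\<gamma> n v - 1\<bar> + \<mu> * cmod (S n v - S n 0)" .
    qed
    then show ?thesis unfolding k_def by (rule tendsto_mult_left_zero)
  qed
  have i1: "integrable lborel (\<lambda>v. 1 / (q + psi v))" by (rule L.integrable_res[OF q])
  have "(\<lambda>n. LINT v|lborel. k n v) \<longlonglongrightarrow> (LINT v|(lborel :: real measure). 0)"
  proof (rule integral_dominated_convergence[OF _ _ integrable_mult_right[OF i1, of 4]])
    show "AE v in lborel. norm (k n v) \<le> 4 * (1 / (q + psi v))" for n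
    proof (intro always_eventually allI)
      fix v
      show "norm (k n v) \<le> 4 * (1 / (q + psi v))"
        unfolding k_def norm_mult norm_of_real using kb[of n v] qp[of v] by (intro mult_mono) auto
    qed
    show "k n \<in> borel_measurable lborel" for n unfolding k_def by measurable
  qed (use klim in auto)
  then have d0: "(\<lambda>n. LINT v|lborel. k n v) \<longlonglongrightarrow> 0" by simp
  \<comment> \<open>Exact for every \<open>n\<close>: the integral of \<open>k n\<close> is the
    defect in the scalar equation.\<close>
  have d: "(LINT v|lborel. k n v) = of_real ((2 * pi + \<mu> * c) * Sr (\<sigma> n) \<mu> q - c)" for n
  proof -
    define A where "A v = of_real (\<gamma> n v) * (1 - of_real \<mu> * S n v) * complex_of_real (1 / (q + psi v))" for v
    have iA: "integrable lborel A"
    proof (rule Bochner_Integration.integrable_bound[OF integrable_mult_right[OF i1, of 2]])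
      show "A \<in> borel_measurable lborel" unfolding A_def by measurable
      show "AE v in lborel. norm (A v) \<le> norm (2 * (1 / (q + psi v)))"
      proof (intro always_eventually allI)
        fix v
        have "cmod (of_real (\<gamma> n v) * (1 - of_real \<mu> * S n v)) \<le> 1 * 2"
          unfolding norm_mult using \<gamma> S1 by (intro mult_mono) auto
        then have "norm (A v) \<le> 2 * (1 / (q + psi v))"
          unfolding A_def norm_mult[of "_ * _" "of_real (1 / (q + psi v))"] norm_of_real using qp[of v] by (intro mult_mono) auto
        then show "norm (A v) \<le> norm (2 * (1 / (q + psi v)))" using qp[of v] by simp
      qed
    qed
    have iB: "integrable lborel (\<lambda>v. complex_of_real (1 / (q + psi v)))" using i1 by (simp only: integrable_of_real)
    have "(LINT v|lborel. k n v) = (LINT v|lborel. A v - (1 - of_real \<mu> * S n 0) * complex_of_real (1 / (q + psi v)))"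
      unfolding k_def A_def left_diff_distrib ..
    also have "\<dots> = (LINT v|lborel. A v) - (LINT v|lborel. (1 - of_real \<mu> * S n 0) * complex_of_real (1 / (q + psi v)))"
      by (intro Bochner_Integration.integral_diff iA integrable_mult_right iB)
    also have "(LINT v|lborel. (1 - of_real \<mu> * S n 0) * complex_of_real (1 / (q + psi v))) = (1 - of_real \<mu> * S n 0) * of_real c"
      unfolding c_def L.res_def integral_mult_right_zero integral_complex_of_real ..
    also have "(LINT v|lborel. A v) = of_real (2 * pi) * S n 0"
      unfolding S_def Sq_fourier[OF \<sigma>(1) m q]
      by (intro Bochner_Integration.integral_cong refl) (simp add: A_def \<gamma>_def S_def resolvent_equation[OF \<sigma>(1) m q])
    finally show ?thesis unfolding S_def Sq_0 by (simp add: algebra_simps)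
  qed
  have "(\<lambda>n. (2 * pi + \<mu> * c) * Sr (\<sigma> n) \<mu> q - c) \<longlonglongrightarrow> 0"
  proof -
    have "(\<lambda>n. complex_of_real ((2 * pi + \<mu> * c) * Sr (\<sigma> n) \<mu> q - c)) \<longlonglongrightarrow> of_real 0"
      unfolding of_real_0 d[symmetric] by (rule d0)
    then show ?thesis by (simp only: tendsto_of_real_iff)
  qed
  then have "(\<lambda>n. ((2 * pi + \<mu> * c) * Sr (\<sigma> n) \<mu> q - c) + c) \<longlonglongrightarrow> 0 + c"
    by (rule tendsto_add[OF _ tendsto_const])
  then have s: "(\<lambda>n. (2 * pi + \<mu> * c) * Sr (\<sigma> n) \<mu> q) \<longlonglongrightarrow> c" by simp
  have pos: "2 * pi + \<mu> * c > 0" using c \<mu> pi_gt_zero by (intro add_pos_pos mult_pos_pos) auto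
  have "(\<lambda>n. ((2 * pi + \<mu> * c) * Sr (\<sigma> n) \<mu> q) / (2 * pi + \<mu> * c)) \<longlonglongrightarrow> c / (2 * pi + \<mu> * c)"
    by (rule tendsto_divide[OF s tendsto_const]) (use pos in simp)
  then have "(\<lambda>n. Sr (\<sigma> n) \<mu> q) \<longlonglongrightarrow> c / (2 * pi + \<mu> * c)" using pos by simp
  then have "(\<lambda>n. (1 - \<mu> * Sr (\<sigma> n) \<mu> q) / q) \<longlonglongrightarrow> (1 - \<mu> * (c / (2 * pi + \<mu> * c))) / q"
    using q by (intro tendsto_intros) auto
  also have "(1 - \<mu> * (c / (2 * pi + \<mu> * c))) / q = 2 * pi / (q * (2 * pi + \<mu> * c))"
    using pos q by (simp add: field_simps)
  finally show ?thesis unfolding gk_laplace[OF \<sigma>(1) m q] c_def .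
qed

end

section \<open>Small values of the collision local time\<close>

lemma integral_affine_exp:
  assumes q: "(q::real) > 0"
  shows "set_integrable lborel {0<..} (\<lambda>t. exp (- (q * t)) * t)"
    and "(LINT t:{0<..}|lborel. exp (- (q * t)) * t) = 1 / q\<^sup>2"
proof -
  have e: "einterval 0 \<infinity> = {0<..}" by (auto simp: einterval_def)
  define G where "G t = - (t / q + 1 / q\<^sup>2) * exp (- (q * t))" for t
  have d: "(G has_real_derivative exp (- (q * t)) * t) (at t)" for t
    unfolding G_def using q by (auto intro!: derivative_eq_intros simp: field_simps power2_eq_square)
  have "(G \<longlongrightarrow> G 0) (at_right 0)"
    unfolding G_def using q by (intro tendsto_intros) auto
  then have l0: "((G \<circ> real_of_ereal) \<longlongrightarrow> G 0) (at_right 0)" by (simp add: ereal_tendsto_simps zero_ereal_def)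
  have "(G \<longlongrightarrow> 0) at_top" unfolding G_def using q by real_asymp
  then have l1: "((G \<circ> real_of_ereal) \<longlongrightarrow> 0) (at_left \<infinity>)" by (simp add: ereal_tendsto_simps)
  have ae: "AE x in lborel. 0 < ereal x \<longrightarrow> ereal x < \<infinity> \<longrightarrow> 0 \<le> exp (- (q * x)) * x" by auto
  have c: "isCont (\<lambda>t. exp (- (q * t)) * t) x" for x by (intro continuous_intros)
  note F = interval_integral_FTC_nonneg[of 0 \<infinity> G "\<lambda>t. exp (- (q * t)) * t", OF _ d c ae l0 l1]
  show "set_integrable lborel {0<..} (\<lambda>t. exp (- (q * t)) * t)" using F(1) unfolding e by simp
  have "G 0 = - (1 / q\<^sup>2)" unfolding G_def by simp
  then show "(LINT t:{0<..}|lborel. exp (- (q * t)) * t) = 1 / q\<^sup>2"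
    using F(2) by (simp add: interval_lebesgue_integral_def e)
qed

text \<open>For \<open>L \<omega> \<ge> 0\<close> the value
  \<open>exp (- (q * L \<omega>)) / q\<close> is the integral of \<open>exp (- (q * x))\<close> over
  \<open>x \<ge> L \<omega>\<close>; taking expectations and exchanging the integrals replaces an
  integration by parts.\<close>

lemma (in prob_space) distribution_laplace:
  fixes L :: "'a \<Rightarrow> real"
  assumes L [measurable]: "L \<in> borel_measurable M" and L0: "AE \<omega> in M. 0 \<le> L \<omega>" and q: "q > 0"
  shows "(LINT x:{0<..}|lborel. exp (- (q * x)) * \<P>(\<omega> in M. L \<omega> \<le> x)) = (LINT \<omega>|M. exp (- (q * L \<omega>))) / q"
proof -
  interpret P: pair_sigma_finite lborel M by unfold_locales
  define f where "f x \<omega> = (if 0 < x \<and> L \<omega> \<le> x then exp (- (q * x)) else 0)" for x \<omega>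
  have w: "integrable lborel (\<lambda>x::real. indicator {0<..} x * exp (- (q * x)))"
    using integrable_I0i_exp_mscale[OF q] by (simp add: set_integrable_def mult.commute)
  have fi: "integrable (lborel \<Otimes>\<^sub>M M) (case_prod f)"
  proof (rule P.integrable_product_bound[OF _ w, of _ "\<lambda>_. 1"])
    show "case_prod f \<in> borel_measurable (lborel \<Otimes>\<^sub>M M)" unfolding f_def by measurable
    show "norm (case_prod f (x, \<omega>)) \<le> indicator {0<..} x * exp (- (q * x)) * 1" for x \<omega> unfolding f_def by auto
  qed simp
  have 1: "(LINT \<omega>|M. f x \<omega>) = indicator {0<..} x * (exp (- (q * x)) * \<P>(\<omega> in M. L \<omega> \<le> x))" for x
  proof -
    have "(LINT \<omega>|M. f x \<omega>) = (LINT \<omega>|M. (indicator {0<..} x * exp (- (q * x))) * indicator {\<omega>\<in>space M. L \<omega> \<le> x} \<omega>)"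
      unfolding f_def by (intro Bochner_Integration.integral_cong) (auto simp: indicator_def)
    also have "\<dots> = (indicator {0<..} x * exp (- (q * x))) * \<P>(\<omega> in M. L \<omega> \<le> x)"
      by (subst integral_mult_right_zero) simp
    finally show ?thesis by simp
  qed
  have 2: "(LINT x|lborel. f x \<omega>) = exp (- (q * L \<omega>)) / q" if "0 \<le> L \<omega>" for \<omega>
  proof -
    have "(LINT x|lborel. f x \<omega>) = (LINT y|lborel. f (L \<omega> + 1 * y) \<omega>)"
      by (subst lborel_integral_real_affine[where c=1 and t="L \<omega>"]) auto
    also have "\<dots> = (LINT y|lborel. exp (- (q * L \<omega>)) * (indicator {0<..} y *\<^sub>R exp (- (q * y))))"
    proof (rule integral_cong_AE)
      show "AE y in lborel. f (L \<omega> + 1 * y) \<omega> = exp (- (q * L \<omega>)) * (indicator {0<..} y *\<^sub>R exp (- (q * y)))"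
        using AE_lborel_singleton[of 0]
      proof eventually_elim
        case (elim y)
        have "exp (- (q * (L \<omega> + y))) = exp (- (q * L \<omega>)) * exp (- (q * y))"
          by (simp add: exp_add[symmetric] algebra_simps)
        then show ?case using that elim unfolding f_def by (auto simp: indicator_def)
      qed
      show "(\<lambda>y. f (L \<omega> + 1 * y) \<omega>) \<in> borel_measurable lborel" unfolding f_def by measurable
    qed measurable
    also have "\<dots> = exp (- (q * L \<omega>)) * (LINT y:{0<..}|lborel. exp (- (q * y)))"
      unfolding set_lebesgue_integral_def by (rule integral_mult_right_zero)
    also have "(LINT y:{0<..}|lborel. exp (- (q * y))) = 1 / q" by (rule integral_exp_real(2)[OF q])
    finally show ?thesis by simp
  qed
  have "(LINT x:{0<..}|lborel. exp (- (q * x)) * \<P>(\<omega> in M. L \<omega> \<le> x)) = (LINT x|lborel. LINT \<omega>|M. f x \<omega>)"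
    unfolding 1 set_lebesgue_integral_def by simp
  also have "\<dots> = (LINT \<omega>|M. LINT x|lborel. f x \<omega>)" by (rule P.Fubini_integral[OF fi, symmetric])
  also have "\<dots> = (LINT \<omega>|M. exp (- (q * L \<omega>)) / q)"
    by (rule integral_cong_AE) (use L0 2 in \<open>auto simp: f_def\<close>)
  finally show ?thesis by simp
qed

text \<open>The rescaled distribution functions \<open>g \<mu>\<close> increase in \<open>x\<close>,
  and their transforms at \<open>q\<close> tend to \<open>c / q\<^sup>2\<close>, the transform of
  \<open>c * x\<close>. The limit at \<open>x = 1\<close>, read with
  \<open>\<mu> = inverse \<epsilon>\<close>, is the claim.\<close>

lemma (in prob_space) karamata_small_values:
  fixes L :: "'a \<Rightarrow> real"
  assumes L [measurable]: "L \<in> borel_measurable M" and L0: "AE \<omega> in M. 0 \<le> L \<omega>"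
    and lim: "((\<lambda>\<mu>. \<mu> * (LINT \<omega>|M. exp (- (\<mu> * L \<omega>)))) \<longlongrightarrow> c) at_top"
  shows "((\<lambda>\<epsilon>. inverse \<epsilon> * \<P>(\<omega> in M. L \<omega> \<le> \<epsilon>)) \<longlongrightarrow> c) (at_right 0)"
proof -
  define g where "g \<mu> x = \<mu> * \<P>(\<omega> in M. \<mu> * L \<omega> \<le> x)" for \<mu> x
  have sl: "(LINT x:{0<..}|lborel. exp (- (q * x)) * g \<mu> x) = (\<mu> * (LINT \<omega>|M. exp (- (q * \<mu> * L \<omega>)))) / q" if "q > 0" "\<mu> > 0" for q \<mu>
  proof -
    have "(LINT x:{0<..}|lborel. exp (- (q * x)) * g \<mu> x) = (LINT x:{0<..}|lborel. \<mu> * (exp (- (q * x)) * \<P>(\<omega> in M. \<mu> * L \<omega> \<le> x)))"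
      unfolding g_def by (simp add: mult_ac)
    also have "\<dots> = \<mu> * ((LINT \<omega>|M. exp (- (q * (\<mu> * L \<omega>)))) / q)"
      unfolding set_integral_mult_right
      by (subst distribution_laplace) (use L0 that in \<open>auto elim!: eventually_mono\<close>)
    finally show ?thesis by (simp add: mult.assoc)
  qed
  have "((\<lambda>\<mu>. g \<mu> 1) \<longlongrightarrow> c * 1) at_top"
  proof (rule laplace_convergence_monotone[where \<sigma>=1 and f="\<lambda>x. c * x" and g=g and T=1])
    show "\<forall>\<^sub>F \<mu> in at_top. set_integrable lborel {0<..} (\<lambda>x. exp (- x) * g \<mu> x) \<and> (\<forall>t>0. 0 \<le> g \<mu> t)"
      using eventually_gt_at_top[of 0]
    proof eventually_elim
      case (elim \<mu>)
      have w: "integrable lborel (\<lambda>x::real. indicator {0<..} x * exp (- (1 * x)))"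
        using integrable_I0i_exp_mscale[of 1] by (simp add: set_integrable_def)
      have gm [measurable]: "g \<mu> \<in> borel_measurable borel"
        by (rule borel_measurable_mono) (auto simp: g_def mono_def intro!: mult_left_mono finite_measure_mono less_imp_le[OF elim])
      have gb: "0 \<le> g \<mu> x" "g \<mu> x \<le> \<mu>" for x unfolding g_def using elim by (auto simp: mult_left_le)
      have "set_integrable lborel {0<..} (\<lambda>x. exp (- x) * g \<mu> x)"
        unfolding set_integrable_def
      proof (rule Bochner_Integration.integrable_bound[OF integrable_mult_right[OF w, of \<mu>]])
        show "AE x in lborel. norm (indicator {0<..} x *\<^sub>R (exp (- x) * g \<mu> x)) \<le> norm (\<mu> * (indicator {0<..} x * exp (- (1 * x))))"
          using gb elim by (auto simp: indicator_def abs_mult mult.commute intro!: mult_left_mono)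
      qed measurable
      then show ?case using gb by auto
    qed
    show "set_integrable lborel {0<..} (\<lambda>t. exp (- t) * (c * t))"
      using set_integrable_mult_right[OF integral_affine_exp(1)[of 1], of c] by (simp add: mult_ac)
    fix k
    define q where "q = real (Suc k)"
    have q: "q > 0" unfolding q_def by simp
    have "filterlim (\<lambda>\<mu>. q * \<mu>) at_top at_top"
      by (rule filterlim_tendsto_pos_mult_at_top[OF tendsto_const q filterlim_ident])
    then have "((\<lambda>\<mu>. (q * \<mu>) * (LINT \<omega>|M. exp (- ((q * \<mu>) * L \<omega>)))) \<longlongrightarrow> c) at_top"
      by (rule filterlim_compose[OF lim])
    \<comment> \<open>Of the two factors \<open>1 / q\<close>, one undoes the rescaling of the
      hypothesis from \<mu> to \<open>q * \<mu>\<close>, the other comes from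
      \<open>distribution_laplace\<close>.\<close>
    then have "((\<lambda>\<mu>. ((q * \<mu>) * (LINT \<omega>|M. exp (- ((q * \<mu>) * L \<omega>)))) / q\<^sup>2) \<longlongrightarrow> c / q\<^sup>2) at_top"
      using q by (intro tendsto_divide tendsto_const) auto
    moreover have "(LINT t:{0<..}|lborel. exp (- (q * t)) * (c * t)) = c / q\<^sup>2"
      using integral_affine_exp(2)[OF q] by (simp add: mult.left_commute[of _ c])
    moreover have "\<forall>\<^sub>F \<mu> in at_top. ((q * \<mu>) * (LINT \<omega>|M. exp (- ((q * \<mu>) * L \<omega>)))) / q\<^sup>2 = (LINT x:{0<..}|lborel. exp (- (q * x)) * g \<mu> x)"
      using eventually_gt_at_top[of 0]
      by eventually_elim (use q in \<open>simp add: sl power2_eq_square\<close>)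
    ultimately show "((\<lambda>\<mu>. LINT t:{0<..}|lborel. exp (- (real (Suc k) * t)) * g \<mu> t) \<longlongrightarrow>
       (LINT t:{0<..}|lborel. exp (- (real (Suc k) * t)) * (c * t))) at_top"
      unfolding q_def[symmetric] by (simp add: Lim_transform_eventually)
  next
    show "\<forall>\<^sub>F \<mu> in at_top. \<forall>s t. 0 < s \<and> s \<le> t \<longrightarrow> 1 * g \<mu> s \<le> 1 * g \<mu> t"
      using eventually_gt_at_top[of 0]
      by eventually_elim (auto simp: g_def intro!: mult_left_mono finite_measure_mono)
  qed auto
  then have gl: "((\<lambda>\<epsilon>. g (inverse \<epsilon>) 1) \<longlongrightarrow> c * 1) (at_right 0)"
    by (rule filterlim_compose[OF _ filterlim_inverse_at_top_right])
  have "\<forall>\<^sub>F \<epsilon> in at_right 0. g (inverse \<epsilon>) 1 = inverse \<epsilon> * \<P>(\<omega> in M. L \<omega> \<le> \<epsilon>)"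
    unfolding eventually_at_right_field
  proof (intro exI[of _ 1] conjI allI impI)
    fix \<epsilon> :: real assume "0 < \<epsilon>" "\<epsilon> < 1"
    then have "inverse \<epsilon> * L \<omega> \<le> 1 \<longleftrightarrow> L \<omega> \<le> \<epsilon>" for \<omega> by (simp add: field_simps)
    then show "g (inverse \<epsilon>) 1 = inverse \<epsilon> * \<P>(\<omega> in M. L \<omega> \<le> \<epsilon>)" unfolding g_def by simp
  qed simp
  from Lim_transform_eventually[OF gl this] show ?thesis by simp
qed

section \<open>From occupation integrals to the local time\<close>

context stable_pair
begin

lemma approx_collision_local_time_eq:
  "approx_collision_local_time X Y T \<epsilon> \<omega> = occ (sqrt \<epsilon>) T \<omega>"
  unfolding approx_collision_local_time_def occ_def
  by (rule set_lebesgue_integral_cong) (auto simp: Z_def)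

text \<open>The approximations are nonnegative, so the negative part of \<open>L\<close> is at most
  the distance to each of them and vanishes almost surely. On the nonnegative half-line
  \<open>exp (- (\<mu> * x))\<close> is Lipschitz with constant \<mu>, which carries mean-square
  convergence over to the expectations.\<close>

lemma collision_local_time_limits:
  assumes L: "is_collision_local_time M X Y T L"
  defines "\<sigma> \<equiv> \<lambda>n. sqrt (1 / (real n + 1))"
  shows "AE \<omega> in M. 0 \<le> L \<omega>"
    and "\<mu> > 0 \<Longrightarrow> (\<lambda>n. gk (\<sigma> n) \<mu> T) \<longlonglongrightarrow> (LINT \<omega>|M. exp (- (\<mu> * L \<omega>)))"
proof -
  have Lm [measurable]: "L \<in> borel_measurable M" using L unfolding is_collision_local_time_def by simp
  define nn where "nn n = (\<integral>\<^sup>+ \<omega>. ennreal ((occ (\<sigma> n) T \<omega> - L \<omega>)\<^sup>2) \<partial>M)" for n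
  have "filterlim (\<lambda>n. 1 / (real n + 1)) (at_right 0) sequentially" by real_asymp
  moreover have "((\<lambda>\<epsilon>. \<integral>\<^sup>+ \<omega>. ennreal ((occ (sqrt \<epsilon>) T \<omega> - L \<omega>)\<^sup>2) \<partial>M) \<longlongrightarrow> 0) (at_right 0)"
    using L unfolding is_collision_local_time_def approx_collision_local_time_eq by simp
  ultimately have nn: "nn \<longlonglongrightarrow> 0" unfolding nn_def \<sigma>_def by (rule filterlim_compose[rotated])
  have "(\<integral>\<^sup>+ \<omega>. ennreal ((min 0 (L \<omega>))\<^sup>2) \<partial>M) \<le> 0"
  proof (rule tendsto_lowerbound[OF nn])
    have "(\<integral>\<^sup>+ \<omega>. ennreal ((min 0 (L \<omega>))\<^sup>2) \<partial>M) \<le> nn n" for n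
      unfolding nn_def
    proof (rule nn_integral_mono)
      fix \<omega>
      have "\<bar>min 0 (L \<omega>)\<bar> \<le> \<bar>occ (\<sigma> n) T \<omega> - L \<omega>\<bar>" using occ_nonneg[of "\<sigma> n" T \<omega>] by auto
      then show "ennreal ((min 0 (L \<omega>))\<^sup>2) \<le> ennreal ((occ (\<sigma> n) T \<omega> - L \<omega>)\<^sup>2)"
        unfolding abs_le_square_iff by (rule ennreal_leI)
    qed
    then show "\<forall>\<^sub>F n in sequentially. (\<integral>\<^sup>+ \<omega>. ennreal ((min 0 (L \<omega>))\<^sup>2) \<partial>M) \<le> nn n" by simp
  qed simp
  then have "AE \<omega> in M. ennreal ((min 0 (L \<omega>))\<^sup>2) = 0" by (subst (asm) le_zero_eq, subst (asm) nn_integral_0_iff_AE) auto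
  then show L0: "AE \<omega> in M. 0 \<le> L \<omega>"
    by eventually_elim (auto simp: min_def split: if_splits)
  assume \<mu>: "\<mu> > 0"
  define I where "I n = (LINT \<omega>|M. (occ (\<sigma> n) T \<omega> - L \<omega>)\<^sup>2)" for n
  have "I = (\<lambda>n. enn2real (nn n))"
    unfolding I_def nn_def by (rule ext, rule integral_eq_nn_integral) auto
  moreover have "(\<lambda>n. enn2real (nn n)) \<longlonglongrightarrow> 0"
    by (rule tendsto_enn2real) (use nn in simp_all)
  ultimately have I: "I \<longlonglongrightarrow> 0" by (simp only:)
  \<comment> \<open>Finiteness of the extended integral is secured separately, since the Bochner
    integral \<open>I n\<close> would be 0 for a square that is not integrable.\<close>
  have fin: "\<forall>\<^sub>F n in sequentially. nn n < 1" by (rule order_tendstoD[OF nn]) simp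
  show "(\<lambda>n. gk (\<sigma> n) \<mu> T) \<longlonglongrightarrow> (LINT \<omega>|M. exp (- (\<mu> * L \<omega>)))"
  proof (rule tendstoI)
    fix r :: real assume r: "r > 0"
    \<comment> \<open>The estimate \<open>b \<le> d + b\<^sup>2 / d\<close> replaces Cauchy-Schwarz;
      this \<open>d\<close> spends half of \<open>r\<close> on the constant term.\<close>
    define d where "d = r / (2 * \<mu>)"
    have d: "d > 0" "\<mu> * d = r / 2" unfolding d_def using r \<mu> by auto
    have "(\<lambda>n. \<mu> / d * I n) \<longlonglongrightarrow> 0" using I by (rule tendsto_mult_right_zero)
    then have "\<forall>\<^sub>F n in sequentially. \<mu> / d * I n < r / 2" by (rule order_tendstoD) (use r in simp)
    then show "\<forall>\<^sub>F n in sequentially. dist (gk (\<sigma> n) \<mu> T) (LINT \<omega>|M. exp (- (\<mu> * L \<omega>))) < r"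
      using fin
    proof eventually_elim
      case (elim n)
      have i2: "integrable M (\<lambda>\<omega>. (occ (\<sigma> n) T \<omega> - L \<omega>)\<^sup>2)"
        by (rule integrableI_nonneg) (use elim(2) in \<open>auto simp: nn_def intro: less_trans\<close>)
      have i1: "integrable M (kill (\<sigma> n) \<mu> T)" using \<mu> by (intro kill_integrable) simp
      have iL: "integrable M (\<lambda>\<omega>. exp (- (\<mu> * L \<omega>)))"
        by (rule integrable_const_bound[of _ 1]) (use L0 \<mu> in \<open>auto elim!: eventually_mono\<close>)
      have "\<bar>gk (\<sigma> n) \<mu> T - (LINT \<omega>|M. exp (- (\<mu> * L \<omega>)))\<bar> = \<bar>LINT \<omega>|M. kill (\<sigma> n) \<mu> T \<omega> - exp (- (\<mu> * L \<omega>))\<bar>"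
        unfolding gk_def using i1 iL by simp
      also have "\<dots> \<le> (LINT \<omega>|M. \<mu> * d + \<mu> / d * (occ (\<sigma> n) T \<omega> - L \<omega>)\<^sup>2)"
        unfolding real_norm_def[symmetric]
      proof (rule order_trans[OF integral_norm_bound integral_mono_AE])
        show "integrable M (\<lambda>\<omega>. norm (kill (\<sigma> n) \<mu> T \<omega> - exp (- (\<mu> * L \<omega>))))"
          by (intro integrable_norm Bochner_Integration.integrable_diff i1 iL)
        show "integrable M (\<lambda>\<omega>. \<mu> * d + \<mu> / d * (occ (\<sigma> n) T \<omega> - L \<omega>)\<^sup>2)"
          by (intro Bochner_Integration.integrable_add integrable_mult_right i2) simp
        show "AE \<omega> in M. norm (kill (\<sigma> n) \<mu> T \<omega> - exp (- (\<mu> * L \<omega>))) \<le> \<mu> * d + \<mu> / d * (occ (\<sigma> n) T \<omega> - L \<omega>)\<^sup>2"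
          using L0
        proof eventually_elim
          case (elim \<omega>)
          define a where "a = occ (\<sigma> n) T \<omega>"
          have a: "a \<ge> 0" unfolding a_def by (rule occ_nonneg)
          have lip: "exp (- (\<mu> * x)) - exp (- (\<mu> * y)) \<le> \<mu> * \<bar>x - y\<bar>" if "0 \<le> x" "0 \<le> y" for x y
          proof -
            have "exp (- (\<mu> * x)) * (1 - exp (\<mu> * x - \<mu> * y)) \<le> 1 * \<bar>\<mu> * x - \<mu> * y\<bar>"
            proof (cases "\<mu> * x \<le> \<mu> * y")
              case True
              have "1 - exp (\<mu> * x - \<mu> * y) \<le> \<bar>\<mu> * x - \<mu> * y\<bar>"
              proof -
                have "1 + (\<mu> * x - \<mu> * y) \<le> exp (\<mu> * x - \<mu> * y)" by (rule exp_ge_add_one_self)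
                then show ?thesis by linarith
              qed
              then show ?thesis using True that \<mu> by (intro mult_mono) auto
            next
              case False
              then have "exp (- (\<mu> * x)) * (1 - exp (\<mu> * x - \<mu> * y)) \<le> 0" by (intro mult_nonneg_nonpos) auto
              then show ?thesis by simp
            qed
            also have "\<bar>\<mu> * x - \<mu> * y\<bar> = \<mu> * \<bar>x - y\<bar>"
              unfolding right_diff_distrib[symmetric] abs_mult using \<mu> by simp
            finally show ?thesis by (simp add: right_diff_distrib exp_add[symmetric])
          qed
          have "norm (exp (- (\<mu> * a)) - exp (- (\<mu> * L \<omega>))) \<le> \<mu> * \<bar>a - L \<omega>\<bar>"
            using lip[OF a elim] lip[OF elim a] by (simp add: abs_le_iff abs_minus_commute)
          also have "\<dots> \<le> \<mu> * (d + (a - L \<omega>)\<^sup>2 / d)"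
          proof (intro mult_left_mono)
            define b where "b = \<bar>a - L \<omega>\<bar>"
            have "b * d \<le> d * d + b\<^sup>2"
            proof (cases "b \<le> d")
              case True
              then have "b * d \<le> d * d" using d(1) by (intro mult_right_mono) auto
              then show ?thesis using zero_le_power2[of b] by linarith
            next
              case False
              then have "b * d \<le> b * b" using d(1) by (intro mult_left_mono) auto
              then show ?thesis using d(1) mult_pos_pos[OF d(1) d(1)] unfolding power2_eq_square by linarith
            qed
            then have "b \<le> (d * d + b\<^sup>2) / d" using d(1) by (simp add: pos_le_divide_eq)
            also have "\<dots> = d + b\<^sup>2 / d" using d(1) by (simp add: add_divide_distrib)
            finally show "\<bar>a - L \<omega>\<bar> \<le> d + (a - L \<omega>)\<^sup>2 / d" unfolding b_def by simp
          qed (use \<mu> in simp)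
          finally show ?case unfolding kill_def a_def by (simp add: distrib_left)
        qed
      qed
      also have "\<dots> = \<mu> * d + \<mu> / d * I n"
        unfolding I_def using i2 by (subst Bochner_Integration.integral_add) (auto simp: prob_space)
      also have "\<dots> < r" using elim(1) d(2) by linarith
      finally show ?case by (simp add: dist_real_def)
    qed
  qed
qed

text \<open>For each \<mu> the width is chosen so small that \<mu> times the error, at time
  \<open>T\<close> as well as in finitely many transforms, is at most \<open>1 / \<mu>\<close>. The
  resulting \<open>g \<mu>\<close> are decreasing functions of time, to which the inversion applies,
  and at \<open>T\<close> they shadow \<open>\<mu> * h \<mu>\<close>.\<close>

lemma local_time_laplace_limit:
  assumes le: "levy_exponent psi" and L: "is_collision_local_time M X Y T L" and T: "T > 0"
  shows "((\<lambda>\<mu>. \<mu> * (LINT \<omega>|M. exp (- (\<mu> * L \<omega>)))) \<longlongrightarrow> levy_exponent.tail psi T) at_top"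
proof -
  interpret E: levy_exponent psi by (rule le)
  define \<sigma> where "\<sigma> n = sqrt (1 / (real n + 1))" for n
  have \<sigma>: "\<And>n. \<sigma> n > 0" unfolding \<sigma>_def by simp
  have \<sigma>0: "\<sigma> \<longlonglongrightarrow> 0" unfolding \<sigma>_def by real_asymp
  define h where "h \<mu> = (LINT \<omega>|M. exp (- (\<mu> * L \<omega>)))" for \<mu>
  define G where "G n \<mu> k = (LINT t:{0<..}|lborel. exp (- (real (Suc k) * t)) * gk (\<sigma> n) \<mu> t)" for n \<mu> k
  define G0 where "G0 \<mu> k = 2 * pi / (real (Suc k) * (2 * pi + \<mu> * E.res (real (Suc k))))" for \<mu> k
  \<comment> \<open>Finitely many \<open>k\<close> can be handled at once; their range grows with
    \<mu> and so eventually contains every fixed \<open>k\<close>. The precision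
    \<open>1 / \<mu>\<^sup>2\<close> leaves \<open>1 / \<mu>\<close> after multiplication by
    \<mu>.\<close>
  have "\<exists>n. \<bar>gk (\<sigma> n) \<mu> T - h \<mu>\<bar> < 1 / \<mu>\<^sup>2 \<and> (\<forall>k\<in>{..nat \<lceil>\<mu>\<rceil>}. \<bar>G n \<mu> k - G0 \<mu> k\<bar> < 1 / \<mu>\<^sup>2)" if \<mu>: "\<mu> > 0" for \<mu>
  proof -
    have p: "1 / \<mu>\<^sup>2 > 0" using \<mu> by simp
    have "(\<lambda>n. gk (\<sigma> n) \<mu> T) \<longlonglongrightarrow> h \<mu>"
      unfolding \<sigma>_def h_def by (rule collision_local_time_limits(2)[OF L \<mu>])
    then have 1: "\<forall>\<^sub>F n in sequentially. \<bar>gk (\<sigma> n) \<mu> T - h \<mu>\<bar> < 1 / \<mu>\<^sup>2"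
      using tendstoD[OF _ p] by (fastforce simp: dist_real_def)
    have "(\<lambda>n. G n \<mu> k) \<longlonglongrightarrow> G0 \<mu> k" for k
      unfolding G_def G0_def by (rule gk_laplace_limit[OF le \<sigma> \<sigma>0 \<mu>]) simp
    then have "\<forall>\<^sub>F n in sequentially. \<bar>G n \<mu> k - G0 \<mu> k\<bar> < 1 / \<mu>\<^sup>2" for k
      using tendstoD[OF _ p] by (fastforce simp: dist_real_def)
    then have "\<forall>\<^sub>F n in sequentially. \<forall>k\<in>{..nat \<lceil>\<mu>\<rceil>}. \<bar>G n \<mu> k - G0 \<mu> k\<bar> < 1 / \<mu>\<^sup>2"
      by (intro eventually_ball_finite) auto
    from eventually_conj[OF 1 this] show ?thesis by (auto simp: eventually_sequentially)
  qed
  then obtain N where N: "\<And>\<mu>. \<mu> > 0 \<Longrightarrow> \<bar>gk (\<sigma> (N \<mu>)) \<mu> T - h \<mu>\<bar> < 1 / \<mu>\<^sup>2"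
      "\<And>\<mu> k. \<mu> > 0 \<Longrightarrow> k \<le> nat \<lceil>\<mu>\<rceil> \<Longrightarrow> \<bar>G (N \<mu>) \<mu> k - G0 \<mu> k\<bar> < 1 / \<mu>\<^sup>2"
    by (metis atMost_iff)
  define g where "g \<mu> t = \<mu> * gk (\<sigma> (N \<mu>)) \<mu> t" for \<mu> t
  have inv0: "((\<lambda>\<mu>::real. 1 / \<mu>) \<longlongrightarrow> 0) at_top" by real_asymp
  have A: "((\<lambda>\<mu>. g \<mu> T) \<longlongrightarrow> E.tail T) at_top"
  proof (rule laplace_convergence_monotone[where \<sigma>="-1" and f=E.tail and g=g and T=T])
    show "\<forall>\<^sub>F \<mu> in at_top. set_integrable lborel {0<..} (\<lambda>t. exp (- t) * g \<mu> t) \<and> (\<forall>t>0. 0 \<le> g \<mu> t)"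
      using eventually_gt_at_top[of 0]
    proof eventually_elim
      case (elim \<mu>)
      have "set_integrable lborel {0<..} (\<lambda>t. \<mu> * (exp (- (1 * t)) * gk (\<sigma> (N \<mu>)) \<mu> t))"
        using elim by (intro set_integrable_mult_right gk_weight_integrable) auto
      then show ?case using elim gk_bounds(1)[of \<mu>] by (auto simp: g_def mult_ac)
    qed
    show "set_integrable lborel {0<..} (\<lambda>t. exp (- t) * E.tail t)"
      using E.tail_laplace(1)[OF zero_less_one] unfolding mult_1_left .
    show "isCont E.tail T" by (rule E.isCont_tail[OF T])
    show "\<forall>\<^sub>F \<mu> in at_top. \<forall>s t. 0 < s \<and> s \<le> t \<longrightarrow> - 1 * g \<mu> s \<le> - 1 * g \<mu> t"
      using eventually_gt_at_top[of 0]
    proof eventually_elim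
      case (elim \<mu>)
      show ?case
      proof (intro allI impI)
        fix s t :: real assume st: "0 < s \<and> s \<le> t"
        have "gk (\<sigma> (N \<mu>)) \<mu> t \<le> gk (\<sigma> (N \<mu>)) \<mu> s"
          by (rule gk_antimono[OF \<sigma>]) (use elim st in simp_all)
        then have "\<mu> * gk (\<sigma> (N \<mu>)) \<mu> t \<le> \<mu> * gk (\<sigma> (N \<mu>)) \<mu> s"
          using elim by (intro mult_left_mono) simp_all
        then show "- 1 * g \<mu> s \<le> - 1 * g \<mu> t" unfolding g_def by simp
      qed
    qed
    fix k
    define q where "q = real (Suc k)"
    have q: "q > 0" unfolding q_def by simp
    have r: "E.res q > 0" by (rule E.res_pos[OF q])
    have a: "((\<lambda>\<mu>. \<mu> * G0 \<mu> k) \<longlongrightarrow> 2 * pi / (q * E.res q)) at_top"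
    proof -
      have 1: "((\<lambda>\<mu>. (a / q) / (a * (1 / \<mu>) + b)) \<longlongrightarrow> (a / q) / (a * 0 + b)) at_top" if "b > 0" for a b :: real
        by (intro tendsto_intros inv0) (use that q in auto)
      have 2: "\<forall>\<^sub>F \<mu> in at_top. (a / q) / (a * (1 / \<mu>) + b) = \<mu> * (a / (q * (a + \<mu> * b)))" for a b :: real
        using eventually_gt_at_top[of 0] by eventually_elim (simp add: field_simps)
      from Lim_transform_eventually[OF 1[OF r] 2, of "2 * pi"]
      show ?thesis unfolding G0_def q_def[symmetric] by simp
    qed
    have b: "((\<lambda>\<mu>. \<mu> * G (N \<mu>) \<mu> k - \<mu> * G0 \<mu> k) \<longlongrightarrow> 0) at_top"
    proof (rule Lim_null_comparison[OF _ inv0])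
      show "\<forall>\<^sub>F \<mu> in at_top. norm (\<mu> * G (N \<mu>) \<mu> k - \<mu> * G0 \<mu> k) \<le> 1 / \<mu>"
        using eventually_ge_at_top[of "max 1 (real k)"]
      proof eventually_elim
        case (elim \<mu>)
        then have \<mu>: "\<mu> > 0" and k: "k \<le> nat \<lceil>\<mu>\<rceil>" by linarith+
        have "norm (\<mu> * G (N \<mu>) \<mu> k - \<mu> * G0 \<mu> k) = \<mu> * \<bar>G (N \<mu>) \<mu> k - G0 \<mu> k\<bar>"
          unfolding right_diff_distrib[symmetric] using \<mu> by (simp add: abs_mult)
        also have "\<dots> \<le> \<mu> * (1 / \<mu>\<^sup>2)" using N(2)[OF \<mu> k] \<mu> by (intro mult_left_mono) auto
        finally show ?case using \<mu> by (simp add: power2_eq_square)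
      qed
    qed
    have "((\<lambda>\<mu>. (\<mu> * G (N \<mu>) \<mu> k - \<mu> * G0 \<mu> k) + \<mu> * G0 \<mu> k) \<longlongrightarrow> 0 + 2 * pi / (q * E.res q)) at_top"
      by (rule tendsto_add[OF b a])
    then have c: "((\<lambda>\<mu>. \<mu> * G (N \<mu>) \<mu> k) \<longlongrightarrow> 2 * pi / (q * E.res q)) at_top" by simp
    have d: "\<mu> * G (N \<mu>) \<mu> k = (LINT t:{0<..}|lborel. exp (- (q * t)) * g \<mu> t)" for \<mu>
      unfolding G_def g_def q_def set_integral_mult_right[symmetric] by (simp add: mult_ac)
    show "((\<lambda>\<mu>. LINT t:{0<..}|lborel. exp (- (real (Suc k) * t)) * g \<mu> t) \<longlongrightarrow>
       (LINT t:{0<..}|lborel. exp (- (real (Suc k) * t)) * E.tail t)) at_top"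
      unfolding q_def[symmetric] E.tail_laplace(2)[OF q] d[symmetric] by (rule c)
  qed (use T in auto)
  have "((\<lambda>\<mu>. \<mu> * h \<mu> - g \<mu> T) \<longlongrightarrow> 0) at_top"
  proof (rule Lim_null_comparison[OF _ inv0])
    show "\<forall>\<^sub>F \<mu> in at_top. norm (\<mu> * h \<mu> - g \<mu> T) \<le> 1 / \<mu>"
      using eventually_gt_at_top[of 0]
    proof eventually_elim
      case (elim \<mu>)
      have "norm (\<mu> * h \<mu> - g \<mu> T) = \<mu> * \<bar>gk (\<sigma> (N \<mu>)) \<mu> T - h \<mu>\<bar>"
        unfolding g_def right_diff_distrib[symmetric] using elim by (simp add: abs_mult abs_minus_commute)
      also have "\<dots> \<le> \<mu> * (1 / \<mu>\<^sup>2)" using N(1)[OF elim] elim by (intro mult_left_mono) auto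
      finally show ?case using elim by (simp add: power2_eq_square)
    qed
  qed
  note B = this
  have "((\<lambda>\<mu>. g \<mu> T + (\<mu> * h \<mu> - g \<mu> T)) \<longlongrightarrow> E.tail T + 0) at_top" by (rule tendsto_add[OF A B])
  then have "((\<lambda>\<mu>. \<mu> * h \<mu>) \<longlongrightarrow> E.tail T) at_top" by simp
  then show ?thesis unfolding h_def .
qed

end

section \<open>Sums of two stable exponents and the explicit constant\<close>

lemma integrable_abs_powr_tail:
  assumes a: "a > (1::real)"
  shows "integrable lborel (\<lambda>v::real. indicator {v. 1 \<le> \<bar>v\<bar>} v * \<bar>v\<bar> powr (- a))"
proof -
  have "(\<lambda>s::real. s powr (- a)) integrable_on {1..}"
    using has_integral_powr_to_inf[of "- a" 1] a by (auto simp: integrable_on_def)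
  then have "(\<lambda>s::real. s powr (- a)) absolutely_integrable_on {1..}"
    by (intro nonnegative_absolutely_integrable_1) auto
  then have 1: "integrable lborel (\<lambda>s::real. indicator {1..} s * s powr (- a))" unfolding set_integrable_def
    by (subst (asm) integrable_completion) auto
  have 2: "integrable lborel (\<lambda>s::real. indicator {1..} (0 + (- 1) * s) * (0 + (- 1) * s) powr (- a))"
    by (rule lborel_integrable_real_affine[OF 1]) simp
  have e: "indicator {v. 1 \<le> \<bar>v\<bar>} v * \<bar>v\<bar> powr (- a)
      = indicator {1..} v * v powr (- a) + indicator {1..} (0 + (- 1) * v) * (0 + (- 1) * v) powr (- a)" for v :: real
    by (auto simp: indicator_def abs_if)
  show ?thesis unfolding e by (rule Bochner_Integration.integrable_add[OF 1 2])
qed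

text \<open>Indices at most 2 give the quadratic bound; integrability at infinity comes from the
  larger index, which exceeds 1.\<close>

lemma stable_sum_levy_exponent:
  assumes a: "\<alpha>\<^sub>1 \<in> {0<..2}" "\<alpha>\<^sub>2 \<in> {0<..2}" "max \<alpha>\<^sub>1 \<alpha>\<^sub>2 > (1::real)"
  shows "levy_exponent (\<lambda>v. \<bar>v\<bar> powr \<alpha>\<^sub>1 + \<bar>v\<bar> powr \<alpha>\<^sub>2)"
proof
  define \<psi> where "\<psi> v = \<bar>v\<bar> powr \<alpha>\<^sub>1 + \<bar>v\<bar> powr \<alpha>\<^sub>2" for v :: real
  have m: "\<psi> \<in> borel_measurable borel" unfolding \<psi>_def by measurable
  then show "(\<lambda>v. \<bar>v\<bar> powr \<alpha>\<^sub>1 + \<bar>v\<bar> powr \<alpha>\<^sub>2) \<in> borel_measurable borel" unfolding \<psi>_def .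
  fix v :: real
  show "0 \<le> \<bar>v\<bar> powr \<alpha>\<^sub>1 + \<bar>v\<bar> powr \<alpha>\<^sub>2" by simp
  show "v \<noteq> 0 \<Longrightarrow> 0 < \<bar>v\<bar> powr \<alpha>\<^sub>1 + \<bar>v\<bar> powr \<alpha>\<^sub>2" by (simp add: add_pos_pos)
  have b: "\<bar>v\<bar> powr b \<le> 1 + v\<^sup>2" if b: "0 < b" "b \<le> 2" for b
  proof (cases "\<bar>v\<bar> \<le> 1")
    case True
    then have "\<bar>v\<bar> powr b \<le> 1" using b by (intro powr_le1) auto
    then show ?thesis using zero_le_power2[of v] by linarith
  next
    case False
    then have "\<bar>v\<bar> powr b \<le> \<bar>v\<bar> powr 2" using b by (intro powr_mono) auto
    also have "\<dots> = v\<^sup>2" using False by (simp add: powr_numeral)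
    finally show ?thesis by simp
  qed
  show "\<bar>v\<bar> powr \<alpha>\<^sub>1 + \<bar>v\<bar> powr \<alpha>\<^sub>2 \<le> 2 * (1 + v\<^sup>2)" using b[of \<alpha>\<^sub>1] b[of \<alpha>\<^sub>2] a by simp
  define c where "c = max \<alpha>\<^sub>1 \<alpha>\<^sub>2"
  have c: "c > 1" unfolding c_def by (rule a(3))
  have i: "integrable lborel (\<lambda>v::real. indicator {- 1..1} v + indicator {v. 1 \<le> \<bar>v\<bar>} v * \<bar>v\<bar> powr (- c))"
    by (rule Bochner_Integration.integrable_add[OF _ integrable_abs_powr_tail[OF c]]) (simp add: emeasure_lborel_Icc_eq)
  have "integrable lborel (\<lambda>v. 1 / (1 + \<psi> v))"
  proof (rule Bochner_Integration.integrable_bound[OF i])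
    show "AE v in lborel. norm (1 / (1 + \<psi> v)) \<le> norm (indicator {- 1..1} v + indicator {v. 1 \<le> \<bar>v\<bar>} v * \<bar>v\<bar> powr (- c))"
    proof (intro always_eventually allI)
      fix v :: real
      have p: "0 \<le> \<psi> v" "\<bar>v\<bar> powr c \<le> \<psi> v" unfolding \<psi>_def c_def by (auto simp: max_def)
      have "1 / (1 + \<psi> v) \<le> indicator {- 1..1} v + indicator {v. 1 \<le> \<bar>v\<bar>} v * \<bar>v\<bar> powr (- c)"
      proof (cases "\<bar>v\<bar> \<le> 1")
        case True
        then have "v \<in> {- 1..1}" by auto
        moreover have "1 / (1 + \<psi> v) \<le> 1" using p by simp
        ultimately show ?thesis by (simp add: indicator_def add_increasing2)
      next
        case False
        then have "0 < \<bar>v\<bar> powr c" by simp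
        then have "1 / (1 + \<psi> v) \<le> 1 / \<bar>v\<bar> powr c" using p by (intro frac_le) auto
        then show ?thesis using False by (simp add: indicator_def powr_minus_divide)
      qed
      moreover have "0 \<le> 1 / (1 + \<psi> v)" using p by simp
      ultimately show "norm (1 / (1 + \<psi> v)) \<le> norm (indicator {- 1..1} v + indicator {v. 1 \<le> \<bar>v\<bar>} v * \<bar>v\<bar> powr (- c))"
        by simp
    qed
    show "(\<lambda>v. 1 / (1 + \<psi> v)) \<in> borel_measurable lborel" using m by measurable
  qed
  then show "integrable lborel (\<lambda>v. 1 / (1 + (\<bar>v\<bar> powr \<alpha>\<^sub>1 + \<bar>v\<bar> powr \<alpha>\<^sub>2)))" unfolding \<psi>_def .
qed

text \<open>On (0, 1] both powers are at most \<open>v\<close>, so the integrand is at least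
  \<open>1 / (2 * v)\<close> there and diverges logarithmically at 0.\<close>

lemma not_integrable_inverse_stable_sum:
  assumes a: "\<alpha>\<^sub>1 \<ge> 1" "\<alpha>\<^sub>2 \<ge> (1::real)"
  shows "\<not> integrable lborel (\<lambda>v::real. 1 / (\<bar>v\<bar> powr \<alpha>\<^sub>1 + \<bar>v\<bar> powr \<alpha>\<^sub>2))"
proof
  define \<psi> where "\<psi> v = \<bar>v\<bar> powr \<alpha>\<^sub>1 + \<bar>v\<bar> powr \<alpha>\<^sub>2" for v :: real
  assume "integrable lborel (\<lambda>v::real. 1 / (\<bar>v\<bar> powr \<alpha>\<^sub>1 + \<bar>v\<bar> powr \<alpha>\<^sub>2))"
  then have i: "integrable lborel (\<lambda>v. 1 / \<psi> v)" unfolding \<psi>_def .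
  define C where "C = 2 * (LINT v|lborel. 1 / \<psi> v)"
  have le: "real n \<le> C" for n
  proof -
    \<comment> \<open>The cut-off \<open>exp (- real n)\<close> makes the integral of
      \<open>1 / v\<close> up to 1 equal to \<open>n\<close>.\<close>
    have e: "0 < exp (- real n)" "exp (- real n) \<le> 1" by auto
    have d: "(ln has_vector_derivative 1 / x) (at x within {exp (- real n)..1})" if "x \<in> {exp (- real n)..1}" for x
    proof -
      have "x > 0" using that by (auto intro: less_le_trans[OF exp_gt_zero])
      then have "(ln has_real_derivative 1 / x) (at x)" by (rule DERIV_ln_divide)
      then show ?thesis
        unfolding has_real_derivative_iff_has_vector_derivative by (rule has_vector_derivative_at_within)
    qed
    have c: "continuous_on {exp (- real n)..1} (\<lambda>x::real. 1 / x)"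
      using e by (intro continuous_intros) auto
    have "has_bochner_integral lborel (\<lambda>x. indicator {exp (- real n)..1} x *\<^sub>R (1 / x)) (ln 1 - ln (exp (- real n)))"
      using d c by (intro has_bochner_integral_FTC_Icc[OF e(2)]) auto
    then have B: "integrable lborel (\<lambda>x. indicator {exp (- real n)..1} x *\<^sub>R (1 / x))"
       "(LINT x|lborel. indicator {exp (- real n)..1} x *\<^sub>R (1 / x)) = real n"
      by (auto simp: has_bochner_integral_iff)
    have "(LINT x|lborel. indicator {exp (- real n)..1} x *\<^sub>R (1 / x)) \<le> (LINT v|lborel. 2 * (1 / \<psi> v))"
    proof (rule integral_mono[OF B(1)])
      show "integrable lborel (\<lambda>v. 2 * (1 / \<psi> v))" by (rule integrable_mult_right[OF i])
      fix v :: real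
      show "indicator {exp (- real n)..1} v *\<^sub>R (1 / v) \<le> 2 * (1 / \<psi> v)"
      proof (cases "v \<in> {exp (- real n)..1}")
        case True
        then have v: "0 < v" "v \<le> 1" by (auto intro: less_le_trans[OF exp_gt_zero])
        have "v powr b \<le> v powr 1" if "1 \<le> b" for b by (rule powr_mono') (use that v in auto)
        from this[OF a(1)] this[OF a(2)] have "\<psi> v \<le> 2 * v" unfolding \<psi>_def using v by simp
        moreover have "0 < \<psi> v" unfolding \<psi>_def using v by (simp add: add_pos_pos)
        ultimately have "1 / (2 * v) \<le> 1 / \<psi> v" by (intro frac_le) auto
        then show ?thesis using True v by simp
      qed (simp add: \<psi>_def)
    qed
    also have "\<dots> = C" unfolding C_def by (rule integral_mult_right_zero)
    finally show ?thesis unfolding B(2) .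
  qed
  obtain n where "real n > C" using reals_Archimedean2 by blast
  then show False using le[of n] by linarith
qed

text \<open>The substitution \<open>r = T * s\<close>, under which \<open>Phi\<close> becomes
  \<open>resC\<close> divided by \<open>T\<close>. The numerator of \<open>main_term\<close> uses
  the conjugate ray and the denominator a squared modulus, which together form
  \<open>1 / R = cnj R / (cmod R)\<^sup>2\<close>, while the two exponential factors are the phase
  and the modulus of \<open>exp (of_real (T * s) * \<omega>)\<close>.\<close>

lemma main_term_eq:
  assumes a: "\<alpha>\<^sub>1 \<in> {0<..2}" "\<alpha>\<^sub>2 \<in> {0<..2}" "max \<alpha>\<^sub>1 \<alpha>\<^sub>2 > (1::real)" and T: "T > 0"
  defines "\<psi> \<equiv> \<lambda>v. \<bar>v\<bar> powr \<alpha>\<^sub>1 + \<bar>v\<bar> powr \<alpha>\<^sub>2"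
  shows "main_term \<alpha>\<^sub>1 \<alpha>\<^sub>2 T = 2 * (LINT s:{0<..}|lborel. levy_exponent.ray_integrand \<psi> T s)"
proof -
  interpret E: levy_exponent \<psi> unfolding \<psi>_def by (rule stable_sum_levy_exponent[OF a])
  define \<omega> where "\<omega> = cis (3 * pi / 4)"
  have w1: "exp (\<i> * of_real (3 * pi / 4)) = \<omega>" unfolding \<omega>_def by (simp add: cis_conv_exp)
  have w2: "exp (- \<i> * of_real (3 * pi / 4)) = cnj \<omega>"
  proof -
    have "exp (- \<i> * of_real (3 * pi / 4)) = cis (- (3 * pi / 4))" by (simp add: cis_conv_exp)
    then show ?thesis unfolding \<omega>_def by (simp only: cis_cnj)
  qed
  have Phi: "Phi \<alpha>\<^sub>1 \<alpha>\<^sub>2 T (of_real T * z) = E.resC z / of_real T" for z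
  proof -
    have "1 / (of_real T * z + of_real (T * \<bar>v\<bar> powr \<alpha>\<^sub>1) + of_real (T * \<bar>v\<bar> powr \<alpha>\<^sub>2)) = 1 / (z + of_real (\<psi> v)) / of_real T" for v
    proof -
      have "of_real T * z + of_real (T * \<bar>v\<bar> powr \<alpha>\<^sub>1) + of_real (T * \<bar>v\<bar> powr \<alpha>\<^sub>2) = (z + of_real (\<psi> v)) * of_real T"
        unfolding \<psi>_def by (simp add: algebra_simps)
      then show ?thesis by simp
    qed
    then show ?thesis unfolding Phi_def E.resC_def by (simp del: divide_divide_eq_left)
  qed
  define g where "g r = indicator {0<..} r *\<^sub>R
       (Im (exp (\<i> * of_real (r / sqrt 2)) * Phi \<alpha>\<^sub>1 \<alpha>\<^sub>2 T (of_real r * exp (- \<i> * of_real (3 * pi / 4))))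
         / (cmod (Phi \<alpha>\<^sub>1 \<alpha>\<^sub>2 T (of_real r * exp (\<i> * of_real (3 * pi / 4)))))\<^sup>2
         * (exp (- (1 / sqrt 2) * r) / r))" for r :: real
  have g: "g (T * s) = indicator {0<..} s *\<^sub>R E.ray_integrand T s" for s
  proof (cases "s > 0")
    case True
    define R where "R = E.resC (of_real s * \<omega>)"
    have Ts: "T * s > 0" using True T by simp
    have P1: "Phi \<alpha>\<^sub>1 \<alpha>\<^sub>2 T (of_real (T * s) * \<omega>) = R / of_real T"
      using Phi[of "of_real s * \<omega>"] unfolding R_def by (simp add: mult.assoc)
    have P2: "Phi \<alpha>\<^sub>1 \<alpha>\<^sub>2 T (of_real (T * s) * cnj \<omega>) = cnj R / of_real T"
    proof -
      have "E.resC (of_real s * cnj \<omega>) = cnj R" unfolding R_def E.resC_cnj[symmetric] by simp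
      then show ?thesis using Phi[of "of_real s * cnj \<omega>"] by (simp add: mult.assoc)
    qed
    have R0: "R \<noteq> 0" unfolding R_def \<omega>_def by (rule E.resC_nonzero[OF True]) simp
    have ex: "exp (of_real (T * s) * \<omega>) = exp (\<i> * of_real (T * s / sqrt 2)) * of_real (exp (- (1 / sqrt 2) * (T * s)))"
    proof -
      have "of_real (T * s) * \<omega> = \<i> * of_real (T * s / sqrt 2) + of_real (- (1 / sqrt 2) * (T * s))"
        unfolding \<omega>_def by (rule complex_eqI) (simp_all add: cis_three_quarters del: cis.sel)
      then show ?thesis by (simp only: exp_add exp_of_real)
    qed
    have q: "1 / R = cnj R / of_real ((cmod R)\<^sup>2)"
      using R0 by (simp add: complex_norm_square[symmetric] field_simps)
    have "E.ray_integrand T s = Im (exp (of_real (T * s) * \<omega>) * (1 / R)) / s"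
      unfolding E.ray_integrand_def \<omega>_def R_def by simp
    also have "exp (of_real (T * s) * \<omega>) * (1 / R)
       = of_real (exp (- (1 / sqrt 2) * (T * s)) / (cmod R)\<^sup>2) * (exp (\<i> * of_real (T * s / sqrt 2)) * cnj R)"
      unfolding ex q by simp
    also have "Im \<dots> = exp (- (1 / sqrt 2) * (T * s)) / (cmod R)\<^sup>2 * Im (exp (\<i> * of_real (T * s / sqrt 2)) * cnj R)"
      by (subst times_complex.sel(2)) simp
    finally have ray: "E.ray_integrand T s = exp (- (1 / sqrt 2) * (T * s)) / (cmod R)\<^sup>2 * Im (exp (\<i> * of_real (T * s / sqrt 2)) * cnj R) / s" .
    have im: "Im (exp (\<i> * of_real (T * s / sqrt 2)) * (cnj R / of_real T)) = Im (exp (\<i> * of_real (T * s / sqrt 2)) * cnj R) / T"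
      unfolding times_divide_eq_right by (rule Im_divide_of_real)
    have n: "(cmod (R / of_real T))\<^sup>2 = (cmod R)\<^sup>2 / T\<^sup>2" using T by (simp add: norm_divide power_divide)
    \<comment> \<open>The squared modulus supplies two powers of \<open>T\<close>, one of which is
      used up by the numerator and one by \<open>1 / r\<close>; the \<open>2 / T\<close> in front of
      the integral is later met by the Jacobian.\<close>
    have "g (T * s) = Im (exp (\<i> * of_real (T * s / sqrt 2)) * cnj R) / T / ((cmod R)\<^sup>2 / T\<^sup>2) * (exp (- (1 / sqrt 2) * (T * s)) / (T * s))"
      unfolding g_def w1 w2 P1 P2 im n using Ts by simp
    also have "\<dots> = E.ray_integrand T s"
      unfolding ray using T True R0 by (simp add: field_simps power2_eq_square)
    finally show ?thesis using True by simp
  next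
    case False
    then have "\<not> T * s > 0" using T by (simp add: zero_less_mult_iff)
    then show ?thesis using False unfolding g_def by simp
  qed
  have "(LINT r|lborel. g r) = \<bar>T\<bar> *\<^sub>R (LINT s|lborel. g (0 + T * s))"
    by (rule lborel_integral_real_affine) (use T in simp)
  also have "\<dots> = T * (LINT s:{0<..}|lborel. E.ray_integrand T s)"
    using T unfolding set_lebesgue_integral_def by (simp add: g)
  finally show ?thesis unfolding main_term_def set_lebesgue_integral_def[of _ _ "\<lambda>r. _ r / _ r * _ r"] g_def[symmetric]
    using T by (simp add: g_def set_lebesgue_integral_def)
qed

theorem theorem1p1:
  fixes M :: "'a measure" and F :: "real \<Rightarrow> 'a measure"
    and X Y :: "real \<Rightarrow> 'a \<Rightarrow> real" and L :: "'a \<Rightarrow> real"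
    and \<alpha>\<^sub>1 \<alpha>\<^sub>2 T :: real
  assumes "prob_space M" and "complete_measure M" and "filtration_on M F"
    and "T > 0"
    and "\<alpha>\<^sub>1 \<in> {0<..2}" and "\<alpha>\<^sub>2 \<in> {0<..2}" and "max \<alpha>\<^sub>1 \<alpha>\<^sub>2 > 1"
    and "symmetric_stable_process M F \<alpha>\<^sub>1 X"
    and "symmetric_stable_process M F \<alpha>\<^sub>2 Y"
    and "independent_processes M X Y"
    and "is_collision_local_time M X Y T L"
  shows "(min \<alpha>\<^sub>1 \<alpha>\<^sub>2 < 1 \<longrightarrow>
           ((\<lambda>\<epsilon>. inverse \<epsilon> * \<P>(\<omega> in M. L \<omega> \<le> \<epsilon>)) \<longlongrightarrow>
             main_term \<alpha>\<^sub>1 \<alpha>\<^sub>2 T +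
             3 * pi / (2 * (LINT v|lborel. 1 / (\<bar>v\<bar> powr \<alpha>\<^sub>1 + \<bar>v\<bar> powr \<alpha>\<^sub>2)))) (at_right 0)) \<and>
         (min \<alpha>\<^sub>1 \<alpha>\<^sub>2 \<ge> 1 \<longrightarrow>
           ((\<lambda>\<epsilon>. inverse \<epsilon> * \<P>(\<omega> in M. L \<omega> \<le> \<epsilon>)) \<longlongrightarrow> main_term \<alpha>\<^sub>1 \<alpha>\<^sub>2 T) (at_right 0))"
proof -
  interpret prob_space M by (rule assms(1))
  interpret stable_pair M F X Y \<alpha>\<^sub>1 \<alpha>\<^sub>2
    by unfold_locales (rule assms)+
  have psi: "psi = (\<lambda>v. \<bar>v\<bar> powr \<alpha>\<^sub>1 + \<bar>v\<bar> powr \<alpha>\<^sub>2)" by (intro ext) (rule psi_def)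
  have le: "levy_exponent psi" unfolding psi by (rule stable_sum_levy_exponent[OF assms(5-7)])
  interpret E: levy_exponent psi by (rule le)
  define I where "I = (LINT v|lborel. 1 / (\<bar>v\<bar> powr \<alpha>\<^sub>1 + \<bar>v\<bar> powr \<alpha>\<^sub>2))"
  have tail: "E.tail T = main_term \<alpha>\<^sub>1 \<alpha>\<^sub>2 T + 3 * pi / (2 * I)"
  proof -
    have "main_term \<alpha>\<^sub>1 \<alpha>\<^sub>2 T = 2 * (LINT s:{0<..}|lborel. E.ray_integrand T s)"
      using main_term_eq[OF assms(5-7,4)] unfolding psi .
    moreover have "I = (LINT v|lborel. 1 / psi v)" unfolding I_def psi ..
    ultimately show ?thesis unfolding E.tail_def by simp
  qed
  have Lm: "L \<in> borel_measurable M" using assms(11) unfolding is_collision_local_time_def by simp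
  have lim: "((\<lambda>\<epsilon>. inverse \<epsilon> * \<P>(\<omega> in M. L \<omega> \<le> \<epsilon>)) \<longlongrightarrow> main_term \<alpha>\<^sub>1 \<alpha>\<^sub>2 T + 3 * pi / (2 * I)) (at_right 0)"
    unfolding tail[symmetric]
    by (rule karamata_small_values[OF Lm collision_local_time_limits(1)[OF assms(11)]
          local_time_laplace_limit[OF le assms(11,4)]])
  \<comment> \<open>A Bochner integral that does not exist is 0, and so is a quotient by 0: the
    extra term disappears from the common formula.\<close>
  moreover have "I = 0" if "min \<alpha>\<^sub>1 \<alpha>\<^sub>2 \<ge> 1"
    unfolding I_def using that by (intro not_integrable_integral_eq not_integrable_inverse_stable_sum) auto
  ultimately show ?thesis unfolding I_def by auto
qed

end
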